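(* Let $k$ be an integer weight, $N$ a positive integer level, and $c$ a positive integer. Let $\phi\in J_{k,cN}$ be a basic theta block (a theta block $\eta^{\varphi(0)}\prod_{r\ge1}(\vartheta_r/\eta)^{\varphi(r)}$ that is a weakly holomorphic Jacobi form of integral weight $k$ and nonnegative integral index $cN$, here moreover holomorphic). Then at most finitely many weakly holomorphic Jacobi forms $\psi\in J^{\mathrm{wh}}_{0,N}$ (of weight $0$ and index $N$, with integral singular Fourier coefficients) give rise to holomorphic Borcherds products $\mathrm{Borch}(\psi)\in M_k(K(N))$ with leading theta block $\phi$.
   Context: $K(N)$ is the paramodular group of degree $2$ and level $N$ (rational symplectic $4\times4$ matrices stabilizing the lattice $\mathbb Z\oplus\mathbb Z\oplus\mathbb Z\oplus N\mathbb Z$), and $M_k(K(N))$ is the space of weight-$k$ paramodular forms. For $\psi(\tau,z)=\sum c(n,r)q^n\zeta^r\in J^{\mathrm{wh}}_{0,N}$ ($q=e^{2\pi i\tau}$, $\zeta=e^{2\pi iz}$, $\xi=e^{2\pi i\omega}$), the Borcherds product of Gritsenko–Nikulin is $\mathrm{Borch}(\psi)(\Omega)=\mathrm{TB}(\varphi)(\tau,z)\,\xi^{C}\exp(-\mathrm{Grit}(\psi)(\Omega))$, where $\varphi(r)=c(0,r)$, $\mathrm{TB}(\varphi)=\eta^{\varphi(0)}\prod_{r\ge1}(\vartheta_r/\eta)^{\varphi(r)}$ with $\vartheta_r(\tau,z)=\vartheta(\tau,rz)$, $C=\frac12\sum_{r\ge1}r^2c(0,r)$, and $\mathrm{Grit}(\psi)=\sum_{m\ge1}(\psi|V_m)\xi^{mN}$.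 Its first nonzero Fourier–Jacobi coefficient, $\mathrm{TB}(\varphi)$, is called the leading theta block; here $C=cN$. *)

theory Defs
  imports "HOL-Analysis.Analysis"
begin

definition ee :: "complex \<Rightarrow> complex" where
  "ee x = exp (2 * of_real pi * \<i> * x)"

section \<open>Jacobi forms\<close>

definition jac_domain :: "(complex \<times> complex) set" where
  "jac_domain = {(\<tau>, z). Im \<tau> > 0}"

text \<open>Holomorphy in several variables: the real Frechet derivative exists and is complex linear.\<close>

definition holomorphic2_on :: "(complex \<times> complex \<Rightarrow> complex) \<Rightarrow> (complex \<times> complex) set \<Rightarrow> bool" where
  "holomorphic2_on f S \<longleftrightarrow>
     (\<forall>p\<in>S. \<exists>a b. (f has_derivative (\<lambda>(h1, h2). a * h1 + b * h2)) (at p))"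

definition holomorphic3_on ::
    "(complex \<times> complex \<times> complex \<Rightarrow> complex) \<Rightarrow> (complex \<times> complex \<times> complex) set \<Rightarrow> bool" where
  "holomorphic3_on f S \<longleftrightarrow>
     (\<forall>p\<in>S. \<exists>a b c. (f has_derivative (\<lambda>(h1, h2, h3). a * h1 + b * h2 + c * h3)) (at p))"

definition has_jac_expansion ::
    "(complex \<times> complex \<Rightarrow> complex) \<Rightarrow> (int \<Rightarrow> int \<Rightarrow> complex) \<Rightarrow> bool" where
  "has_jac_expansion f c \<longleftrightarrow>
     (\<forall>\<tau> z. Im \<tau> > 0 \<longrightarrow>
        ((\<lambda>(n, r). c n r * ee (of_int n * \<tau> + of_int r * z)) has_sum f (\<tau>, z)) UNIV)"

text \<open>The expansion is a Laurent series in \<open>q = ee \<tau>\<close> and \<open>\<zeta> = ee z\<close>, so its coefficients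
  are unique whenever it exists.\<close>

definition jac_coeff :: "(complex \<times> complex \<Rightarrow> complex) \<Rightarrow> int \<Rightarrow> int \<Rightarrow> complex" where
  "jac_coeff f = (THE c. has_jac_expansion f c)"

definition jacobi_transform :: "int \<Rightarrow> nat \<Rightarrow> (complex \<times> complex \<Rightarrow> complex) \<Rightarrow> bool" where
  "jacobi_transform k m f \<longleftrightarrow>
     (\<forall>a b c d :: int. \<forall>\<tau> z. a * d - b * c = 1 \<longrightarrow> Im \<tau> > 0 \<longrightarrow>
        f ((of_int a * \<tau> + of_int b) / (of_int c * \<tau> + of_int d), z / (of_int c * \<tau> + of_int d))
        = (of_int c * \<tau> + of_int d) powi k
          * ee (of_nat m * of_int c * z\<^sup>2 / (of_int c * \<tau> + of_int d)) * f (\<tau>, z)) \<and>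
     (\<forall>l \<mu> :: int. \<forall>\<tau> z. Im \<tau> > 0 \<longrightarrow>
        f (\<tau>, z + of_int l * \<tau> + of_int \<mu>)
        = ee (- (of_nat m * (of_int (l\<^sup>2) * \<tau> + 2 * of_int l * z))) * f (\<tau>, z))"

text \<open>Functions on the domain are represented by total functions that are \<open>undefined\<close> outside it
  (\<open>extensional\<close>), so that distinct elements are distinct as functions on the domain.\<close>

definition wh_jacobi_forms :: "int \<Rightarrow> nat \<Rightarrow> (complex \<times> complex \<Rightarrow> complex) set" where
  "wh_jacobi_forms k m = {f \<in> extensional jac_domain.
     holomorphic2_on f jac_domain \<and> jacobi_transform k m f \<and>
     (\<exists>c. has_jac_expansion f c \<and> (\<exists>n0. \<forall>n r. n < n0 \<longrightarrow> c n r = 0))}"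

definition jacobi_forms :: "int \<Rightarrow> nat \<Rightarrow> (complex \<times> complex \<Rightarrow> complex) set" where
  "jacobi_forms k m = {f \<in> wh_jacobi_forms k m.
     \<forall>n r. 4 * int m * n - r\<^sup>2 < 0 \<longrightarrow> jac_coeff f n r = 0}"

definition integral_singular_coeffs :: "nat \<Rightarrow> (complex \<times> complex \<Rightarrow> complex) \<Rightarrow> bool" where
  "integral_singular_coeffs m f \<longleftrightarrow>
     (\<forall>n r. 4 * int m * n - r\<^sup>2 \<le> 0 \<longrightarrow> jac_coeff f n r \<in> \<int>)"

text \<open>The index raising operator \<open>V\<^sub>m\<close> in weight \<open>k\<close>, written over the standard representatives
  (upper triangular with diagonal \<open>m/d, d\<close> and \<open>0 \<le> b < d\<close>) of the integral matrices of
  determinant \<open>m\<close> modulo the modular group; on coefficients it is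
  \<open>c(n,r) \<mapsto> \<Sum>\<^bsub>d | (n,r,m)\<^esub> d\<^bsup>k-1\<^esup> c(nm/d\<^sup>2, r/d)\<close>.\<close>

definition jacobi_V ::
    "int \<Rightarrow> nat \<Rightarrow> (complex \<times> complex \<Rightarrow> complex) \<Rightarrow> complex \<times> complex \<Rightarrow> complex" where
  "jacobi_V k m f = (\<lambda>(\<tau>, z).
     of_nat m powi (k - 1) *
     (\<Sum>d | d dvd m. \<Sum>b<d. of_nat d powi (- k) *
        f ((of_nat (m div d) * \<tau> + of_nat b) / of_nat d, of_nat (m div d) * z)))"

section \<open>Theta blocks\<close>

definition dedekind_eta :: "complex \<Rightarrow> complex" where
  "dedekind_eta \<tau> = ee (\<tau> / 24) * (\<Prod>n. 1 - ee (of_nat (Suc n) * \<tau>))"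

text \<open>The odd Jacobi theta function
  \<open>\<vartheta>(\<tau>,z) = q\<^bsup>1/8\<^esup> (\<zeta>\<^bsup>1/2\<^esup> - \<zeta>\<^bsup>-1/2\<^esup>) \<Prod>\<^bsub>n\<ge>1\<^esub> (1 - q\<^sup>n)(1 - q\<^sup>n \<zeta>)(1 - q\<^sup>n \<zeta>\<^bsup>-1\<^esup>)\<close>, by the
  triple product identity equal to \<open>\<Sum>\<^bsub>n\<^esub> (-1)\<^sup>n q\<^bsup>(2n+1)(2n+1)/8\<^esup> \<zeta>\<^bsup>(2n+1)/2\<^esup>\<close>.\<close>

definition jacobi_theta :: "complex \<Rightarrow> complex \<Rightarrow> complex" where
  "jacobi_theta \<tau> z = ee (\<tau> / 8) * (ee (z / 2) - ee (- z / 2)) *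
     (\<Prod>n. (1 - ee (of_nat (Suc n) * \<tau>)) *
           (1 - ee (of_nat (Suc n) * \<tau> + z)) * (1 - ee (of_nat (Suc n) * \<tau> - z)))"

text \<open>\<open>theta_block e\<close> is the pointwise value of
  \<open>\<eta>\<^bsup>e(0)\<^esup> \<Prod>\<^bsub>r\<ge>1\<^esub> (\<vartheta>\<^sub>r/\<eta>)\<^bsup>e(r)\<^esup>\<close>. It is only
  meaningful where no theta function in the denominator vanishes (\<open>theta_block_regular\<close>, a dense
  open subset of the domain); elsewhere the block may have a pole or a removable singularity.
  The product is intended for \<open>e\<close> of finite support.\<close>

definition theta_block :: "(nat \<Rightarrow> int) \<Rightarrow> complex \<Rightarrow> complex \<Rightarrow> complex" where
  "theta_block e \<tau> z = dedekind_eta \<tau> powi e 0 *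
     (\<Prod>r | 1 \<le> r \<and> e r \<noteq> 0. (jacobi_theta \<tau> (of_nat r * z) / dedekind_eta \<tau>) powi e r)"

definition theta_block_regular :: "(nat \<Rightarrow> int) \<Rightarrow> complex \<Rightarrow> complex \<Rightarrow> bool" where
  "theta_block_regular e \<tau> z \<longleftrightarrow>
     (\<forall>r\<ge>1. e r < 0 \<longrightarrow> jacobi_theta \<tau> (of_nat r * z) \<noteq> 0)"

text \<open>For \<open>f\<close> continuous on the domain this says that the meromorphic function given by the
  block extends to \<open>f\<close>.\<close>

definition is_theta_block :: "(nat \<Rightarrow> int) \<Rightarrow> (complex \<times> complex \<Rightarrow> complex) \<Rightarrow> bool" where
  "is_theta_block e f \<longleftrightarrow> finite {r. e r \<noteq> 0} \<and>
     (\<forall>\<tau> z. Im \<tau> > 0 \<longrightarrow> theta_block_regular e \<tau> z \<longrightarrow> f (\<tau>, z) = theta_block e \<tau> z)"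

definition basic_theta_block :: "int \<Rightarrow> nat \<Rightarrow> (complex \<times> complex \<Rightarrow> complex) \<Rightarrow> bool" where
  "basic_theta_block k m f \<longleftrightarrow> f \<in> wh_jacobi_forms k m \<and> (\<exists>e. is_theta_block e f)"

section \<open>Paramodular forms\<close>

definition siegel_point :: "complex \<Rightarrow> complex \<Rightarrow> complex \<Rightarrow> complex^2^2" where
  "siegel_point \<tau> z \<omega> = vector [vector [\<tau>, z], vector [z, \<omega>]]"

definition siegel_upper_half_space :: "(complex^2^2) set" where
  "siegel_upper_half_space = {\<Omega>. transpose \<Omega> = \<Omega> \<and>
     (\<forall>x :: real^2. x \<noteq> 0 \<longrightarrow> x \<bullet> ((\<chi> i j. Im (\<Omega> $ i $ j)) *v x) > 0)}"

definition symplectic_J :: "rat^4^4" where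
  "symplectic_J = vector [vector [0, 0, 1, 0], vector [0, 0, 0, 1],
                          vector [- 1, 0, 0, 0], vector [0, - 1, 0, 0]]"

definition paramodular_lattice :: "nat \<Rightarrow> (rat^4) set" where
  "paramodular_lattice N =
     {x. x $ 1 \<in> \<int> \<and> x $ 2 \<in> \<int> \<and> x $ 3 \<in> \<int> \<and> (\<exists>j\<in>\<int>. x $ 4 = of_nat N * j)}"

definition paramodular_group :: "nat \<Rightarrow> (rat^4^4) set" where
  "paramodular_group N = {g. transpose g ** symplectic_J ** g = symplectic_J \<and>
     (\<lambda>x. g *v x) ` paramodular_lattice N = paramodular_lattice N}"

text \<open>The 2 by 2 block of \<open>g\<close> with rows \<open>i1, i2\<close> and columns \<open>j1, j2\<close>.\<close>

definition block2 :: "rat^4^4 \<Rightarrow> 4 \<Rightarrow> 4 \<Rightarrow> 4 \<Rightarrow> 4 \<Rightarrow> complex^2^2" where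
  "block2 g i1 i2 j1 j2 = vector [vector [of_rat (g $ i1 $ j1), of_rat (g $ i1 $ j2)],
                                  vector [of_rat (g $ i2 $ j1), of_rat (g $ i2 $ j2)]]"

definition siegel_denom :: "rat^4^4 \<Rightarrow> complex^2^2 \<Rightarrow> complex^2^2" where
  "siegel_denom g \<Omega> = block2 g 3 4 1 2 ** \<Omega> + block2 g 3 4 3 4"

definition siegel_act :: "rat^4^4 \<Rightarrow> complex^2^2 \<Rightarrow> complex^2^2" where
  "siegel_act g \<Omega> = (block2 g 1 2 1 2 ** \<Omega> + block2 g 1 2 3 4) ** matrix_inv (siegel_denom g \<Omega>)"

text \<open>No condition at the cusps is needed, by the Koecher principle.\<close>

definition paramodular_forms :: "int \<Rightarrow> nat \<Rightarrow> (complex^2^2 \<Rightarrow> complex) set" where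
  "paramodular_forms k N = {F \<in> extensional siegel_upper_half_space.
     holomorphic3_on (\<lambda>(\<tau>, z, \<omega>). F (siegel_point \<tau> z \<omega>))
       {(\<tau>, z, \<omega>). siegel_point \<tau> z \<omega> \<in> siegel_upper_half_space} \<and>
     (\<forall>g\<in>paramodular_group N. \<forall>\<Omega>\<in>siegel_upper_half_space.
        F (siegel_act g \<Omega>) = det (siegel_denom g \<Omega>) powi k * F \<Omega>)}"

section \<open>Borcherds products\<close>

text \<open>The function \<open>r \<mapsto> c(0,r)\<close>, cast to integers; all \<open>c(0,r)\<close> are singular coefficients.\<close>

definition leading_exponents :: "(complex \<times> complex \<Rightarrow> complex) \<Rightarrow> nat \<Rightarrow> int" where
  "leading_exponents \<psi> r = \<lfloor>Re (jac_coeff \<psi> 0 (int r))\<rfloor>"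

definition borch_C :: "(complex \<times> complex \<Rightarrow> complex) \<Rightarrow> complex" where
  "borch_C \<psi> = (\<Sum>r | 1 \<le> r \<and> leading_exponents \<psi> r \<noteq> 0.
     of_nat (r\<^sup>2) * of_int (leading_exponents \<psi> r)) / 2"

definition grit_term ::
    "nat \<Rightarrow> (complex \<times> complex \<Rightarrow> complex) \<Rightarrow> complex \<Rightarrow> complex \<Rightarrow> complex \<Rightarrow> nat \<Rightarrow> complex" where
  "grit_term N \<psi> \<tau> z \<omega> m = jacobi_V 0 m \<psi> (\<tau>, z) * ee (of_nat (m * N) * \<omega>)"

text \<open>The defining expression \<open>TB(\<phi>)(\<tau>,z) \<xi>\<^sup>C exp(-Grit(\<psi>))\<close> only converges near the cusp: for
  each \<open>(\<tau>,z)\<close>, when the imaginary part of \<open>\<omega>\<close> is large. The Borcherds product is the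
  meromorphic continuation of this germ to the whole Siegel space; a holomorphic \<open>F\<close> on the Siegel
  space is that continuation iff it agrees with the germ, as follows.\<close>

definition is_borcherds_product ::
    "nat \<Rightarrow> (complex \<times> complex \<Rightarrow> complex) \<Rightarrow> (complex^2^2 \<Rightarrow> complex) \<Rightarrow> bool" where
  "is_borcherds_product N \<psi> F \<longleftrightarrow>
     (\<forall>\<tau> z. Im \<tau> > 0 \<longrightarrow> theta_block_regular (leading_exponents \<psi>) \<tau> z \<longrightarrow>
        (\<forall>\<^sub>F \<omega> in filtercomap Im at_top.
           summable (\<lambda>m. grit_term N \<psi> \<tau> z \<omega> (Suc m)) \<and>
           F (siegel_point \<tau> z \<omega>) = theta_block (leading_exponents \<psi>) \<tau> z * ee (borch_C \<psi> * \<omega>)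
             * exp (- (\<Sum>m. grit_term N \<psi> \<tau> z \<omega> (Suc m)))))"

definition has_leading_theta_block ::
    "(complex \<times> complex \<Rightarrow> complex) \<Rightarrow> (complex \<times> complex \<Rightarrow> complex) \<Rightarrow> bool" where
  "has_leading_theta_block \<psi> \<phi> \<longleftrightarrow> is_theta_block (leading_exponents \<psi>) \<phi>"

end

theory Submission
  imports Defs "HOL-Complex_Analysis.Complex_Analysis"
begin

text \<open>Expanding \<open>Borch(\<psi>)\<close> in powers of \<open>X = \<xi>\<^sup>N\<close>, the Fourier--Jacobi coefficients are
  \<open>\<phi> Q\<^sub>m\<close> with \<open>\<Sum> Q\<^sub>m X\<^sup>m = exp (- \<Sum> (\<psi> | V\<^sub>i) X\<^sup>i)\<close>, and Koecher's principle makes every \<open>\<phi> Q\<^sub>m\<close>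
  holomorphic at the cusps. The form \<open>\<psi>\<close> is determined by finitely many
  singular coefficients, which are integers. So if there were infinitely many \<open>\<psi>\<close>, these
  coefficients would be unbounded; rescaling \<open>\<psi>\<close> to norm \<open>1\<close> and passing to a limit \<open>D \<noteq> 0\<close>, only the
  monomial \<open>(- \<psi>)\<^sup>m / m!\<close> of \<open>Q\<^sub>m\<close> survives, because it is the only one of degree \<open>m\<close> in \<open>\<psi>\<close>. Hence
  \<open>\<phi> D\<^sup>m\<close> is holomorphic at the cusps for all \<open>m\<close>, which forces \<open>D\<close> itself to be a holomorphic Jacobi
  form of weight \<open>0\<close> and positive index. Such a form is zero.\<close>

section \<open>Fourier expansions\<close>

text \<open>The germ of \<open>F\<close> is known only where no theta function in a denominator
  vanishes and only for large \<open>Im \<omega>\<close>. The first restriction is met by working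
  along lines z = \<theta> \<tau> with \<theta> irrational, since the zeros of all theta functions
  have rational slope Im z / Im \<tau>. On such a line a single monomial dominates, so the least
  value of n + \<theta> r behaves like a valuation, additive on products. If E0 and E1 are the
  values for \<phi> and D, holomorphy of \<phi> D^m, of index (c + m) N, gives E0 + m E1 >= - (c +
  m) N \<theta>^2. Dividing by m leaves E1 >= - N \<theta>^2, and this for all irrational \<theta>
  in (0, 1) is holomorphy of D. The case m = 1 for \<psi> itself bounds its exponents in terms of
  \<phi> alone; this makes the finite list of singular coefficients the same for all \<psi>. The
  second restriction is met by periodicity in \<omega>: the Fourier-Jacobi coefficients are Taylor
  coefficients of a function on a larger disc, so bounds for \<open>F\<close> at any point of the
  Siegel space control them.\<close>

lemma ee_add: "ee (x + y) = ee x * ee y"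
  by (simp add: ee_def exp_add ring_distribs)

lemma ee_0 [simp]: "ee 0 = 1"
  by (simp add: ee_def)

lemma ee_nonzero [simp]: "ee x \<noteq> 0"
  by (simp add: ee_def)

lemma norm_ee: "norm (ee x) = exp (- 2 * pi * Im x)"
  by (simp add: ee_def)

lemma ee_eq_1_iff: "ee x = 1 \<longleftrightarrow> x \<in> \<int>"
  unfolding ee_def exp_eq_1 by (auto simp: complex_eq_iff Ints_def field_simps)

lemma ee_of_int [simp]: "ee (of_int n) = 1"
  by (simp add: ee_eq_1_iff)

lemma ee_power: "ee x ^ n = ee (of_nat n * x)"
  by (simp add: ee_def exp_of_nat_mult [symmetric] mult_ac)

lemma ee_minus: "ee (- x) = inverse (ee x)"
  by (simp add: ee_def exp_minus)

lemma cnj_ee: "cnj (ee x) = ee (- cnj x)"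
  by (simp add: ee_def exp_cnj)

section \<open>Roots of unity, Bessel's inequality and coefficient bounds\<close>

lemma ee_root_sum:
  fixes K :: nat and m :: int
  assumes "\<bar>m\<bar> < int K"
  shows "(\<Sum>j<K. ee (of_int m * (of_nat j / of_nat K))) = (if m = 0 then of_nat K else 0)"
proof (cases "m = 0")
  case False
  define w where "w = ee (of_int m / of_nat K)"
  have K: "K > 0" using assms by auto
  have "w \<noteq> 1"
  proof
    assume "w = 1"
    then obtain l where l: "complex_of_int m / of_nat K = of_int l"
      by (auto simp: w_def ee_eq_1_iff Ints_def)
    then have "complex_of_int m = of_int (l * int K)"
      using K by (simp add: field_simps)
    then have "m = l * int K" by (simp only: of_int_eq_iff)
    with assms False show False
      by (metis abs_mult abs_of_nat dvd_imp_le_int dvd_triv_right linorder_not_le)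
  qed
  have "(\<Sum>j<K. ee (of_int m * (of_nat j / of_nat K))) = (\<Sum>j<K. w ^ j)"
    by (intro sum.cong) (auto simp: w_def ee_power mult_ac)
  also have "\<dots> = 0"
  proof -
    have "w ^ K = 1" using K by (simp add: w_def ee_power)
    with \<open>w \<noteq> 1\<close> show ?thesis by (simp add: sum_gp_strict)
  qed
  finally show ?thesis using False by simp
qed auto

text \<open>Parseval's identity for a trigonometric polynomial, by averaging over a K by K grid of
  rational points in place of an integral: once K exceeds all differences of frequencies, the grid
  separates the characters exactly.\<close>

lemma bessel_finite:
  fixes b :: "int \<times> int \<Rightarrow> complex"
  assumes fin: "finite G"
    and bd: "\<And>u x :: real. norm (\<Sum>p\<in>G. b p * ee (of_int (fst p) * of_real u + of_int (snd p) * of_real x)) \<le> B"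
  shows "(\<Sum>p\<in>G. (norm (b p))\<^sup>2) \<le> B\<^sup>2"
proof -
  define R where "R = (\<Sum>p\<in>G. nat \<bar>fst p\<bar> + nat \<bar>snd p\<bar>)"
  \<comment> \<open>Frequencies have absolute value at most R, so their differences are at most 2 R
    < K, as \<open>ee_root_sum\<close> requires.\<close>
  define K where "K = 2 * R + 1"
  have R: "nat \<bar>fst p\<bar> + nat \<bar>snd p\<bar> \<le> R" if "p \<in> G" for p
    unfolding R_def using that fin by (intro member_le_sum) auto
  have K: "\<bar>fst p - fst q\<bar> < int K" "\<bar>snd p - snd q\<bar> < int K" if "p \<in> G" "q \<in> G" for p q
    using R[OF that(1)] R[OF that(2)] unfolding K_def by linarith+
  define e where "e = (\<lambda>p j k. ee (of_int (fst p) * (of_nat j / of_nat K) + of_int (snd p) * (of_nat k / of_nat K)))"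
  define g where "g = (\<lambda>j k. \<Sum>p\<in>G. b p * e p j k)"
  have gB: "norm (g j k) \<le> B" for j k
    using bd[of "real j / real K" "real k / real K"] by (simp add: g_def e_def)
  have cnj_e: "cnj (e p j k) = ee (- (of_int (fst p) * (of_nat j / of_nat K) + of_int (snd p) * (of_nat k / of_nat K)))" for p j k
    by (simp add: e_def cnj_ee)
  have orth: "(\<Sum>j<K. \<Sum>k<K. e p j k * cnj (e q j k)) = (if p = q then of_nat (K\<^sup>2) else 0)"
    if "p \<in> G" "q \<in> G" for p q
  proof -
    have "e p j k * cnj (e q j k) = ee (of_int (fst p - fst q) * (of_nat j / of_nat K))
        * ee (of_int (snd p - snd q) * (of_nat k / of_nat K))" for j k
      unfolding cnj_e unfolding e_def ee_add[symmetric] by (simp add: algebra_simps)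
    then have "(\<Sum>j<K. \<Sum>k<K. e p j k * cnj (e q j k)) =
       (\<Sum>j<K. ee (of_int (fst p - fst q) * (of_nat j / of_nat K))) *
       (\<Sum>k<K. ee (of_int (snd p - snd q) * (of_nat k / of_nat K)))"
      by (simp add: sum_product)
    also have "\<dots> = (if p = q then of_nat (K\<^sup>2) else 0)"
      unfolding ee_root_sum[OF K(1)[OF that]] ee_root_sum[OF K(2)[OF that]]
      by (auto simp: prod_eq_iff power2_eq_square)
    finally show ?thesis .
  qed
  have "complex_of_real (\<Sum>j<K. \<Sum>k<K. (norm (g j k))\<^sup>2) = (\<Sum>j<K. \<Sum>k<K. g j k * cnj (g j k))"
    by (simp add: complex_norm_square del: of_real_power)
  also have "\<dots> = (\<Sum>j<K. \<Sum>k<K. \<Sum>p\<in>G. \<Sum>q\<in>G. b p * cnj (b q) * (e p j k * cnj (e q j k)))"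
    unfolding g_def by (simp add: sum_product mult_ac)
  also have "\<dots> = (\<Sum>p\<in>G. \<Sum>q\<in>G. \<Sum>j<K. \<Sum>k<K. b p * cnj (b q) * (e p j k * cnj (e q j k)))"
    by (simp only: sum.swap[of _ G "{..<K}"])
  also have "\<dots> = (\<Sum>p\<in>G. \<Sum>q\<in>G. b p * cnj (b q) * (if p = q then of_nat (K\<^sup>2) else 0))"
    by (intro sum.cong refl) (simp only: sum_distrib_left[symmetric] orth)
  also have "\<dots> = (\<Sum>p\<in>G. b p * cnj (b p) * of_nat (K\<^sup>2))"
    by (intro sum.cong refl) (use fin in \<open>simp add: if_distrib sum.delta cong: if_cong\<close>)
  also have "\<dots> = of_real (real (K\<^sup>2) * (\<Sum>p\<in>G. (norm (b p))\<^sup>2))"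
    by (simp add: complex_norm_square sum_distrib_left mult_ac del: of_real_power) simp
  finally have eq: "(\<Sum>j<K. \<Sum>k<K. (norm (g j k))\<^sup>2) = real (K\<^sup>2) * (\<Sum>p\<in>G. (norm (b p))\<^sup>2)"
    by (simp only: of_real_eq_iff)
  have "(\<Sum>j<K. \<Sum>k<K. (norm (g j k))\<^sup>2) \<le> (\<Sum>j<K. \<Sum>k<K. B\<^sup>2)"
    by (intro sum_mono power_mono gB) auto
  also have "\<dots> = real (K\<^sup>2) * B\<^sup>2" by (simp add: power2_eq_square)
  finally show ?thesis unfolding eq by (simp add: K_def)
qed

lemma jac_abs_summable:
  assumes "has_jac_expansion f c" "Im \<tau> > 0"
  shows "(\<lambda>(n, r). norm (c n r) * exp (- 2 * pi * (of_int n * Im \<tau> + of_int r * Im z))) summable_on UNIV"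
proof -
  have "(\<lambda>(n, r). c n r * ee (of_int n * \<tau> + of_int r * z)) summable_on UNIV"
    using assms by (auto simp: has_jac_expansion_def summable_on_def)
  then have "(\<lambda>x. norm (case x of (n, r) \<Rightarrow> c n r * ee (of_int n * \<tau> + of_int r * z))) summable_on UNIV"
    by (rule summable_on_iff_abs_summable_on_complex[THEN iffD1])
  then show ?thesis
    by (simp add: norm_mult norm_ee case_prod_unfold)
qed

text \<open>With the imaginary parts v and y fixed, the damping factors can be absorbed into the
  coefficients \<open>b\<close>; what remains is a Fourier series in the real parts u and x.\<close>

lemma jac_bessel:
  assumes f: "has_jac_expansion f c" and v: "v > 0" and fin: "finite G"
    and bd: "\<And>u x :: real. norm (f (Complex u v, Complex x y)) \<le> B"
  shows "(\<Sum>(n, r)\<in>G. (norm (c n r) * exp (- 2 * pi * (of_int n * v + of_int r * y)))\<^sup>2) \<le> B\<^sup>2"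
proof -
  define b where "b = (\<lambda>p. c (fst p) (snd p) * ee (of_int (fst p) * Complex 0 v + of_int (snd p) * Complex 0 y))"
  have nb: "norm (b p) = norm (c (fst p) (snd p)) * exp (- 2 * pi * (of_int (fst p) * v + of_int (snd p) * y))" for p
    by (simp add: b_def norm_mult norm_ee)
  have sum: "(\<lambda>p. norm (b p)) summable_on UNIV"
    using jac_abs_summable[OF f, of "Complex 0 v" "Complex 0 y"] v by (simp add: nb case_prod_unfold)
  have hs: "((\<lambda>p. b p * ee (of_int (fst p) * of_real u + of_int (snd p) * of_real x)) has_sum f (Complex u v, Complex x y)) UNIV" for u x
  proof -
    have "b p * ee (of_int (fst p) * of_real u + of_int (snd p) * of_real x)
       = c (fst p) (snd p) * ee (of_int (fst p) * Complex u v + of_int (snd p) * Complex x y)" for p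
    proof -
      have 1: "Complex u v = of_real u + Complex 0 v" "Complex x y = of_real x + Complex 0 y"
        by (auto simp: complex_eq_iff)
      show ?thesis unfolding b_def mult.assoc ee_add[symmetric] 1 by (simp add: algebra_simps)
    qed
    then show ?thesis using f v by (simp add: has_jac_expansion_def case_prod_unfold)
  qed
  have B0: "B \<ge> 0" using bd[of 0 0] norm_ge_zero order_trans by blast
  \<comment> \<open>The series is cut down to a finite set H containing G whose complement
    contributes at most e; afterwards e tends to 0.\<close>
  have main: "(\<Sum>p\<in>G. (norm (b p))\<^sup>2) \<le> (B + e)\<^sup>2" if e: "e > 0" for e
  proof -
    from sum have "((\<lambda>p. norm (b p)) has_sum (\<Sum>\<^sub>\<infinity>p. norm (b p))) UNIV" by simp
    from has_sum_finite_approximation[OF this e]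
    obtain X where X: "finite X"
      and Xe: "dist (sum (\<lambda>p. norm (b p)) X) (\<Sum>\<^sub>\<infinity>p. norm (b p)) \<le> e" by auto
    define H where "H = X \<union> G"
    have H: "finite H" "X \<subseteq> H" "G \<subseteq> H" using X fin by (auto simp: H_def)
    have sH: "(\<lambda>p. norm (b p)) summable_on (- H)" using sum summable_on_subset_banach by blast
    have tail: "(\<Sum>\<^sub>\<infinity>p\<in>-H. norm (b p)) \<le> e"
    proof -
      have "(\<Sum>\<^sub>\<infinity>p. norm (b p)) = sum (\<lambda>p. norm (b p)) H + (\<Sum>\<^sub>\<infinity>p\<in>-H. norm (b p))"
        using infsum_Un_disjoint[of "\<lambda>p. norm (b p)" H "- H"] H sH by simp
      moreover have "sum (\<lambda>p. norm (b p)) X \<le> sum (\<lambda>p. norm (b p)) H"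
        using H by (intro sum_mono2) auto
      ultimately show ?thesis using Xe unfolding dist_real_def by linarith
    qed
    have "norm (\<Sum>p\<in>H. b p * ee (of_int (fst p) * of_real u + of_int (snd p) * of_real x)) \<le> B + e" for u x :: real
    proof -
      define t where "t = (\<lambda>p. b p * ee (of_int (fst p) * of_real u + of_int (snd p) * of_real x))"
      have ht: "(t has_sum f (Complex u v, Complex x y)) UNIV" unfolding t_def by (rule hs)
      have nt: "norm (t p) = norm (b p)" for p by (simp add: t_def norm_mult norm_ee)
      have st: "t summable_on A" for A
        using summable_on_subset_banach[OF has_sum_imp_summable[OF ht], of A] by simp
      have "infsum t (H \<union> - H) = infsum t H + infsum t (- H)"
        by (rule infsum_Un_disjoint[OF st st]) blast
      moreover have "infsum t (H \<union> - H) = f (Complex u v, Complex x y)"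
        unfolding Compl_partition by (rule infsumI[OF ht])
      ultimately have "sum t H = f (Complex u v, Complex x y) - infsum t (- H)"
        by (simp add: infsum_finite[OF H(1)] eq_diff_eq)
      then have "norm (sum t H) \<le> norm (f (Complex u v, Complex x y)) + norm (infsum t (- H))"
        by (metis norm_triangle_ineq4)
      moreover have "norm (infsum t (- H)) \<le> (\<Sum>\<^sub>\<infinity>p\<in>-H. norm (b p))"
        using norm_infsum_bound[of t "- H"] sH by (simp add: nt)
      ultimately have "norm (sum t H) \<le> B + e" using bd[of u x] tail by linarith
      then show ?thesis by (simp only: t_def)
    qed
    from bessel_finite[OF H(1) this]
    have "(\<Sum>p\<in>H. (norm (b p))\<^sup>2) \<le> (B + e)\<^sup>2" .
    moreover have "(\<Sum>p\<in>G. (norm (b p))\<^sup>2) \<le> (\<Sum>p\<in>H. (norm (b p))\<^sup>2)"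
      using H by (intro sum_mono2) auto
    ultimately show ?thesis by linarith
  qed
  have "((\<lambda>e. (B + e)\<^sup>2) \<longlongrightarrow> (B + 0)\<^sup>2) (at_right 0)"
    by (intro tendsto_intros)
  then have "(\<Sum>p\<in>G. (norm (b p))\<^sup>2) \<le> (B + 0)\<^sup>2"
    by (rule tendsto_lowerbound) (use main in \<open>auto simp: eventually_at_filter\<close>)
  then show ?thesis by (simp add: nb case_prod_unfold)
qed

text \<open>Bessel's inequality for a single term. The heights v and y stay free, so a bound for f
  on a suitable sequence of tori can force a coefficient to vanish.\<close>

lemma jac_cauchy:
  assumes f: "has_jac_expansion f c" and v: "v > 0"
    and bd: "\<And>u x :: real. norm (f (Complex u v, Complex x y)) \<le> B"
  shows "norm (c n r) \<le> B * exp (2 * pi * (of_int n * v + of_int r * y))"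
proof -
  have B0: "B \<ge> 0" using bd[of 0 0] norm_ge_zero order_trans by blast
  have "(norm (c n r) * exp (- 2 * pi * (of_int n * v + of_int r * y)))\<^sup>2 \<le> B\<^sup>2"
    using jac_bessel[OF f v _ bd, of "{(n, r)}"] by simp
  then have "norm (c n r) * exp (- 2 * pi * (of_int n * v + of_int r * y)) \<le> B"
    using B0 power2_le_imp_le by blast
  then have "norm (c n r) * exp (- 2 * pi * (of_int n * v + of_int r * y)) * exp (2 * pi * (of_int n * v + of_int r * y)) \<le> B * exp (2 * pi * (of_int n * v + of_int r * y))"
    by (intro mult_right_mono) auto
  then show ?thesis by (simp add: mult.assoc exp_add[symmetric])
qed

section \<open>Linear combinations and uniqueness of expansions\<close>

lemma has_jac_expansion_cong:
  assumes "has_jac_expansion f c" "\<And>\<tau> z. Im \<tau> > 0 \<Longrightarrow> g (\<tau>, z) = f (\<tau>, z)"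
  shows "has_jac_expansion g c"
  using assms by (simp add: has_jac_expansion_def)

lemma has_jac_expansion_add:
  assumes "has_jac_expansion f c" "has_jac_expansion g d"
  shows "has_jac_expansion (\<lambda>p. f p + g p) (\<lambda>n r. c n r + d n r)"
  using assms unfolding has_jac_expansion_def
  by (auto simp: case_prod_unfold ring_distribs intro!: has_sum_add)

lemma has_jac_expansion_scale:
  assumes "has_jac_expansion f c"
  shows "has_jac_expansion (\<lambda>p. a * f p) (\<lambda>n r. a * c n r)"
  using assms unfolding has_jac_expansion_def
  by (auto simp: case_prod_unfold mult.assoc intro!: has_sum_cmult_right)

lemma has_jac_expansion_0: "has_jac_expansion (\<lambda>p. 0) (\<lambda>n r. 0)"
  by (simp add: has_jac_expansion_def case_prod_unfold)

lemma has_jac_expansion_sum: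
  assumes "finite I" "\<And>i. i \<in> I \<Longrightarrow> has_jac_expansion (f i) (c i)"
  shows "has_jac_expansion (\<lambda>p. \<Sum>i\<in>I. f i p) (\<lambda>n r. \<Sum>i\<in>I. c i n r)"
  using assms by (induction I rule: finite_induct) (auto intro: has_jac_expansion_0 has_jac_expansion_add)

text \<open>The difference of the two expansions represents 0, and \<open>jac_cauchy\<close> applies
  to it with B = 0.\<close>

lemma has_jac_expansion_unique:
  assumes "has_jac_expansion f c" "has_jac_expansion f d"
  shows "c = d"
proof -
  have h: "has_jac_expansion (\<lambda>p. f p + (- 1) * f p) (\<lambda>n r. c n r + (- 1) * d n r)"
    by (intro has_jac_expansion_add has_jac_expansion_scale assms)
  have "norm (c n r + (- 1) * d n r) \<le> 0 * exp (2 * pi * (of_int n * 1 + of_int r * 0))" for n r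
    by (rule jac_cauchy[OF h]) auto
  then show ?thesis by (intro ext) simp
qed

lemma jac_coeff_eq: "has_jac_expansion f c \<Longrightarrow> jac_coeff f = c"
  unfolding jac_coeff_def by (rule the_equality) (auto intro: has_jac_expansion_unique)

lemma jac_expansion_bounded:
  assumes f: "has_jac_expansion f c" and v: "v > 0"
  obtains B where "\<And>\<tau> z. Im \<tau> = v \<Longrightarrow> Im z = y \<Longrightarrow> norm (f (\<tau>, z)) \<le> B"
proof
  fix \<tau> z assume "Im \<tau> = v" "Im z = y"
  with v have "((\<lambda>(n, r). c n r * ee (of_int n * \<tau> + of_int r * z)) has_sum f (\<tau>, z)) UNIV"
    using f by (simp add: has_jac_expansion_def)
  from infsumI[OF this, symmetric]
  have "norm (f (\<tau>, z)) \<le> (\<Sum>\<^sub>\<infinity>x. norm (case x of (n, r) \<Rightarrow> c n r * ee (of_int n * \<tau> + of_int r * z)))"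
    using jac_abs_summable[OF f, of \<tau> z] v \<open>Im \<tau> = v\<close>
    by (simp only:) (intro norm_infsum_bound, simp add: norm_mult norm_ee case_prod_unfold)
  then show "norm (f (\<tau>, z)) \<le> (\<Sum>\<^sub>\<infinity>x. case x of (n, r) \<Rightarrow> norm (c n r) * exp (- 2 * pi * (of_int n * v + of_int r * y)))"
    using \<open>Im \<tau> = v\<close> \<open>Im z = y\<close> by (simp add: norm_mult norm_ee case_prod_unfold)
qed

section \<open>Leading terms in an irrational direction\<close>

text \<open>Comparing the expansions at z and z + l \<tau>, uniqueness identifies the coefficients
  along an elliptic orbit; the discriminant 4 M n - r^2 is constant on it.\<close>

lemma jac_elliptic_coeff:
  assumes f: "has_jac_expansion f c" and T: "jacobi_transform k M f"
  shows "c n r = c (n + l * r + int M * l\<^sup>2) (r + 2 * int M * l)"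
proof -
  let ?m = "int M"
  \<comment> \<open>This is c composed with the inverse of (n, r) -> (n + l r + M l^2, r + 2 M
    l).\<close>
  define d where "d = (\<lambda>n r. c (n - l * (r - 2 * ?m * l) - ?m * l\<^sup>2) (r - 2 * ?m * l))"
  have "has_jac_expansion f d"
    unfolding has_jac_expansion_def
  proof (intro allI impI)
    fix \<tau> z assume \<tau>: "Im \<tau> > 0"
    let ?e = "ee (of_nat M * (of_int (l\<^sup>2) * \<tau> + 2 * of_int l * z))"
    have "f (\<tau>, z + of_int l * \<tau> + of_int 0) = ee (- (of_nat M * (of_int (l\<^sup>2) * \<tau> + 2 * of_int l * z))) * f (\<tau>, z)"
      using T \<tau> unfolding jacobi_transform_def by blast
    then have feq: "f (\<tau>, z) = ?e * f (\<tau>, z + of_int l * \<tau>)"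
      by (simp add: ee_minus)
    have "((\<lambda>(n, r). c n r * ee (of_int n * \<tau> + of_int r * (z + of_int l * \<tau>))) has_sum f (\<tau>, z + of_int l * \<tau>)) UNIV"
      using f \<tau> by (simp add: has_jac_expansion_def)
    from has_sum_cmult_right[OF this, of ?e]
    have "((\<lambda>(n, r). ?e * (c n r * ee (of_int n * \<tau> + of_int r * (z + of_int l * \<tau>)))) has_sum f (\<tau>, z)) UNIV"
      by (simp add: case_prod_unfold feq)
    moreover have "?e * (c n r * ee (of_int n * \<tau> + of_int r * (z + of_int l * \<tau>)))
       = c n r * ee (of_int (n + l * r + ?m * l\<^sup>2) * \<tau> + of_int (r + 2 * ?m * l) * z)" for n r
      by (simp add: mult.left_commute[of _ "c n r"] ee_add[symmetric] algebra_simps)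
    ultimately have "((\<lambda>(n, r). c n r * ee (of_int (n + l * r + ?m * l\<^sup>2) * \<tau> + of_int (r + 2 * ?m * l) * z)) has_sum f (\<tau>, z)) UNIV"
      by (simp only:)
    then show "((\<lambda>(n, r). d n r * ee (of_int n * \<tau> + of_int r * z)) has_sum f (\<tau>, z)) UNIV"
      by (subst (asm) has_sum_reindex_bij_witness[where
            i = "\<lambda>(n, r). (n - l * (r - 2 * ?m * l) - ?m * l\<^sup>2, r - 2 * ?m * l)" and T = UNIV and
            j = "\<lambda>(n, r). (n + l * r + ?m * l\<^sup>2, r + 2 * ?m * l)"])
         (auto simp: d_def)
  qed
  from has_jac_expansion_unique[OF f this] have cd: "c = d" .
  have "c n r = d (n + l * r + ?m * l\<^sup>2) (r + 2 * ?m * l)" by (simp add: d_def)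
  then show ?thesis by (simp only: cd)
qed

lemma jac_coeff_reduce:
  assumes f: "has_jac_expansion f c" and T: "jacobi_transform k M f" and M: "M > 0"
  obtains n' r' where "c n r = c n' r'" "4 * int M * n' - r'\<^sup>2 = 4 * int M * n - r\<^sup>2" "\<bar>r'\<bar> \<le> int M"
proof -
  let ?m = "int M"
  \<comment> \<open>The quotient r / (2 M) rounded to a nearest integer, so that the remainder lies
    between -M and M.\<close>
  define q where "q = (r + ?m) div (2 * ?m)"
  define r' where "r' = r - 2 * ?m * q"
  define n' where "n' = n - q * r + ?m * q\<^sup>2"
  have "(r + ?m) mod (2 * ?m) = r' + ?m"
    unfolding r'_def q_def minus_mult_div_eq_mod[symmetric] by simp
  moreover have "0 \<le> (r + ?m) mod (2 * ?m)" "(r + ?m) mod (2 * ?m) < 2 * ?m"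
    using M by auto
  ultimately have "\<bar>r'\<bar> \<le> ?m" by linarith
  moreover have "c n r = c n' r'"
    using jac_elliptic_coeff[OF f T, of n r "- q"] by (simp add: n'_def r'_def)
  moreover have "4 * ?m * n' - r'\<^sup>2 = 4 * ?m * n - r\<^sup>2"
    unfolding n'_def r'_def by (simp add: algebra_simps power2_eq_square)
  ultimately show ?thesis by (intro that)
qed

text \<open>A lower bound for n on the strip |r| <= M bounds the discriminant there, and elliptic
  translation preserves the discriminant. The whole support therefore lies inside a
  parabola.\<close>

lemma jac_support_bound:
  assumes f: "has_jac_expansion f c" and T: "jacobi_transform k M f" and M: "M > 0"
    and n0: "\<And>n r. \<bar>r\<bar> \<le> int M \<Longrightarrow> c n r \<noteq> 0 \<Longrightarrow> n0 \<le> n"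
  obtains K where "\<And>n r. c n r \<noteq> 0 \<Longrightarrow> r\<^sup>2 - K \<le> 4 * int M * n"
proof
  fix n r assume nz: "c n r \<noteq> 0"
  obtain n' r' where *: "c n r = c n' r'" "4 * int M * n' - r'\<^sup>2 = 4 * int M * n - r\<^sup>2" "\<bar>r'\<bar> \<le> int M"
    by (rule jac_coeff_reduce[OF f T M])
  have "n0 \<le> n'" using n0 * nz by auto
  then have "4 * int M * n0 \<le> 4 * int M * n'" by (intro mult_left_mono) auto
  moreover have "r'\<^sup>2 \<le> (int M)\<^sup>2" using *(3) by (metis abs_le_square_iff abs_of_nat)
  ultimately show "r\<^sup>2 - ((int M)\<^sup>2 - 4 * int M * n0) \<le> 4 * int M * n"
    using *(2) by linarith
qed

text \<open>A parabola opening towards positive n meets the half plane n + \<theta> r <= e in a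
  bounded region.\<close>

lemma finite_sublevel:
  fixes K :: int and M :: nat and \<theta> e :: real
  assumes M: "M > 0"
  shows "finite {(n :: int, r :: int). r\<^sup>2 - K \<le> 4 * int M * n \<and> of_int n + \<theta> * of_int r \<le> e}"
proof -
  \<comment> \<open>Beyond R the square r^2 outgrows the linear expression K + 4 M e - 4 M \<theta>
    r.\<close>
  define R where "R = \<bar>4 * M * \<theta>\<bar> + \<bar>of_int K + 4 * M * e\<bar> + 1"
  define L where "L = \<lceil>R\<rceil>"
  define E where "E = \<lceil>\<bar>K\<bar> + \<bar>e\<bar> + \<bar>\<theta>\<bar> * of_int L\<rceil>"
  have "{(n :: int, r :: int). r\<^sup>2 - K \<le> 4 * int M * n \<and> of_int n + \<theta> * of_int r \<le> e} \<subseteq> {-E..E} \<times> {-L..L}"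
  proof safe
    fix n r :: int
    assume 1: "r\<^sup>2 - K \<le> 4 * int M * n" and 2: "of_int n + \<theta> * of_int r \<le> e"
    have "real_of_int (r\<^sup>2 - K) \<le> real_of_int (4 * int M * n)" using 1 by (simp only: of_int_le_iff)
    then have 3: "(of_int r)\<^sup>2 - of_int K \<le> 4 * M * real_of_int n" by simp
    have "4 * M * (of_int n + \<theta> * of_int r) \<le> 4 * M * e"
      using 2 by (intro mult_left_mono) auto
    with 3 have 4: "(real_of_int r)\<^sup>2 \<le> of_int K + 4 * M * e - 4 * M * \<theta> * of_int r"
      by (simp add: algebra_simps)
    have "\<bar>real_of_int r\<bar> \<le> R"
    proof (rule ccontr)
      assume "\<not> ?thesis"
      then have gt: "\<bar>real_of_int r\<bar> > R" by simp
      have R1: "R \<ge> 1" by (simp add: R_def)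
      have "R * \<bar>real_of_int r\<bar> \<le> \<bar>real_of_int r\<bar> * \<bar>real_of_int r\<bar>" using gt R1 by (intro mult_right_mono) auto
      also have "\<dots> = (real_of_int r)\<^sup>2" by (simp add: power2_eq_square)
      also have "\<dots> \<le> \<bar>of_int K + 4 * M * e\<bar> + \<bar>4 * M * \<theta>\<bar> * \<bar>real_of_int r\<bar>"
        using 4 abs_ge_self[of "of_int K + 4 * M * e"] abs_ge_minus_self[of "4 * M * \<theta> * of_int r"]
        unfolding abs_mult[of "4 * M * \<theta>"] by linarith
      also have "\<bar>of_int K + 4 * M * e\<bar> \<le> \<bar>of_int K + 4 * M * e\<bar> * \<bar>real_of_int r\<bar>"
        using gt R1 by (intro mult_le_cancel_left1[THEN iffD2]) auto
      finally have "R * \<bar>real_of_int r\<bar> \<le> (R - 1) * \<bar>real_of_int r\<bar>"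
        by (simp add: R_def algebra_simps)
      then show False using gt R1 by (simp add: algebra_simps)
    qed
    then have L: "\<bar>real_of_int r\<bar> \<le> of_int L" unfolding L_def by linarith
    then show rL: "r \<in> {-L..L}" by auto
    have lr: "\<bar>\<theta> * of_int r\<bar> \<le> \<bar>\<theta>\<bar> * of_int L" using L by (simp add: abs_mult mult_left_mono)
    have "real_of_int n \<le> E" using 2 lr unfolding E_def by linarith
    moreover have "n \<ge> - \<bar>K\<bar>"
    proof (rule ccontr)
      assume "\<not> ?thesis"
      then have "n < - \<bar>K\<bar>" by simp
      then have "4 * int M * n \<le> 1 * n" using M by (intro mult_right_mono_neg) auto
      with 1 \<open>n < - \<bar>K\<bar>\<close> show False using zero_le_power2[of r] by linarith
    qed
    then have "real_of_int n \<ge> - E" using lr unfolding E_def by linarith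
    ultimately show "n \<in> {-E..E}" by auto
  qed
  then show ?thesis by (rule finite_subset) auto
qed

lemma irrational_pairing_inj:
  fixes \<theta> :: real
  assumes "\<theta> \<notin> \<rat>" "of_int n + \<theta> * of_int r = of_int n' + \<theta> * of_int r'"
  shows "n = n' \<and> r = r'"
proof -
  have "r = r'"
  proof (rule ccontr)
    assume "r \<noteq> r'"
    then have "\<theta> = of_int (n' - n) / of_int (r - r')" using assms(2) by (simp add: field_simps)
    also have "\<dots> \<in> \<rat>" by (intro Rats_divide) auto
    finally show False using assms(1) by simp
  qed
  with assms(2) show ?thesis by simp
qed

text \<open>The gap \<delta> lets all other terms decay, relative to the leading one, at a common
  exponential rate along z = \<theta> \<tau>.\<close>

definition is_leading :: "real \<Rightarrow> (int \<Rightarrow> int \<Rightarrow> complex) \<Rightarrow> int \<Rightarrow> int \<Rightarrow> bool" where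
  "is_leading \<theta> c n0 r0 \<longleftrightarrow> c n0 r0 \<noteq> 0 \<and> (\<exists>\<delta>>0. \<forall>n r. c n r \<noteq> 0 \<longrightarrow> (n, r) \<noteq> (n0, r0) \<longrightarrow>
     of_int n0 + \<theta> * of_int r0 + \<delta> \<le> of_int n + \<theta> * of_int r)"

text \<open>An irrational slope singles out one leading monomial in the direction \<open>z = \<theta>\<tau>\<close>.\<close>

lemma jac_leading_term:
  fixes \<theta> :: real and c :: "int \<Rightarrow> int \<Rightarrow> complex"
  assumes M: "M > 0" and K: "\<And>n r. c n r \<noteq> 0 \<Longrightarrow> r\<^sup>2 - K \<le> 4 * int M * n"
    and \<theta>: "\<theta> \<notin> \<rat>" and nz: "c n1 r1 \<noteq> 0"
  shows "\<exists>n0 r0. is_leading \<theta> c n0 r0"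
proof -
  define w where "w = (\<lambda>p :: int \<times> int. of_int (fst p) + \<theta> * of_int (snd p))"
  define S where "S = (\<lambda>e. {p. c (fst p) (snd p) \<noteq> 0 \<and> w p \<le> e})"
  have fin: "finite (S e)" for e
    by (rule finite_subset[OF _ finite_sublevel[OF M, of K \<theta> e]]) (auto simp: S_def w_def K)
  have "(n1, r1) \<in> S (w (n1, r1))" using nz by (simp add: S_def)
  then obtain p0 where p0: "p0 \<in> S (w (n1, r1))" "\<And>p. p \<in> S (w (n1, r1)) \<Longrightarrow> w p0 \<le> w p"
    using fin[of "w (n1, r1)"] ex_min_if_finite[of "w ` S (w (n1, r1))"]
    by (metis (no_types, lifting) arg_min_if_finite(1) arg_min_least empty_iff)
  have min: "w p0 \<le> w p" if "c (fst p) (snd p) \<noteq> 0" for p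
    using p0 that by (cases "w p \<le> w (n1, r1)") (auto simp: S_def)
  \<comment> \<open>Only finitely many support points have exponent at most \<open>w p0 + 1\<close>;
    the element 1 accounts for all the others.\<close>
  define D where "D = insert 1 ((\<lambda>p. w p - w p0) ` (S (w p0 + 1) - {p0}))"
  have D: "finite D" "D \<noteq> {}" unfolding D_def using fin by auto
  have pos: "\<And>x. x \<in> D \<Longrightarrow> x > 0"
  proof -
    fix x assume "x \<in> D"
    then consider "x = 1" | p where "x = w p - w p0" "p \<in> S (w p0 + 1)" "p \<noteq> p0"
      unfolding D_def by auto
    then show "x > 0"
    proof cases
      case 2
      then have "w p \<noteq> w p0"
        using irrational_pairing_inj[OF \<theta>, of "fst p" "snd p" "fst p0" "snd p0"] by (auto simp: w_def prod_eq_iff)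
      with 2 min[of p] show ?thesis by (auto simp: S_def)
    qed auto
  qed
  have "is_leading \<theta> c (fst p0) (snd p0)"
    unfolding is_leading_def
  proof (intro conjI exI[of _ "Min D"] allI impI)
    show "c (fst p0) (snd p0) \<noteq> 0" using p0 by (simp add: S_def)
    show "Min D > 0" using pos D by simp
    fix n r assume c: "c n r \<noteq> 0" and ne: "(n, r) \<noteq> (fst p0, snd p0)"
    show "of_int (fst p0) + \<theta> * of_int (snd p0) + Min D \<le> of_int n + \<theta> * of_int r"
    proof (cases "w (n, r) \<le> w p0 + 1")
      case True
      then have "w (n, r) - w p0 \<in> D" using c ne by (auto simp: D_def S_def)
      then have "Min D \<le> w (n, r) - w p0" using D by simp
      then show ?thesis by (simp add: w_def)
    next
      case False
      have "Min D \<le> 1" using D by (intro Min_le) (auto simp: D_def)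
      with False show ?thesis by (simp add: w_def)
    qed
  qed
  then show ?thesis by blast
qed

lemma exp_neg_mult_tendsto_0:
  fixes x :: real
  assumes "x > 0"
  shows "((\<lambda>v. exp (- (x * v))) \<longlongrightarrow> 0) at_top"
proof (rule filterlim_compose[OF exp_at_bot])
  have "filterlim (\<lambda>v. x * v) at_top at_top"
    using assms by (intro filterlim_tendsto_pos_mult_at_top[OF tendsto_const _ filterlim_ident]) auto
  then show "filterlim (\<lambda>v. - (x * v)) at_bot at_top"
    by (simp only: filterlim_uminus_at_bot minus_minus)
qed

text \<open>Scaling by the inverse size of the leading monomial turns that term into a constant and
  sends the rest to 0. Products can then be compared through limits, without computing the
  coefficients of a product.\<close>

lemma jac_leading_asymp:
  fixes \<theta> :: real
  assumes f: "has_jac_expansion f c" and lead: "is_leading \<theta> c n0 r0"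
  shows "((\<lambda>v. f (Complex 0 v, Complex 0 (\<theta> * v)) * of_real (exp (2 * pi * v * (of_int n0 + \<theta> * of_int r0)))) \<longlongrightarrow> c n0 r0) at_top"
proof -
  obtain \<delta> where \<delta>: "\<delta> > 0"
    and gap: "\<And>n r. c n r \<noteq> 0 \<Longrightarrow> (n, r) \<noteq> (n0, r0) \<Longrightarrow> of_int n0 + \<theta> * of_int r0 + \<delta> \<le> of_int n + \<theta> * of_int r"
    using lead unfolding is_leading_def by blast
  define w where "w = (\<lambda>p :: int \<times> int. of_int (fst p) + \<theta> * of_int (snd p))"
  define E where "E = of_int n0 + \<theta> * of_int r0"
  define t where "t = (\<lambda>v p. c (fst p) (snd p) * of_real (exp (- 2 * pi * v * (w p - E))))"
  define T where "T = (\<Sum>\<^sub>\<infinity>p\<in>-{(n0, r0)}. norm (t 1 p))"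
  define g where "g = (\<lambda>v. f (Complex 0 v, Complex 0 (\<theta> * v)) * of_real (exp (2 * pi * v * E)))"
  have hs: "(t v has_sum g v) UNIV" if "v > 0" for v
  proof -
    have "((\<lambda>p. c (fst p) (snd p) * ee (of_int (fst p) * Complex 0 v + of_int (snd p) * Complex 0 (\<theta> * v))) has_sum f (Complex 0 v, Complex 0 (\<theta> * v))) UNIV"
      using f that by (simp add: has_jac_expansion_def case_prod_unfold)
    from has_sum_cmult_left[OF this, of "of_real (exp (2 * pi * v * E))"]
    have *: "((\<lambda>p. c (fst p) (snd p) * ee (of_int (fst p) * Complex 0 v + of_int (snd p) * Complex 0 (\<theta> * v)) * of_real (exp (2 * pi * v * E))) has_sum g v) UNIV"
      by (simp add: g_def)
    have "c (fst p) (snd p) * ee (of_int (fst p) * Complex 0 v + of_int (snd p) * Complex 0 (\<theta> * v)) * of_real (exp (2 * pi * v * E)) = t v p" for p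
    proof -
      have "ee (of_int (fst p) * Complex 0 v + of_int (snd p) * Complex 0 (\<theta> * v)) = of_real (exp (- 2 * pi * v * w p))"
        unfolding ee_def exp_of_real[symmetric] by (rule arg_cong[of _ _ exp]) (simp add: complex_eq_iff w_def algebra_simps)
      then show ?thesis
        by (simp add: t_def mult.assoc exp_add[symmetric] algebra_simps flip: of_real_mult)
    qed
    with * show ?thesis by simp
  qed
  \<comment> \<open>Comparison with v = 1, where the series converges absolutely: each further unit
    of v gains a factor exp(-2 pi \<delta>).\<close>
  have nt: "norm (t v p) \<le> norm (t 1 p) * exp (- 2 * pi * (v - 1) * \<delta>)" if "v \<ge> 1" "p \<noteq> (n0, r0)" for v p
  proof (cases "c (fst p) (snd p) = 0")
    case False
    have "w p - E \<ge> \<delta>" using gap[of "fst p" "snd p"] that(2) False by (auto simp: w_def E_def prod_eq_iff)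
    then have "(v - 1) * \<delta> \<le> (v - 1) * (w p - E)" using that by (intro mult_left_mono) auto
    then have "2 * pi * ((v - 1) * \<delta>) \<le> 2 * pi * ((v - 1) * (w p - E))" by (rule mult_left_mono) auto
    then have "exp (- 2 * pi * v * (w p - E)) \<le> exp (- 2 * pi * 1 * (w p - E)) * exp (- 2 * pi * (v - 1) * \<delta>)"
      unfolding exp_add[symmetric] by (simp add: algebra_simps)
    then show ?thesis
      unfolding t_def norm_mult norm_of_real abs_exp_cancel mult.assoc[of "norm (c (fst p) (snd p))"]
      by (intro mult_left_mono) auto
  qed (simp add: t_def)
  have sum1: "(\<lambda>p. norm (t v p)) summable_on A" if "v > 0" for v A
    using has_sum_imp_summable[OF hs[OF that], THEN summable_on_iff_abs_summable_on_complex[THEN iffD1]]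
      summable_on_subset_banach by blast
  have bound: "norm (g v - c n0 r0) \<le> T * exp (- 2 * pi * (v - 1) * \<delta>)" if v: "v \<ge> 1" for v
  proof -
    have v0: "v > 0" using v by simp
    have st: "t v summable_on A" for A
      using summable_on_subset_banach[OF has_sum_imp_summable[OF hs[OF v0]], of A] by simp
    have "infsum (t v) ({(n0, r0)} \<union> - {(n0, r0)}) = infsum (t v) {(n0, r0)} + infsum (t v) (- {(n0, r0)})"
      by (rule infsum_Un_disjoint[OF st st]) blast
    moreover have "infsum (t v) ({(n0, r0)} \<union> - {(n0, r0)}) = g v"
      unfolding Compl_partition by (rule infsumI[OF hs[OF v0]])
    moreover have "infsum (t v) {(n0, r0)} = c n0 r0"
      by (simp add: t_def w_def E_def)
    ultimately have "g v - c n0 r0 = infsum (t v) (- {(n0, r0)})"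
      by (simp add: diff_eq_eq add.commute[of _ "c n0 r0"])
    also have "norm \<dots> \<le> (\<Sum>\<^sub>\<infinity>p\<in>-{(n0, r0)}. norm (t v p))"
      by (rule norm_infsum_bound[OF sum1[OF v0]])
    also have "\<dots> \<le> (\<Sum>\<^sub>\<infinity>p\<in>-{(n0, r0)}. norm (t 1 p) * exp (- 2 * pi * (v - 1) * \<delta>))"
      by (intro infsum_mono sum1 v0 summable_on_cmult_left nt v) auto
    also have "\<dots> = T * exp (- 2 * pi * (v - 1) * \<delta>)"
      unfolding T_def by (rule infsum_cmult_left') 
    finally show ?thesis .
  qed
  have "((\<lambda>v. T * exp (- 2 * pi * (v - 1) * \<delta>)) \<longlongrightarrow> 0) at_top"
  proof -
    have "((\<lambda>v. exp (- ((2 * pi * \<delta>) * v))) \<longlongrightarrow> 0) at_top"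
      using \<delta> by (intro exp_neg_mult_tendsto_0) auto
    then have "((\<lambda>v. exp (2 * pi * \<delta>) * exp (- ((2 * pi * \<delta>) * v))) \<longlongrightarrow> 0) at_top"
      by (rule tendsto_mult_right_zero)
    then have "((\<lambda>v. exp (- 2 * pi * (v - 1) * \<delta>)) \<longlongrightarrow> 0) at_top"
      by (simp add: exp_add[symmetric] algebra_simps)
    then show ?thesis by (rule tendsto_mult_right_zero)
  qed
  then have "((\<lambda>v. g v - c n0 r0) \<longlongrightarrow> 0) at_top"
    by (rule Lim_null_comparison[rotated]) (rule eventually_at_top_linorderI[of 1], rule bound)
  then have "(g \<longlongrightarrow> c n0 r0) at_top" by (rule LIM_zero_cancel)
  then show ?thesis by (simp add: g_def E_def)
qed

section \<open>Holomorphic forms of weight zero\<close>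

text \<open>In weight k the Petersson norm is v^(k/2) |f| exp(-2 pi M y^2 / v) with v = Im \<tau>, y
  = Im z; this is its form in weight 0. On z = \<theta> \<tau> the last factor turns the exponent n
  + \<theta> r into n + \<theta> r + M \<theta>^2.\<close>

definition jac_norm :: "nat \<Rightarrow> (complex \<times> complex \<Rightarrow> complex) \<Rightarrow> complex \<Rightarrow> complex \<Rightarrow> real" where
  "jac_norm M f \<tau> z = norm (f (\<tau>, z)) * exp (- 2 * pi * M * ((Im z)\<^sup>2 / Im \<tau>))"

lemma Im_moebius_int:
  fixes a b c d :: int
  assumes "a * d - b * c = 1" "Im \<tau> > 0"
  shows "of_int c * \<tau> + of_int d \<noteq> 0"
    and "Im ((of_int a * \<tau> + of_int b) / (of_int c * \<tau> + of_int d)) = Im \<tau> / (norm (of_int c * \<tau> + of_int d))\<^sup>2"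
proof -
  show "of_int c * \<tau> + of_int d \<noteq> 0"
  proof
    assume *: "of_int c * \<tau> + of_int d = 0"
    then have "of_int c * Im \<tau> = 0" by (simp add: complex_eq_iff)
    then have "c = 0" using assms(2) by simp
    with * have "d = 0" by simp
    with \<open>c = 0\<close> assms(1) show False by simp
  qed
  have "real_of_int a * of_int d - of_int b * of_int c = 1"
    using assms(1) by (metis of_int_1 of_int_diff of_int_mult)
  then have det: "real_of_int a * of_int d = 1 + of_int b * of_int c" by simp
  show "Im ((of_int a * \<tau> + of_int b) / (of_int c * \<tau> + of_int d)) = Im \<tau> / (norm (of_int c * \<tau> + of_int d))\<^sup>2"
  proof -
    have "of_int a * Im \<tau> * (of_int c * Re \<tau> + of_int d) - (of_int a * Re \<tau> + of_int b) * (of_int c * Im \<tau>)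
        = (real_of_int a * of_int d - of_int b * of_int c) * Im \<tau>"
      by (simp add: algebra_simps)
    also have "\<dots> = Im \<tau>" by (simp add: det)
    finally show ?thesis
      by (simp add: Im_divide cmod_power2)
  qed
qed

text \<open>In weight 0 the automorphy factor is the exponential alone, and its size is compensated
  exactly by the change of y^2 / v.\<close>

lemma jac_norm_modular:
  fixes a b c d :: int
  assumes T: "jacobi_transform 0 M f" and det: "a * d - b * c = 1" and \<tau>: "Im \<tau> > 0"
  shows "jac_norm M f ((of_int a * \<tau> + of_int b) / (of_int c * \<tau> + of_int d)) (z / (of_int c * \<tau> + of_int d)) = jac_norm M f \<tau> z"
proof -
  define J where "J = of_int c * \<tau> + of_int d"
  define \<tau>' where "\<tau>' = (of_int a * \<tau> + of_int b) / J"
  have J: "J \<noteq> 0" and Im': "Im \<tau>' = Im \<tau> / (norm J)\<^sup>2"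
    using Im_moebius_int[OF det \<tau>] by (simp_all add: J_def \<tau>'_def)
  have "f (\<tau>', z / J) = J powi 0 * ee (of_nat M * of_int c * z\<^sup>2 / J) * f (\<tau>, z)"
    using T det \<tau> unfolding jacobi_transform_def J_def \<tau>'_def by blast
  then have nf: "norm (f (\<tau>', z / J)) = exp (- 2 * pi * M * Im (of_int c * z\<^sup>2 / J)) * norm (f (\<tau>, z))"
  proof -
    define w where "w = of_int c * z\<^sup>2 / J"
    have "of_nat M * of_int c * z\<^sup>2 / J = of_nat M * w" by (simp add: w_def)
    moreover have "Im (of_nat M * w) = M * Im w" by simp
    ultimately have "Im (of_nat M * of_int c * z\<^sup>2 / J) = M * Im (of_int c * z\<^sup>2 / J)"
      by (simp only: w_def)
    with \<open>f (\<tau>', z / J) = _\<close> show ?thesis by (simp add: norm_mult norm_ee mult_ac)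
  qed
  define p q x y v where "p = Re J" and "q = Im J" and "x = Re z" and "y = Im z" and "v = Im \<tau>"
  have v: "v > 0" and qv: "q = of_int c * v" using \<tau> by (auto simp: v_def q_def J_def)
  have D: "p\<^sup>2 + q\<^sup>2 > 0" using J by (simp add: p_def q_def complex_eq_iff sum_power2_gt_zero_iff)
  have nJ: "(norm J)\<^sup>2 = p\<^sup>2 + q\<^sup>2" by (simp add: cmod_power2 p_def q_def)
  have Iz: "Im (z / J) = (y * p - x * q) / (p\<^sup>2 + q\<^sup>2)"
    by (simp add: Im_divide p_def q_def x_def y_def)
  have Ic: "Im (of_int c * z\<^sup>2 / J) = of_int c * (2 * x * y * p - (x\<^sup>2 - y\<^sup>2) * q) / (p\<^sup>2 + q\<^sup>2)"
    by (simp add: Im_divide p_def q_def x_def y_def power2_eq_square algebra_simps)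
  have frac: "m * A / R + (E / R)\<^sup>2 / (v / R) = (m * v * A + E\<^sup>2) / (v * R)" if "R > 0" for m A R E :: real
    using that v by (simp add: field_simps power2_eq_square)
  \<comment> \<open>The invariance amounts to this identity of exponents; because q = c v, its left
    side has the common denominator v |J|^2.\<close>
  have "Im (of_int c * z\<^sup>2 / J) + (Im (z / J))\<^sup>2 / Im \<tau>' = (Im z)\<^sup>2 / Im \<tau>"
  proof -
    have "Im (of_int c * z\<^sup>2 / J) + (Im (z / J))\<^sup>2 / Im \<tau>'
       = (q * (2 * x * y * p - (x\<^sup>2 - y\<^sup>2) * q) + (y * p - x * q)\<^sup>2) / (v * (p\<^sup>2 + q\<^sup>2))"
      unfolding Iz Ic Im' nJ v_def[symmetric] frac[OF D] by (simp only: qv)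
    also have "q * (2 * x * y * p - (x\<^sup>2 - y\<^sup>2) * q) + (y * p - x * q)\<^sup>2 = y\<^sup>2 * (p\<^sup>2 + q\<^sup>2)"
      by (simp add: power2_eq_square algebra_simps)
    also have "y\<^sup>2 * (p\<^sup>2 + q\<^sup>2) / (v * (p\<^sup>2 + q\<^sup>2)) = y\<^sup>2 / v"
      using D by (intro mult_divide_mult_cancel_right) linarith
    finally show ?thesis by (simp only: y_def v_def)
  qed
  then have "exp (- 2 * pi * M * Im (of_int c * z\<^sup>2 / J)) * exp (- 2 * pi * M * ((Im (z / J))\<^sup>2 / Im \<tau>')) = exp (- 2 * pi * M * ((Im z)\<^sup>2 / Im \<tau>))"
    unfolding exp_add[symmetric] distrib_left[symmetric] by simp
  then show ?thesis
    unfolding jac_norm_def J_def[symmetric] \<tau>'_def[symmetric] nf by (simp add: mult_ac)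
qed

lemma jac_norm_elliptic:
  assumes T: "jacobi_transform k M f" and \<tau>: "Im \<tau> > 0"
  shows "jac_norm M f \<tau> (z + of_int l * \<tau>) = jac_norm M f \<tau> z"
proof -
  have "f (\<tau>, z + of_int l * \<tau> + of_int 0) = ee (- (of_nat M * (of_int (l\<^sup>2) * \<tau> + 2 * of_int l * z))) * f (\<tau>, z)"
    using T \<tau> unfolding jacobi_transform_def by blast
  moreover have "Im (- (of_nat M * (of_int (l\<^sup>2) * \<tau> + 2 * of_int l * z))) = - M * (of_int l ^ 2 * Im \<tau> + 2 * of_int l * Im z)"
    by (simp add: algebra_simps flip: of_int_power)
  ultimately have nf: "norm (f (\<tau>, z + of_int l * \<tau>)) = exp (2 * pi * M * (of_int l ^ 2 * Im \<tau> + 2 * of_int l * Im z)) * norm (f (\<tau>, z))"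
    by (simp add: norm_mult norm_ee)
  have "(Im (z + of_int l * \<tau>))\<^sup>2 / Im \<tau> = (of_int l ^ 2 * Im \<tau> + 2 * of_int l * Im z) + (Im z)\<^sup>2 / Im \<tau>"
    using \<tau> by (simp add: field_simps power2_eq_square)
  then have "2 * pi * M * (of_int l ^ 2 * Im \<tau> + 2 * of_int l * Im z) + (- 2 * pi * M * ((Im (z + of_int l * \<tau>))\<^sup>2 / Im \<tau>)) = - 2 * pi * M * ((Im z)\<^sup>2 / Im \<tau>)"
    by (simp only: distrib_left)
  then have "exp (2 * pi * M * (of_int l ^ 2 * Im \<tau> + 2 * of_int l * Im z)) * exp (- 2 * pi * M * ((Im (z + of_int l * \<tau>))\<^sup>2 / Im \<tau>)) = exp (- 2 * pi * M * ((Im z)\<^sup>2 / Im \<tau>))"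
    unfolding exp_add[symmetric] by simp
  then show ?thesis unfolding jac_norm_def nf by (simp add: mult_ac)
qed

text \<open>Dirichlet's approximation theorem, with denominators up to about 1 / sqrt v for v = Im
  \<tau>, yields a coprime pair (k, -h) making |k \<tau> - h| small; as a bottom row it lifts
  \<tau>.\<close>

lemma modular_reduction:
  assumes \<tau>: "Im \<tau> > 0"
  obtains a b c d :: int where "a * d - b * c = 1"
    "Im ((of_int a * \<tau> + of_int b) / (of_int c * \<tau> + of_int d)) \<ge> 1 / 5"
proof (cases "Im \<tau> \<ge> 1")
  case True
  then show ?thesis by (intro that[of 1 1 0 0]) auto
next
  case False
  define v where "v = Im \<tau>"
  define N where "N = nat \<lceil>1 / sqrt v\<rceil>"
  have v: "0 < v" "v < 1" using \<tau> False by (auto simp: v_def)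
  have sv: "0 < sqrt v" "sqrt v \<le> 1" using v by auto
  have N: "real N \<ge> 1 / sqrt v" "real N \<le> 1 / sqrt v + 1" unfolding N_def using sv by (auto simp: of_nat_nat ceiling_le_iff) 
  have N0: "N > 0" using N(1) sv by (metis divide_pos_pos less_le_trans of_nat_0_less_iff zero_less_one)
  obtain h k where hk: "coprime h k" "0 < k" "k \<le> int N" "\<bar>of_int k * Re \<tau> - of_int h\<bar> < 1 / N"
    by (rule Dirichlet_approx_coprime[OF N0])
  from hk(1) obtain s t where "s * h + t * k = 1"
    by (metis bezout_int coprime_iff_gcd_eq_1)
  then have det: "(- s) * (- h) - (- t) * k = 1" by simp
  \<comment> \<open>5 = 1 + 4: the squared real part is at most v, and the squared imaginary part at
    most 4 v because k <= 2 / sqrt v.\<close>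
  have "(norm (of_int k * \<tau> + of_int (- h)))\<^sup>2 \<le> 5 * v"
  proof -
    have "1 / N \<le> sqrt v" using N(1) sv N0 by (simp add: field_simps)
    then have "\<bar>of_int k * Re \<tau> - of_int h\<bar> \<le> sqrt v" using hk(4) by linarith
    then have 1: "(of_int k * Re \<tau> - of_int h)\<^sup>2 \<le> v"
      using v by (metis abs_ge_zero power2_abs power_mono real_sqrt_pow2 less_imp_le)
    have "1 \<le> 1 / sqrt v" using sv by simp
    then have "real_of_int k \<le> 2 / sqrt v" using hk(3) N(2) by simp
    then have "real_of_int k * v \<le> 2 / sqrt v * v" using v by (intro mult_right_mono) auto
    also have "\<dots> = 2 * sqrt v" using v by (simp add: real_div_sqrt field_simps)
    finally have "(real_of_int k * v)\<^sup>2 \<le> (2 * sqrt v)\<^sup>2" using hk(2) v by (intro power_mono) auto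
    also have "\<dots> = 4 * v" using v by (simp add: power_mult_distrib)
    finally show ?thesis using 1 unfolding cmod_power2 by (simp add: v_def)
  qed
  moreover have "(norm (of_int k * \<tau> + of_int (- h)))\<^sup>2 > 0"
    using Im_moebius_int(1)[OF det \<tau>] by simp
  ultimately have "1 / 5 \<le> v / (norm (of_int k * \<tau> + of_int (- h)))\<^sup>2"
    using v by (simp add: field_simps)
  then show ?thesis
    using Im_moebius_int(2)[OF det \<tau>] by (intro that[OF det]) (simp add: v_def)
qed

text \<open>Completing the square gives (4 M n - r^2 + (r + 2 M \<theta>)^2) / (4 M). Up to the
  factor 2 pi this is the decay rate of the (n, r) term of \<open>jac_norm\<close> along slope
  \<theta>.\<close>

lemma holomorphic_exponent_nonneg:
  fixes \<theta> :: real
  assumes "M > 0" "4 * int M * n - r\<^sup>2 \<ge> 0"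
  shows "of_int n + \<theta> * of_int r + M * \<theta>\<^sup>2 \<ge> 0"
proof -
  have "4 * M * (of_int n + \<theta> * of_int r + M * \<theta>\<^sup>2) = real_of_int (4 * int M * n - r\<^sup>2) + (of_int r + 2 * M * \<theta>)\<^sup>2"
    by (simp add: power2_eq_square algebra_simps)
  also have "\<dots> \<ge> 0" using assms(2) by (intro add_nonneg_nonneg) (auto simp only: of_int_0_le_iff zero_le_power2)
  finally show ?thesis using assms(1) by (simp add: zero_le_mult_iff)
qed

text \<open>Since the exponents are nonnegative, every damped term decreases as Im \<tau> grows, so
  height \<delta> is the worst case. Uniformity in the slope comes from the two end slopes 0 and
  1.\<close>

lemma jac_norm_bounded_cusp:
  assumes f: "has_jac_expansion f c" and M: "M > 0" and \<delta>: "\<delta> > 0"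
    and hol: "\<And>n r. 4 * int M * n - r\<^sup>2 < 0 \<Longrightarrow> c n r = 0"
  obtains B where "\<And>\<tau> z. Im \<tau> \<ge> \<delta> \<Longrightarrow> 0 \<le> Im z \<Longrightarrow> Im z \<le> Im \<tau> \<Longrightarrow> jac_norm M f \<tau> z \<le> B"
proof
  define w where "w = (\<lambda>\<theta> v p. norm (c (fst p) (snd p)) * exp (- 2 * pi * (of_int (fst p) * v + of_int (snd p) * (\<theta> * v))))"
  have sw: "w \<theta> v summable_on UNIV" if "v > 0" for \<theta> v
    using jac_abs_summable[OF f, of "Complex 0 v" "Complex 0 (\<theta> * v)"] that by (simp add: w_def case_prod_unfold)
  fix \<tau> z assume \<tau>: "Im \<tau> \<ge> \<delta>" and z: "0 \<le> Im z" "Im z \<le> Im \<tau>"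
  have v: "Im \<tau> > 0" using \<tau> \<delta> by simp
  define \<theta> where "\<theta> = Im z / Im \<tau>"
  have \<theta>: "0 \<le> \<theta>" "\<theta> \<le> 1" and zt: "Im z = \<theta> * Im \<tau>" using z v by (auto simp: \<theta>_def)
  define E where "E = exp (- 2 * pi * M * (\<theta>\<^sup>2 * Im \<tau>))"
  define t where "t = (\<lambda>p. c (fst p) (snd p) * ee (of_int (fst p) * \<tau> + of_int (snd p) * z))"
  have "(t has_sum f (\<tau>, z)) UNIV"
    using f v by (simp add: t_def has_jac_expansion_def case_prod_unfold)
  then have ft: "f (\<tau>, z) = infsum t UNIV" by (rule infsumI[symmetric])
  have nt: "norm (t p) = w \<theta> (Im \<tau>) p" for p by (simp add: t_def w_def norm_mult norm_ee zt)
  have "norm (f (\<tau>, z)) \<le> infsum (w \<theta> (Im \<tau>)) UNIV"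
    unfolding ft using norm_infsum_bound[of t UNIV] sw[OF v, of \<theta>] by (simp add: nt)
  then have "jac_norm M f \<tau> z \<le> infsum (w \<theta> (Im \<tau>)) UNIV * E"
    unfolding jac_norm_def using v by (intro mult_mono' order_refl) (auto simp: E_def zt power2_eq_square)
  also have "\<dots> = (\<Sum>\<^sub>\<infinity>p. w \<theta> (Im \<tau>) p * E)" by (rule infsum_cmult_left'[symmetric])
  also have "\<dots> \<le> (\<Sum>\<^sub>\<infinity>p. w 0 \<delta> p + w 1 \<delta> p)"
  proof (rule infsum_mono)
    show "(\<lambda>p. w \<theta> (Im \<tau>) p * E) summable_on UNIV" by (intro summable_on_cmult_left sw v)
    show "(\<lambda>p. w 0 \<delta> p + w 1 \<delta> p) summable_on UNIV" by (intro summable_on_add sw \<delta>)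
    fix p :: "int \<times> int"
    show "w \<theta> (Im \<tau>) p * E \<le> w 0 \<delta> p + w 1 \<delta> p"
    proof (cases "c (fst p) (snd p) = 0")
      case False
      define n r where "n = fst p" and "r = snd p"
      define e where "e = of_int n + \<theta> * of_int r + M * \<theta>\<^sup>2"
      have "e \<ge> 0" using False hol[of n r] holomorphic_exponent_nonneg[OF M, of n r \<theta>]
        by (force simp: e_def n_def r_def)
      then have "e * \<delta> \<le> e * Im \<tau>" using \<tau> by (intro mult_left_mono) auto
      moreover have "(of_int n + \<theta> * of_int r) * \<delta> \<le> e * \<delta>" using \<delta> by (intro mult_right_mono) (auto simp: e_def)
      \<comment> \<open>For 0 <= \<theta> <= 1 the number \<theta> r is at least min 0 r, which is
        the value at slope 0 or at slope 1.\<close>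
      moreover have "(of_int n + min 0 (of_int r)) * \<delta> \<le> (of_int n + \<theta> * of_int r) * \<delta>"
      proof (intro mult_right_mono add_left_mono)
        show "min 0 (real_of_int r) \<le> \<theta> * of_int r"
        proof (cases "r \<ge> 0")
          case True then show ?thesis using \<theta> by simp
        next
          case False
          then have "1 * real_of_int r \<le> \<theta> * of_int r" using \<theta> by (intro mult_right_mono_neg) auto
          then show ?thesis by simp
        qed
      qed (use \<delta> in auto)
      ultimately have "(of_int n + min 0 (of_int r)) * \<delta> \<le> e * Im \<tau>" by linarith
      then have "exp (- 2 * pi * (e * Im \<tau>)) \<le> exp (- 2 * pi * ((of_int n + min 0 (of_int r)) * \<delta>))"
        by simp
      also have "\<dots> \<le> exp (- 2 * pi * (of_int n * \<delta>)) + exp (- 2 * pi * ((of_int n + of_int r) * \<delta>))"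
        by (cases "r \<ge> 0") (auto simp: min_def)
      finally have *: "exp (- 2 * pi * (e * Im \<tau>)) \<le> exp (- 2 * pi * (of_int n * \<delta>)) + exp (- 2 * pi * ((of_int n + of_int r) * \<delta>))" .
      have "w \<theta> (Im \<tau>) p * E = norm (c n r) * exp (- 2 * pi * (e * Im \<tau>))"
        unfolding w_def E_def e_def n_def r_def by (simp add: mult.assoc exp_add[symmetric] algebra_simps)
      also have "\<dots> \<le> norm (c n r) * (exp (- 2 * pi * (of_int n * \<delta>)) + exp (- 2 * pi * ((of_int n + of_int r) * \<delta>)))"
        using * by (intro mult_left_mono) auto
      also have "\<dots> = w 0 \<delta> p + w 1 \<delta> p" by (simp add: w_def n_def r_def algebra_simps)
      finally show ?thesis .
    qed (simp add: w_def)
  qed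
  finally show "jac_norm M f \<tau> z \<le> (\<Sum>\<^sub>\<infinity>p. w 0 \<delta> p + w 1 \<delta> p)" .
qed

text \<open>In weight \<open>0\<close> the invariant norm is bounded on the whole domain, so letting \<open>Im \<tau> \<rightarrow> 0\<close> in
  Bessel's inequality makes the coefficients square summable, while every elliptic orbit of
  coefficients is infinite.\<close>

lemma weight_0_holomorphic_eq_0:
  assumes f: "has_jac_expansion f c" and T: "jacobi_transform 0 M f" and M: "M > 0"
    and hol: "\<And>n r. 4 * int M * n - r\<^sup>2 < 0 \<Longrightarrow> c n r = 0"
  shows "c n r = 0"
proof -
  obtain B where B: "\<And>\<tau> z. Im \<tau> \<ge> 1 / 5 \<Longrightarrow> 0 \<le> Im z \<Longrightarrow> Im z \<le> Im \<tau> \<Longrightarrow> jac_norm M f \<tau> z \<le> B"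
    using jac_norm_bounded_cusp[OF f M _ hol, of "1 / 5"] by auto
  have B1: "jac_norm M f \<tau> z \<le> B" if \<tau>: "Im \<tau> \<ge> 1 / 5" for \<tau> z
  proof -
    define l where "l = - \<lfloor>Im z / Im \<tau>\<rfloor>"
    have "of_int (- l) \<le> Im z / Im \<tau>" "Im z / Im \<tau> < of_int (- l) + 1" unfolding l_def by linarith+
    then have "0 \<le> Im (z + of_int l * \<tau>)" "Im (z + of_int l * \<tau>) \<le> Im \<tau>" using \<tau> by (auto simp: field_simps)
    from B[OF \<tau> this] show ?thesis using jac_norm_elliptic[OF T, of \<tau> z l] \<tau> by simp
  qed
  have B2: "jac_norm M f \<tau> z \<le> B" if \<tau>: "Im \<tau> > 0" for \<tau> z
  proof -
    obtain a b c d :: int where det: "a * d - b * c = 1" and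
      Im: "Im ((of_int a * \<tau> + of_int b) / (of_int c * \<tau> + of_int d)) \<ge> 1 / 5"
      by (rule modular_reduction[OF \<tau>])
    show ?thesis using B1[OF Im] jac_norm_modular[OF T det \<tau>, of z] by metis
  qed
  \<comment> \<open>For Im z = 0 the invariant norm is |f| itself, so \<open>B\<close> bounds |f| at
    every height v, and the damping in Bessel's inequality disappears as v tends to 0.\<close>
  have sq: "(\<Sum>(n, r)\<in>G. (norm (c n r))\<^sup>2) \<le> B\<^sup>2" if fin: "finite G" for G
  proof -
    have "((\<lambda>v. \<Sum>(n, r)\<in>G. (norm (c n r) * exp (- 2 * pi * (of_int n * v + of_int r * 0)))\<^sup>2)
        \<longlongrightarrow> (\<Sum>(n, r)\<in>G. (norm (c n r) * exp (- 2 * pi * (of_int n * 0 + of_int r * 0)))\<^sup>2)) (at_right 0)"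
      unfolding case_prod_unfold by (intro tendsto_intros)
    then have "(\<Sum>(n, r)\<in>G. (norm (c n r) * exp (- 2 * pi * (of_int n * 0 + of_int r * 0)))\<^sup>2) \<le> B\<^sup>2"
    proof (rule tendsto_upperbound)
      show "\<forall>\<^sub>F v in at_right 0. (\<Sum>(n, r)\<in>G. (norm (c n r) * exp (- 2 * pi * (of_int n * v + of_int r * 0)))\<^sup>2) \<le> B\<^sup>2"
        unfolding eventually_at_filter
      proof (intro always_eventually allI impI)
        fix v :: real assume "v \<noteq> 0" "v \<in> {0<..}"
        then have v: "v > 0" by simp
        have "norm (f (Complex u v, Complex x 0)) \<le> B" for u x
          using B2[of "Complex u v" "Complex x 0"] v by (simp add: jac_norm_def)
        from jac_bessel[OF f v fin this]
        show "(\<Sum>(n, r)\<in>G. (norm (c n r) * exp (- 2 * pi * (of_int n * v + of_int r * 0)))\<^sup>2) \<le> B\<^sup>2" .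
      qed
    qed auto
    then show ?thesis by simp
  qed
  show "c n r = 0"
  proof (rule ccontr)
    assume nz: "c n r \<noteq> 0"
    define h where "h = (\<lambda>l :: nat. (n + int l * r + int M * (int l)\<^sup>2, r + 2 * int M * int l))"
    have inj: "inj_on h A" for A using M by (auto simp: inj_on_def h_def)
    have ch: "c (fst (h l)) (snd (h l)) = c n r" for l
      using jac_elliptic_coeff[OF f T, of n r "int l"] by (simp add: h_def)
    obtain L :: nat where L: "B\<^sup>2 / (norm (c n r))\<^sup>2 < L" using reals_Archimedean2 by blast
    have "L * (norm (c n r))\<^sup>2 = (\<Sum>(n, r)\<in>h ` {..<L}. (norm (c n r))\<^sup>2)"
      by (subst sum.reindex[OF inj]) (simp add: case_prod_unfold ch)
    also have "\<dots> \<le> B\<^sup>2" by (rule sq) auto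
    finally show False using L nz by (simp add: field_simps)
  qed
qed

section \<open>Products and the operators V\<close>

text \<open>Absolute convergence allows the double series to be regrouped by total exponent. The
  supports are unrestricted here, so the convolution is an infinite sum.\<close>

lemma has_jac_expansion_mult:
  assumes f: "has_jac_expansion f c" and g: "has_jac_expansion g d"
  shows "has_jac_expansion (\<lambda>p. f p * g p)
    (\<lambda>n r. \<Sum>\<^sub>\<infinity>p. c (fst p) (snd p) * d (n - fst p) (r - snd p))"
  unfolding has_jac_expansion_def
proof (intro allI impI)
  fix \<tau> z assume \<tau>: "Im \<tau> > 0"
  define E where "E = (\<lambda>p. ee (of_int (fst p) * \<tau> + of_int (snd p) * z))"
  define a where "a = (\<lambda>p. c (fst p) (snd p) * E p)"
  define b where "b = (\<lambda>p. d (fst p) (snd p) * E p)"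
  have ha: "(a has_sum f (\<tau>, z)) UNIV" and hb: "(b has_sum g (\<tau>, z)) UNIV"
    using f g \<tau> by (simp_all add: has_jac_expansion_def a_def b_def E_def case_prod_unfold)
  have sa: "(\<lambda>p. norm (a p)) summable_on UNIV" and sb: "(\<lambda>p. norm (b p)) summable_on UNIV"
    using has_sum_imp_summable[OF ha] has_sum_imp_summable[OF hb]
    by (simp_all only: summable_on_iff_abs_summable_on_complex)
  have "(\<lambda>x. norm (case x of (p, q) \<Rightarrow> a p * b q)) summable_on (UNIV \<times> UNIV)"
  proof (rule Infinite_Sum.abs_summable_on_Sigma_iff[THEN iffD2], intro conjI ballI)
    show "(\<lambda>y. norm (case (p, y) of (p, q) \<Rightarrow> a p * b q)) summable_on UNIV" for p
      by (simp add: norm_mult summable_on_cmult_right sb)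
    show "(\<lambda>p. norm (\<Sum>\<^sub>\<infinity>y. norm (case (p, y) of (p, q) \<Rightarrow> a p * b q))) summable_on UNIV"
      by (simp add: norm_mult infsum_cmult_right' abs_mult summable_on_cmult_left sa)
  qed
  then have sab: "(\<lambda>(p, q). a p * b q) summable_on (UNIV \<times> UNIV)"
    by (simp only: summable_on_iff_abs_summable_on_complex)
  have "((\<lambda>(p, q). a p * b q) has_sum f (\<tau>, z) * g (\<tau>, z)) (UNIV \<times> UNIV)"
    by (rule has_sum_SigmaI[OF _ has_sum_cmult_left[OF ha] sab]) (auto intro: has_sum_cmult_right hb)
  then have H: "((\<lambda>(s, p). a p * b (s - p)) has_sum f (\<tau>, z) * g (\<tau>, z)) (UNIV \<times> UNIV)"
    by (subst has_sum_reindex_bij_witness[where i = "\<lambda>(p, q). (p + q, p)" and j = "\<lambda>(s, p). (p, s - p)"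
          and T = "UNIV \<times> UNIV" and h = "\<lambda>(p, q). a p * b q"]) auto
  have E: "E p * E (s - p) = E s" for p s
    by (simp add: E_def ee_add[symmetric] algebra_simps)
  have ab: "a p * b (s - p) = (c (fst p) (snd p) * d (fst s - fst p) (snd s - snd p)) * E s" for s p
    by (simp add: a_def b_def mult_ac flip: E[of p s])
  have inner: "((\<lambda>p. a p * b (s - p)) has_sum (\<Sum>\<^sub>\<infinity>p. c (fst p) (snd p) * d (fst s - fst p) (snd s - snd p)) * E s) UNIV" for s
  proof -
    have "(\<lambda>p. a p * b (s - p)) summable_on UNIV"
      using summable_on_SigmaD1[OF has_sum_imp_summable[OF H], of s] by simp
    then have "((\<lambda>p. a p * b (s - p)) has_sum (\<Sum>\<^sub>\<infinity>p. a p * b (s - p))) UNIV" by simp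
    then show ?thesis unfolding ab by (simp only: infsum_cmult_left')
  qed
  have "((\<lambda>s. (\<Sum>\<^sub>\<infinity>p. c (fst p) (snd p) * d (fst s - fst p) (snd s - snd p)) * E s) has_sum f (\<tau>, z) * g (\<tau>, z)) UNIV"
    by (rule has_sum_SigmaD[OF H]) (simp add: inner)
  then show "((\<lambda>(n, r). (\<Sum>\<^sub>\<infinity>p. c (fst p) (snd p) * d (n - fst p) (r - snd p)) * ee (of_int n * \<tau> + of_int r * z)) has_sum f (\<tau>, z) * g (\<tau>, z)) UNIV"
    by (simp add: E_def case_prod_unfold)
qed

lemma has_jac_expansion_1: "has_jac_expansion (\<lambda>p. 1) (\<lambda>n r. if n = 0 \<and> r = 0 then 1 else 0)"
proof -
  have "((\<lambda>(n, r). (if n = 0 \<and> r = 0 then 1 else 0) * ee (of_int n * \<tau> + of_int r * z)) has_sum 1) UNIV" for \<tau> z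
  proof -
    have "((\<lambda>(n, r). (if n = 0 \<and> r = 0 then 1 else 0) * ee (of_int n * \<tau> + of_int r * z)) has_sum 1) {(0 :: int, 0 :: int)}"
      by (rule has_sum_finiteI) auto
    then show ?thesis by (rule has_sum_cong_neutral[THEN iffD1, rotated -1]) (auto split: if_splits)
  qed
  then show ?thesis by (simp add: has_jac_expansion_def)
qed

lemma has_jac_expansion_power:
  "has_jac_expansion f c \<Longrightarrow> \<exists>d. has_jac_expansion (\<lambda>p. f p ^ m) d"
  by (induction m) (auto intro: has_jac_expansion_1 has_jac_expansion_mult)

lemma ee_root_sum_dvd:
  assumes d: "d > 0"
  shows "(\<Sum>b<d. ee (of_int n * (of_nat b / of_nat d))) = (if int d dvd n then of_nat d else 0)"
proof (cases "int d dvd n")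
  case True
  then obtain k where k: "n = int d * k" by auto
  have "ee (of_int n * (of_nat b / of_nat d)) = 1" for b
  proof -
    have "of_int n * (of_nat b / of_nat d) = (of_int (k * int b) :: complex)" using d by (simp add: k)
    then show ?thesis by (simp only: ee_of_int)
  qed
  then show ?thesis using True by simp
next
  case False
  have "ee (of_int n * (of_nat b / of_nat d)) = ee (of_int (n mod int d) * (of_nat b / of_nat d))" for b
  proof -
    have "of_int n * (of_nat b / of_nat d) = of_int (n mod int d) * (of_nat b / of_nat d) + (of_int (n div int d * int b) :: complex)"
    proof -
      have "(of_int n :: complex) = of_int (n div int d) * of_nat d + of_int (n mod int d)"
        by (metis div_mult_mod_eq of_int_add of_int_mult of_int_of_nat_eq)
      then show ?thesis using d by (simp add: field_simps)
    qed
    then show ?thesis by (simp only: ee_add ee_of_int mult_1_right)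
  qed
  moreover have "\<bar>n mod int d\<bar> < int d" using d by simp
  moreover have "n mod int d \<noteq> 0" using False by (simp add: dvd_eq_mod_eq_0)
  ultimately show ?thesis using ee_root_sum[of "n mod int d" d] False by simp
qed

lemma has_sum_finite_sum:
  assumes "finite I" "\<And>i. i \<in> I \<Longrightarrow> (f i has_sum s i) A"
  shows "((\<lambda>x. \<Sum>i\<in>I. f i x) has_sum (\<Sum>i\<in>I. s i :: complex)) A"
  using assms by (induction I rule: finite_induct) (auto intro: has_sum_add)

text \<open>The sum over b retains only exponents n divisible by d, and the surviving pair (n, r)
  moves to (a n / d, a r).\<close>

lemma has_jac_expansion_hecke:
  assumes f: "has_jac_expansion f c" and d: "d > 0" and a: "a > 0"
  shows "has_jac_expansion (\<lambda>(\<tau>, z). \<Sum>b<d. f ((of_nat a * \<tau> + of_nat b) / of_nat d, of_nat a * z))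
    (\<lambda>n r. if int a dvd n \<and> int a dvd r then of_nat d * c (n div int a * int d) (r div int a) else 0)"
    (is "has_jac_expansion ?g ?c")
  unfolding has_jac_expansion_def
proof (intro allI impI)
  fix \<tau> z assume \<tau>: "Im \<tau> > 0"
  have "Im ((of_nat a * \<tau> + of_nat b) / of_nat d) > 0" for b
    using \<tau> d a by (simp add: Im_divide_of_nat)
  then have one: "((\<lambda>p. c (fst p) (snd p) * ee (of_int (fst p) * ((of_nat a * \<tau> + of_nat b) / of_nat d) + of_int (snd p) * (of_nat a * z)))
      has_sum f ((of_nat a * \<tau> + of_nat b) / of_nat d, of_nat a * z)) UNIV" for b
    using f unfolding has_jac_expansion_def case_prod_unfold by blast
  have "((\<lambda>p. \<Sum>b<d. c (fst p) (snd p) * ee (of_int (fst p) * ((of_nat a * \<tau> + of_nat b) / of_nat d) + of_int (snd p) * (of_nat a * z)))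
      has_sum ?g (\<tau>, z)) UNIV"
    unfolding case_prod_conv by (rule has_sum_finite_sum[OF finite_lessThan one])
  moreover have "(\<Sum>b<d. c (fst p) (snd p) * ee (of_int (fst p) * ((of_nat a * \<tau> + of_nat b) / of_nat d) + of_int (snd p) * (of_nat a * z)))
     = (if int d dvd fst p then of_nat d * c (fst p) (snd p) else 0) * ee (of_int (fst p) * (of_nat a * \<tau> / of_nat d) + of_int (snd p) * (of_nat a * z))" for p
  proof -
    have "ee (of_int (fst p) * ((of_nat a * \<tau> + of_nat b) / of_nat d) + of_int (snd p) * (of_nat a * z))
      = ee (of_int (fst p) * (of_nat a * \<tau> / of_nat d) + of_int (snd p) * (of_nat a * z)) * ee (of_int (fst p) * (of_nat b / of_nat d))" for b
      unfolding ee_add[symmetric] by (simp add: algebra_simps add_divide_distrib)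
    note e = this
    show ?thesis
      unfolding e sum_distrib_left[symmetric] ee_root_sum_dvd[OF d] by simp
  qed
  ultimately have H: "((\<lambda>p. (if int d dvd fst p then of_nat d * c (fst p) (snd p) else 0) * ee (of_int (fst p) * (of_nat a * \<tau> / of_nat d) + of_int (snd p) * (of_nat a * z))) has_sum ?g (\<tau>, z)) UNIV"
    by (simp only:)
  define S where "S = {p :: int \<times> int. int d dvd fst p}"
  define T where "T = {p :: int \<times> int. int a dvd fst p \<and> int a dvd snd p}"
  have HS: "((\<lambda>p. of_nat d * c (fst p) (snd p) * ee (of_int (fst p) * (of_nat a * \<tau> / of_nat d) + of_int (snd p) * (of_nat a * z))) has_sum ?g (\<tau>, z)) S"
  proof -
    have "((\<lambda>p. (if int d dvd fst p then of_nat d * c (fst p) (snd p) else 0) * ee (of_int (fst p) * (of_nat a * \<tau> / of_nat d) + of_int (snd p) * (of_nat a * z))) has_sum ?g (\<tau>, z)) UNIV \<longleftrightarrow> ((\<lambda>p. of_nat d * c (fst p) (snd p) * ee (of_int (fst p) * (of_nat a * \<tau> / of_nat d) + of_int (snd p) * (of_nat a * z))) has_sum ?g (\<tau>, z)) S"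
      by (rule has_sum_cong_neutral) (auto simp: S_def)
    with H show ?thesis by blast
  qed
  \<comment> \<open>Mutually inverse relabellings between the surviving exponents \<open>S\<close>
    and their new positions \<open>T\<close>.\<close>
  let ?i = "\<lambda>p. (fst p div int a * int d, snd p div int a)"
  let ?j = "\<lambda>p. (fst p div int d * int a, snd p * int a)"
  have "((\<lambda>p. ?c (fst p) (snd p) * ee (of_int (fst p) * \<tau> + of_int (snd p) * z)) has_sum ?g (\<tau>, z)) T"
    using HS
  proof (rule has_sum_reindex_bij_witness[where i = ?i and j = ?j, THEN iffD1, rotated -1])
    show "?i (?j p) = p" if "p \<in> S" for p
      using that a d by (auto simp: S_def)
    show "?j p \<in> T" if "p \<in> S" for p
      using that by (auto simp: T_def)
    show "?j (?i p) = p" if "p \<in> T" for p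
      using that a d by (auto simp: T_def)
    show "?i p \<in> S" if "p \<in> T" for p
      using that by (auto simp: S_def)
    fix p assume "p \<in> S"
    then obtain k where k: "fst p = int d * k" by (auto simp: S_def)
    show "?c (fst (?j p)) (snd (?j p)) *
       ee (of_int (fst (?j p)) * \<tau> + of_int (snd (?j p)) * z)
      = of_nat d * c (fst p) (snd p) * ee (of_int (fst p) * (of_nat a * \<tau> / of_nat d) + of_int (snd p) * (of_nat a * z))"
      using a d by (simp add: k mult_ac)
  qed auto
  then have "((\<lambda>p. ?c (fst p) (snd p) * ee (of_int (fst p) * \<tau> + of_int (snd p) * z)) has_sum ?g (\<tau>, z)) UNIV"
    by (rule has_sum_cong_neutral[THEN iffD1, rotated -1]) (auto simp: T_def)
  then show "((\<lambda>(n, r). ?c n r * ee (of_int n * \<tau> + of_int r * z)) has_sum ?g (\<tau>, z)) UNIV"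
    by (simp only: case_prod_unfold)
qed

lemma has_jac_expansion_V:
  assumes f: "has_jac_expansion f c" and m: "m > 0"
  shows "\<exists>c'. has_jac_expansion (jacobi_V k m f) c'"
proof -
  let ?h = "\<lambda>d. \<lambda>(\<tau>, z). \<Sum>b<d. f ((of_nat (m div d) * \<tau> + of_nat b) / of_nat d, of_nat (m div d) * z)"
  have "\<exists>c'. has_jac_expansion (?h d) c'" if "d dvd m" for d
    by (rule exI, rule has_jac_expansion_hecke[OF f])
       (use that m in \<open>auto intro: dvd_pos_nat simp: div_greater_zero_iff dvd_imp_le\<close>)
  then obtain C where C: "\<And>d. d dvd m \<Longrightarrow> has_jac_expansion (?h d) (C d)" by metis
  have "has_jac_expansion (\<lambda>p. of_nat m powi (k - 1) * (\<Sum>d | d dvd m. of_nat d powi (- k) * ?h d p))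
      (\<lambda>n r. of_nat m powi (k - 1) * (\<Sum>d | d dvd m. of_nat d powi (- k) * C d n r))"
    using m by (intro has_jac_expansion_scale has_jac_expansion_sum C) auto
  then have "has_jac_expansion (jacobi_V k m f) (\<lambda>n r. of_nat m powi (k - 1) * (\<Sum>d | d dvd m. of_nat d powi (- k) * C d n r))"
    by (rule has_jac_expansion_cong) (simp add: jacobi_V_def sum_distrib_left)
  then show ?thesis by blast
qed

lemma jacobi_V_sum:
  "jacobi_V k m (\<lambda>p. \<Sum>s\<in>S. x s * f s p) p = (\<Sum>s\<in>S. x s * jacobi_V k m (f s) p)"
  by (simp add: jacobi_V_def case_prod_unfold sum_distrib_left mult_ac sum.swap[of _ S])

lemma jacobi_V_cong:
  assumes "\<And>\<tau> z. Im \<tau> > 0 \<Longrightarrow> f (\<tau>, z) = g (\<tau>, z)" "Im \<tau> > 0" "m > 0"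
  shows "jacobi_V k m f (\<tau>, z) = jacobi_V k m g (\<tau>, z)"
proof -
  have "Im ((of_nat (m div d) * \<tau> + of_nat b) / of_nat d) > 0" if "d dvd m" for d b
  proof -
    have "d > 0" "m div d > 0" using that assms(3) by (auto intro: dvd_pos_nat simp: div_greater_zero_iff dvd_imp_le)
    then show ?thesis using assms(2) by (simp add: Im_divide_of_nat)
  qed
  then show ?thesis unfolding jacobi_V_def by (auto simp: assms(1) intro!: sum.cong)
qed

lemma jacobi_V_1: "jacobi_V 0 1 f p = f p"
  by (cases p) (simp add: jacobi_V_def)

section \<open>Theta blocks at points of irrational slope\<close>

lemma convergent_prod_ee:
  assumes \<tau>: "Im \<tau> > 0"
  shows "convergent_prod (\<lambda>n. 1 - ee (of_nat (Suc n) * \<tau> + w))"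
proof -
  define q where "q = exp (- 2 * pi * Im \<tau>)"
  have q: "0 \<le> q" "q < 1" using \<tau> by (auto simp: q_def)
  have "norm (1 - ee (of_nat (Suc n) * \<tau> + w) - 1) = norm (ee (\<tau> + w)) * q ^ n" for n
    unfolding q_def by (simp add: norm_ee exp_of_nat_mult[symmetric] exp_add[symmetric] algebra_simps)
  moreover have "summable (\<lambda>n. norm (ee (\<tau> + w)) * q ^ n)"
    using q by (intro summable_mult summable_geometric) auto
  ultimately have "summable (\<lambda>n. norm (1 - ee (of_nat (Suc n) * \<tau> + w) - 1))"
    by (simp only:)
  then show ?thesis
    by (intro abs_convergent_prod_imp_convergent_prod) (simp add: abs_convergent_prod_conv_summable)
qed

lemma one_minus_ee_nonzero: "Im x \<noteq> 0 \<Longrightarrow> 1 - ee x \<noteq> 0"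
  by (auto simp: ee_eq_1_iff complex_is_Int_iff)

lemma dedekind_eta_nonzero:
  assumes \<tau>: "Im \<tau> > 0"
  shows "dedekind_eta \<tau> \<noteq> 0"
proof -
  have "(\<Prod>n. 1 - ee (of_nat (Suc n) * \<tau>)) \<noteq> 0"
    using convergent_prod_ee[OF \<tau>, of 0] \<tau>
    by (intro prodinf_nonzero one_minus_ee_nonzero) (auto simp del: of_nat_Suc)
  then show ?thesis by (simp add: dedekind_eta_def)
qed

text \<open>The zeros in z are the points of Z \<tau> + Z, at which Im z / Im \<tau> is an integer;
  each factor of the product is checked separately.\<close>

lemma jacobi_theta_nonzero:
  assumes \<tau>: "Im \<tau> > 0" and z: "Im z / Im \<tau> \<notin> \<rat>"
  shows "jacobi_theta \<tau> z \<noteq> 0"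
proof -
  have ne: "Im (of_int m * \<tau> + z) \<noteq> 0" for m
  proof
    assume "Im (of_int m * \<tau> + z) = 0"
    then have "Im z / Im \<tau> = of_int (- m)" using \<tau> by (simp add: field_simps)
    then show False using z by (metis Rats_of_int)
  qed
  have p: "Im (of_nat (Suc n) * \<tau> + z) \<noteq> 0" "Im (of_nat (Suc n) * \<tau> - z) \<noteq> 0" for n
    using ne[of "int (Suc n)"] ne[of "- int (Suc n)"] by (auto simp del: of_nat_Suc)
  have "(\<Prod>n. (1 - ee (of_nat (Suc n) * \<tau>)) * (1 - ee (of_nat (Suc n) * \<tau> + z)) * (1 - ee (of_nat (Suc n) * \<tau> - z))) \<noteq> 0"
  proof (intro prodinf_nonzero convergent_prod_mult)
    show "convergent_prod (\<lambda>n. 1 - ee (of_nat (Suc n) * \<tau>))" using convergent_prod_ee[OF \<tau>, of 0] by simp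
    show "convergent_prod (\<lambda>n. 1 - ee (of_nat (Suc n) * \<tau> + z))" by (rule convergent_prod_ee[OF \<tau>])
    show "convergent_prod (\<lambda>n. 1 - ee (of_nat (Suc n) * \<tau> - z))" using convergent_prod_ee[OF \<tau>, of "- z"] by simp
    show "(1 - ee (of_nat (Suc n) * \<tau>)) * (1 - ee (of_nat (Suc n) * \<tau> + z)) * (1 - ee (of_nat (Suc n) * \<tau> - z)) \<noteq> 0" for n
      using p[of n] \<tau> by (intro no_zero_divisors one_minus_ee_nonzero) (auto simp del: of_nat_Suc)
  qed
  moreover have "ee (z / 2) - ee (- z / 2) \<noteq> 0"
  proof
    assume "ee (z / 2) - ee (- z / 2) = 0"
    then have "ee (z / 2) = inverse (ee (z / 2))" by (simp add: ee_minus)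
    then have "ee (z / 2) * ee (z / 2) = 1" by (metis ee_nonzero right_inverse)
    then have "ee z = 1" by (simp flip: ee_add)
    then show False using one_minus_ee_nonzero[of z] ne[of 0] by simp
  qed
  ultimately show ?thesis by (simp add: jacobi_theta_def)
qed

lemma jacobi_theta_multiple_nonzero:
  assumes \<tau>: "Im \<tau> > 0" and z: "Im z / Im \<tau> \<notin> \<rat>" and r: "r \<ge> 1"
  shows "jacobi_theta \<tau> (of_nat r * z) \<noteq> 0"
proof (rule jacobi_theta_nonzero[OF \<tau>])
  show "Im (of_nat r * z) / Im \<tau> \<notin> \<rat>"
  proof
    assume "Im (of_nat r * z) / Im \<tau> \<in> \<rat>"
    from Rats_divide[OF this Rats_of_nat[of r]]
    have "Im (of_nat r * z) / Im \<tau> / of_nat r \<in> \<rat>" .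
    then show False using z r by simp
  qed
qed

text \<open>Irrational slope is a notion of good point that serves all exponent functions
  \<open>e\<close> at once: zeros of theta at r z are r-division points, of rational slope.\<close>

lemma theta_block_nonzero:
  assumes "is_theta_block e f" and \<tau>: "Im \<tau> > 0" and z: "Im z / Im \<tau> \<notin> \<rat>"
  shows "theta_block_regular e \<tau> z" "f (\<tau>, z) = theta_block e \<tau> z" "f (\<tau>, z) \<noteq> 0"
proof -
  show reg: "theta_block_regular e \<tau> z"
    by (simp add: theta_block_regular_def jacobi_theta_multiple_nonzero[OF \<tau> z])
  show eq: "f (\<tau>, z) = theta_block e \<tau> z"
    using assms(1) \<tau> reg by (simp add: is_theta_block_def)
  have "finite {r. 1 \<le> r \<and> e r \<noteq> 0}"
    using assms(1) by (auto simp: is_theta_block_def intro: finite_subset)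
  then show "f (\<tau>, z) \<noteq> 0"
    unfolding eq theta_block_def
    using jacobi_theta_multiple_nonzero[OF \<tau> z] dedekind_eta_nonzero[OF \<tau>] by simp
qed

section \<open>Elements of the paramodular group\<close>

lemma vector_4:
  "(vector [w, x, y, z] :: 'a::zero ^ 4) $ 1 = w" "(vector [w, x, y, z] :: 'a::zero ^ 4) $ 2 = x"
  "(vector [w, x, y, z] :: 'a::zero ^ 4) $ 3 = y" "(vector [w, x, y, z] :: 'a::zero ^ 4) $ 4 = z"
  unfolding vector_def by simp_all

text \<open>The block matrix diag(A, A^-T) for A = (a b; c d) of determinant 1, which acts by
  \<Omega> -> A \<Omega> A^T.\<close>

definition levi_element :: "rat \<Rightarrow> rat \<Rightarrow> rat \<Rightarrow> rat \<Rightarrow> rat^4^4" where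
  "levi_element a b c d = vector [vector [a, b, 0, 0], vector [c, d, 0, 0],
     vector [0, 0, d, - c], vector [0, 0, - b, a]]"

definition translation_element :: "rat \<Rightarrow> rat \<Rightarrow> rat \<Rightarrow> rat^4^4" where
  "translation_element a b c = vector [vector [1, 0, a, b], vector [0, 1, b, c],
     vector [0, 0, 1, 0], vector [0, 0, 0, 1]]"

lemma levi_element_mult:
  assumes "a * d - b * c = 1"
  shows "levi_element a b c d *v (levi_element d (- b) (- c) a *v x) = x"
proof -
  have *: "a * (d * y) = y + b * (c * y)" for y
    using assms by algebra
  show ?thesis
    by (simp add: vec_eq_iff forall_4 matrix_vector_mult_def sum_4 levi_element_def vector_4 algebra_simps *)
qed

lemma translation_element_mult:
  "translation_element a b c *v (translation_element (- a) (- b) (- c) *v x) = x"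
  by (simp add: vec_eq_iff forall_4 matrix_vector_mult_def sum_4 translation_element_def vector_4 algebra_simps)

text \<open>The factor N in b comes from the last coordinate a x4 - b x3, which has to stay in N
  Z.\<close>

lemma levi_element_lattice:
  assumes "a \<in> \<int>" "b = of_nat N * b'" "b' \<in> \<int>" "c \<in> \<int>" "d \<in> \<int>" "x \<in> paramodular_lattice N"
  shows "levi_element a b c d *v x \<in> paramodular_lattice N"
proof -
  obtain j where j: "j \<in> \<int>" "x $ 4 = of_nat N * j" and x: "x $ 1 \<in> \<int>" "x $ 2 \<in> \<int>" "x $ 3 \<in> \<int>"
    using assms(6) by (auto simp: paramodular_lattice_def)
  have "a * j - b' * x $ 3 \<in> \<int>" using assms j x by auto
  moreover have "a * (x $ 4) - b * x $ 3 = of_nat N * (a * j - b' * x $ 3)"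
    using assms j by (simp add: algebra_simps)
  ultimately have "\<exists>j\<in>\<int>. a * (x $ 4) - b * x $ 3 = of_nat N * j" by blast
  then show ?thesis
    using assms j x
    by (simp add: paramodular_lattice_def matrix_vector_mult_def sum_4 levi_element_def vector_4)
qed

text \<open>As x4 lies in N Z, the entry c may have denominator N. This gives \<open>F\<close> the
  period 1/N in \<omega>.\<close>

lemma translation_element_lattice:
  assumes "a \<in> \<int>" "b \<in> \<int>" "of_nat N * c \<in> \<int>" "x \<in> paramodular_lattice N"
  shows "translation_element a b c *v x \<in> paramodular_lattice N"
proof -
  obtain j where j: "j \<in> \<int>" "x $ 4 = of_nat N * j" and x: "x $ 1 \<in> \<int>" "x $ 2 \<in> \<int>" "x $ 3 \<in> \<int>"
    using assms(4) by (auto simp: paramodular_lattice_def)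
  have "c * x $ 4 = of_nat N * c * j" by (simp add: j)
  also have "\<dots> \<in> \<int>" by (rule Ints_mult[OF assms(3) j(1)])
  finally have "c * x $ 4 \<in> \<int>" .
  moreover have "x $ 4 \<in> \<int>" using j by simp
  ultimately show ?thesis
    using assms(1,2) x j
    by (auto simp: paramodular_lattice_def matrix_vector_mult_def sum_4 translation_element_def vector_4)
qed

lemma levi_element_paramodular:
  fixes a b c d :: int
  assumes det: "a * d - b * c = 1" and N: "int N dvd b"
  shows "levi_element (of_int a) (of_int b) (of_int c) (of_int d) \<in> paramodular_group N"
proof -
  let ?g = "levi_element (of_int a) (of_int b) (of_int c) (of_int d)"
  let ?h = "levi_element (of_int d) (- of_int b) (- of_int c) (of_int a)"
  have det': "of_int a * of_int d - of_int b * of_int c = (1 :: rat)"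
    using det by (metis of_int_1 of_int_diff of_int_mult)
  obtain b' where b': "b = int N * b'" using N by auto
  have g: "?g *v x \<in> paramodular_lattice N" if "x \<in> paramodular_lattice N" for x
    using that by (intro levi_element_lattice[of _ _ _ "of_int b'"]) (auto simp: b')
  have h: "?h *v x \<in> paramodular_lattice N" if "x \<in> paramodular_lattice N" for x
    using that by (intro levi_element_lattice[of _ _ _ "- of_int b'"]) (auto simp: b')
  have "(\<lambda>x. ?g *v x) ` paramodular_lattice N = paramodular_lattice N"
  proof (intro equalityI subsetI)
    fix x assume "x \<in> paramodular_lattice N"
    then show "x \<in> (\<lambda>x. ?g *v x) ` paramodular_lattice N"
      using h levi_element_mult[OF det', of x] by (metis image_eqI)
  qed (use g in auto)
  moreover have "of_int a * (of_int d * y) = (y :: rat) + of_int b * (of_int c * y)" for y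
    using det' by algebra
  then have "transpose ?g ** symplectic_J ** ?g = symplectic_J"
    using det'
    by (simp add: vec_eq_iff forall_4 matrix_matrix_mult_def sum_4 transpose_def levi_element_def symplectic_J_def vector_4 algebra_simps)
  ultimately show ?thesis by (simp add: paramodular_group_def)
qed

lemma translation_element_paramodular:
  assumes "a \<in> \<int>" "b \<in> \<int>" "of_nat N * c \<in> \<int>"
  shows "translation_element a b c \<in> paramodular_group N"
proof -
  let ?g = "translation_element a b c" and ?h = "translation_element (- a) (- b) (- c)"
  have g: "?g *v x \<in> paramodular_lattice N" if "x \<in> paramodular_lattice N" for x
    using assms that by (rule translation_element_lattice)
  have h: "?h *v x \<in> paramodular_lattice N" if "x \<in> paramodular_lattice N" for x
    using assms that by (intro translation_element_lattice) auto
  have "(\<lambda>x. ?g *v x) ` paramodular_lattice N = paramodular_lattice N"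
  proof (intro equalityI subsetI)
    fix x assume "x \<in> paramodular_lattice N"
    then show "x \<in> (\<lambda>x. ?g *v x) ` paramodular_lattice N"
      using h translation_element_mult[of a b c x] by (metis image_eqI)
  qed (use g in auto)
  moreover have "transpose ?g ** symplectic_J ** ?g = symplectic_J"
    by (simp add: vec_eq_iff forall_4 matrix_matrix_mult_def sum_4 transpose_def translation_element_def symplectic_J_def vector_4 algebra_simps)
  ultimately show ?thesis by (simp add: paramodular_group_def)
qed

lemma siegel_point_in_space_iff:
  "siegel_point \<tau> z \<omega> \<in> siegel_upper_half_space \<longleftrightarrow> Im \<tau> > 0 \<and> (Im z)\<^sup>2 < Im \<tau> * Im \<omega>"
proof -
  let ?v = "Im \<tau>" and ?y = "Im z" and ?w = "Im \<omega>"
  have form: "x \<bullet> ((\<chi> i j. Im (siegel_point \<tau> z \<omega> $ i $ j)) *v x) = ?v * (x $ 1)\<^sup>2 + 2 * ?y * (x $ 1) * (x $ 2) + ?w * (x $ 2)\<^sup>2" for x :: "real^2"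
    by (simp add: siegel_point_def inner_vec_def matrix_vector_mult_def sum_2 power2_eq_square algebra_simps)
  have sym: "transpose (siegel_point \<tau> z \<omega>) = siegel_point \<tau> z \<omega>"
    by (simp add: siegel_point_def transpose_def vec_eq_iff forall_2)
  have "(\<forall>x :: real^2. x \<noteq> 0 \<longrightarrow> ?v * (x $ 1)\<^sup>2 + 2 * ?y * (x $ 1) * (x $ 2) + ?w * (x $ 2)\<^sup>2 > 0) \<longleftrightarrow> ?v > 0 \<and> ?y\<^sup>2 < ?v * ?w"
  proof (intro iffI conjI allI impI)
    assume *: "\<forall>x :: real^2. x \<noteq> 0 \<longrightarrow> ?v * (x $ 1)\<^sup>2 + 2 * ?y * (x $ 1) * (x $ 2) + ?w * (x $ 2)\<^sup>2 > 0"
    have ne: "vector [p, q] \<noteq> (0 :: real^2)" if "p \<noteq> 0 \<or> q \<noteq> 0" for p q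
      using that by (auto simp: vec_eq_iff forall_2)
    show v: "?v > 0" using *[rule_format, OF ne[of 1 0]] by simp
    \<comment> \<open>On the test vector (- Im z, Im \<tau>) the form equals Im \<tau> times its
      determinant.\<close>
    have "?v * (- ?y)\<^sup>2 + 2 * ?y * (- ?y) * ?v + ?w * ?v\<^sup>2 > 0"
      using *[rule_format, OF ne[of "- ?y" ?v]] v by simp
    then have "?v * (?v * ?w - ?y\<^sup>2) > 0" by (simp add: power2_eq_square algebra_simps)
    then show "?y\<^sup>2 < ?v * ?w" using v by (simp add: zero_less_mult_iff)
  next
    fix x :: "real^2" assume *: "?v > 0 \<and> ?y\<^sup>2 < ?v * ?w" and x: "x \<noteq> 0"
    have "?v * (?v * (x $ 1)\<^sup>2 + 2 * ?y * (x $ 1) * (x $ 2) + ?w * (x $ 2)\<^sup>2) = (?v * x $ 1 + ?y * x $ 2)\<^sup>2 + (?v * ?w - ?y\<^sup>2) * (x $ 2)\<^sup>2"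
      by (simp add: power2_eq_square algebra_simps)
    also have "\<dots> > 0"
    proof (cases "x $ 2 = 0")
      case True
      then have "x $ 1 \<noteq> 0" using x by (auto simp: vec_eq_iff forall_2)
      then show ?thesis using True * by simp
    next
      case False
      then show ?thesis using * by (intro add_nonneg_pos mult_pos_pos) auto
    qed
    finally show "?v * (x $ 1)\<^sup>2 + 2 * ?y * (x $ 1) * (x $ 2) + ?w * (x $ 2)\<^sup>2 > 0"
      using * by (simp add: zero_less_mult_iff)
  qed
  then show ?thesis by (simp add: siegel_upper_half_space_def form sym)
qed

lemma matrix_inv_eq:
  fixes A B :: "complex^2^2"
  assumes "A ** B = mat 1" "B ** A = mat 1"
  shows "matrix_inv A = B"
proof -
  have "A ** matrix_inv A = mat 1 \<and> matrix_inv A ** A = mat 1"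
    unfolding matrix_inv_def by (rule someI_ex) (use assms in blast)
  then show ?thesis by (metis assms(2) matrix_mul_assoc matrix_mul_lid matrix_mul_rid)
qed

text \<open>The denominator is A^-T, of determinant 1, so invariance of \<open>F\<close> under these
  elements is independent of the weight.\<close>

lemma siegel_act_levi:
  fixes a b c d :: int
  assumes det: "a * d - b * c = 1"
  defines "g \<equiv> levi_element (of_int a) (of_int b) (of_int c) (of_int d)"
  shows "siegel_act g (siegel_point \<tau> z \<omega>) = siegel_point
     (of_int a ^ 2 * \<tau> + 2 * of_int a * of_int b * z + of_int b ^ 2 * \<omega>)
     (of_int a * of_int c * \<tau> + (of_int a * of_int d + of_int b * of_int c) * z + of_int b * of_int d * \<omega>)
     (of_int c ^ 2 * \<tau> + 2 * of_int c * of_int d * z + of_int d ^ 2 * \<omega>)"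
   and "det (siegel_denom g (siegel_point \<tau> z \<omega>)) = 1"
proof -
  have det': "of_int a * of_int d - of_int b * of_int c = (1 :: complex)"
    using det by (metis of_int_1 of_int_diff of_int_mult)
  have D: "siegel_denom g (siegel_point \<tau> z \<omega>) = vector [vector [of_int d, - of_int c], vector [- of_int b, of_int a]]"
    by (simp add: siegel_denom_def block2_def g_def levi_element_def vector_4 vec_eq_iff forall_2 matrix_matrix_mult_def sum_2 of_rat_minus)
  have inv: "matrix_inv (siegel_denom g (siegel_point \<tau> z \<omega>)) = vector [vector [of_int a, of_int c], vector [of_int b, of_int d]]"
    unfolding D using det' by (intro matrix_inv_eq) (simp_all add: vec_eq_iff forall_2 matrix_matrix_mult_def sum_2 mat_def algebra_simps)
  show "det (siegel_denom g (siegel_point \<tau> z \<omega>)) = 1"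
    unfolding D using det' by (simp add: det_2 algebra_simps)
  show "siegel_act g (siegel_point \<tau> z \<omega>) = siegel_point
     (of_int a ^ 2 * \<tau> + 2 * of_int a * of_int b * z + of_int b ^ 2 * \<omega>)
     (of_int a * of_int c * \<tau> + (of_int a * of_int d + of_int b * of_int c) * z + of_int b * of_int d * \<omega>)
     (of_int c ^ 2 * \<tau> + 2 * of_int c * of_int d * z + of_int d ^ 2 * \<omega>)"
    unfolding siegel_act_def inv
    by (simp add: block2_def g_def levi_element_def siegel_point_def vector_4 vec_eq_iff forall_2 matrix_matrix_mult_def sum_2 power2_eq_square algebra_simps)
qed

lemma siegel_act_translation:
  fixes a b c :: rat
  defines "g \<equiv> translation_element a b c"
  shows "siegel_act g (siegel_point \<tau> z \<omega>) = siegel_point (\<tau> + of_rat a) (z + of_rat b) (\<omega> + of_rat c)"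
    and "det (siegel_denom g (siegel_point \<tau> z \<omega>)) = 1"
proof -
  have D: "siegel_denom g (siegel_point \<tau> z \<omega>) = mat 1"
    by (simp add: siegel_denom_def block2_def g_def translation_element_def vector_4 vec_eq_iff forall_2 matrix_matrix_mult_def sum_2 mat_def)
  have inv: "matrix_inv (siegel_denom g (siegel_point \<tau> z \<omega>)) = mat 1"
    unfolding D by (intro matrix_inv_eq) simp_all
  show "det (siegel_denom g (siegel_point \<tau> z \<omega>)) = 1"
    unfolding D by simp
  show "siegel_act g (siegel_point \<tau> z \<omega>) = siegel_point (\<tau> + of_rat a) (z + of_rat b) (\<omega> + of_rat c)"
    unfolding siegel_act_def inv
    by (simp add: block2_def g_def translation_element_def siegel_point_def vector_4 vec_eq_iff forall_2 matrix_matrix_mult_def sum_2 mat_def)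
qed

lemma paramodular_levi:
  fixes a b c d :: int
  assumes F: "F \<in> paramodular_forms k N" and det: "a * d - b * c = 1" and N: "int N dvd b"
    and in_space: "siegel_point \<tau> z \<omega> \<in> siegel_upper_half_space"
  shows "F (siegel_point
     (of_int a ^ 2 * \<tau> + 2 * of_int a * of_int b * z + of_int b ^ 2 * \<omega>)
     (of_int a * of_int c * \<tau> + (of_int a * of_int d + of_int b * of_int c) * z + of_int b * of_int d * \<omega>)
     (of_int c ^ 2 * \<tau> + 2 * of_int c * of_int d * z + of_int d ^ 2 * \<omega>)) = F (siegel_point \<tau> z \<omega>)"
proof -
  have "F (siegel_act g \<Omega>) = det (siegel_denom g \<Omega>) powi k * F \<Omega>"
    if "g \<in> paramodular_group N" "\<Omega> \<in> siegel_upper_half_space" for g \<Omega>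
    using F that by (simp add: paramodular_forms_def)
  from this[OF levi_element_paramodular[OF det N] in_space]
  show ?thesis by (simp only: siegel_act_levi[OF det] power_int_1_left mult_1_left)
qed

lemma paramodular_translation:
  assumes F: "F \<in> paramodular_forms k N" and "a \<in> \<int>" "b \<in> \<int>" "of_nat N * c \<in> \<int>"
    and in_space: "siegel_point \<tau> z \<omega> \<in> siegel_upper_half_space"
  shows "F (siegel_point (\<tau> + of_rat a) (z + of_rat b) (\<omega> + of_rat c)) = F (siegel_point \<tau> z \<omega>)"
proof -
  have "F (siegel_act g \<Omega>) = det (siegel_denom g \<Omega>) powi k * F \<Omega>"
    if "g \<in> paramodular_group N" "\<Omega> \<in> siegel_upper_half_space" for g \<Omega>
    using F that by (simp add: paramodular_forms_def)
  from this[OF translation_element_paramodular[OF assms(2-4)] in_space]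
  show ?thesis by (simp only: siegel_act_translation power_int_1_left mult_1_left)
qed

section \<open>Fourier--Jacobi coefficients\<close>

lemma ee_diff: "ee (x - y) = ee x / ee y"
  by (simp add: ee_def exp_diff right_diff_distrib)

text \<open>Constant term 0 makes composing the exponential series with it the exponential of a
  power series.\<close>

definition neg_fps :: "(nat \<Rightarrow> complex) \<Rightarrow> complex fps" where
  "neg_fps g = Abs_fps (\<lambda>i. if i = 0 then 0 else - g i)"

text \<open>With g i the value of \<psi> | V_i at a point, this is the value of Q_m there.\<close>

definition exp_coeff :: "(nat \<Rightarrow> complex) \<Rightarrow> nat \<Rightarrow> complex" where
  "exp_coeff g m = fps_nth (fps_exp 1 oo neg_fps g) m"

lemma exp_coeff_0 [simp]: "exp_coeff g 0 = 1"
  by (simp add: exp_coeff_def)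

text \<open>E = exp h satisfies E' = h' E. This recursion drives the inductions on m for expansions
  and for limits, so the monomials of Q_m never have to be listed.\<close>

lemma exp_coeff_Suc:
  "exp_coeff g (Suc m) = - (\<Sum>i\<le>m. of_nat (Suc i) * g (Suc i) * exp_coeff g (m - i)) / of_nat (Suc m)"
proof -
  let ?E = "fps_exp 1 oo neg_fps g"
  have "fps_deriv ?E = fps_deriv (neg_fps g) * ?E"
    by (subst fps_compose_deriv) (auto simp: neg_fps_def mult.commute)
  then have "fps_nth (fps_deriv ?E) m = fps_nth (fps_deriv (neg_fps g) * ?E) m" by simp
  then have "of_nat (Suc m) * exp_coeff g (Suc m) = - (\<Sum>i\<le>m. of_nat (Suc i) * g (Suc i) * exp_coeff g (m - i))"
    by (simp add: exp_coeff_def fps_mult_nth neg_fps_def atLeast0AtMost sum_negf[symmetric] del: of_nat_Suc)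
  then show ?thesis by (simp add: field_simps del: of_nat_Suc)
qed

lemma neg_fps_eval:
  assumes "summable (\<lambda>m. g (Suc m) * X ^ Suc m)"
  shows "(\<Sum>m. g (Suc m) * X ^ Suc m) = - eval_fps (neg_fps g) X"
proof -
  let ?f = "\<lambda>m. fps_nth (neg_fps g) m * X ^ m"
  have eq: "?f (Suc m) = - (g (Suc m) * X ^ Suc m)" for m by (simp add: neg_fps_def)
  have s: "summable (\<lambda>m. ?f (Suc m))" unfolding eq by (rule summable_minus[OF assms])
  then have "summable ?f" by (subst (asm) summable_Suc_iff)
  from suminf_split_head[OF this] have "eval_fps (neg_fps g) X = (\<Sum>m. ?f (Suc m))"
    by (simp add: eval_fps_def neg_fps_def)
  also have "\<dots> = - (\<Sum>m. g (Suc m) * X ^ Suc m)" unfolding eq by (rule suminf_minus[OF assms])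
  finally show ?thesis by simp
qed

lemma neg_fps_conv_radius:
  assumes "summable (\<lambda>m. g (Suc m) * X ^ Suc m)" "X \<noteq> 0"
  shows "fps_conv_radius (neg_fps g) > 0"
proof -
  let ?f = "\<lambda>m. fps_nth (neg_fps g) m * X ^ m"
  have eq: "?f (Suc m) = - (g (Suc m) * X ^ Suc m)" for m by (simp add: neg_fps_def)
  have "summable (\<lambda>m. ?f (Suc m))" unfolding eq by (rule summable_minus[OF assms(1)])
  then have "summable ?f" by (subst (asm) summable_Suc_iff)
  then have "fps_conv_radius (neg_fps g) \<ge> norm X" unfolding fps_conv_radius_def by (rule conv_radius_geI)
  then show ?thesis using assms(2) by (metis ereal_less(2) less_le_trans zero_less_norm_iff)
qed

text \<open>The Fourier--Jacobi coefficients of a periodic function on a half plane are Taylor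
  coefficients in \<open>X = ee (N \<omega>)\<close>; they are read off near \<open>X = 0\<close> and bounded by Cauchy's
  inequality on a larger circle.\<close>

lemma fourier_jacobi_coeff_bound:
  fixes G :: "complex \<Rightarrow> complex" and N c m :: nat
  assumes N: "N > 0" and c: "c > 0"
    and hol: "G holomorphic_on {\<omega>. Im \<omega> > h0}"
    and per: "\<And>\<omega> \<omega>'. Im \<omega> > h0 \<Longrightarrow> of_nat N * (\<omega>' - \<omega>) \<in> \<int> \<Longrightarrow> G \<omega>' = G \<omega>"
    and germ_sum: "\<And>\<omega>. Im \<omega> > Y \<Longrightarrow> summable (\<lambda>m. g (Suc m) * ee (of_nat N * \<omega>) ^ Suc m)"
    and germ: "\<And>\<omega>. Im \<omega> > Y \<Longrightarrow> G \<omega> = \<phi>0 * ee (of_nat N * \<omega>) ^ c * exp (- (\<Sum>m. g (Suc m) * ee (of_nat N * \<omega>) ^ Suc m))"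
    and h: "h > h0" and B: "\<And>x. norm (G (Complex x h)) \<le> B"
  shows "norm (\<phi>0 * exp_coeff g m) \<le> B * exp (2 * pi * real ((c + m) * N) * h)"
proof -
  define R where "R = (\<lambda>t. exp (- 2 * pi * real N * t))"
  \<comment> \<open>A principal-branch inverse of \<omega> ->
    \<open>ee (of_nat N * \<omega>)\<close>; its jump along the cut is invisible to the periodic
    function \<open>G\<close>.\<close>
  define lg where "lg = (\<lambda>X. Ln X / (2 * of_real pi * \<i> * of_nat N))"
  \<comment> \<open>The value 0 at X = 0 is the continuous one, because the germ carries the factor
    X^c with c > 0.\<close>
  define H where "H = (\<lambda>X. if X = 0 then 0 else G (lg X))"
  have ee_lg: "ee (of_nat N * lg X) = X" if "X \<noteq> 0" for X
    using that N by (simp add: ee_def lg_def)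
  have norm_N: "norm (ee (of_nat N * \<omega>)) = R (Im \<omega>)" for \<omega> by (simp add: norm_ee R_def mult_ac)
  have R_less: "R s < R t \<longleftrightarrow> t < s" for s t using N by (simp add: R_def)
  have HG: "H X = G \<omega>" if "ee (of_nat N * \<omega>) = X" "Im \<omega> > h0" for X \<omega>
  proof -
    have X: "X \<noteq> 0" unfolding that(1)[symmetric] by (rule ee_nonzero)
    have "ee (of_nat N * (lg X - \<omega>)) = 1"
      unfolding right_diff_distrib ee_diff ee_lg[OF X] that(1) using X by simp
    then have "of_nat N * (lg X - \<omega>) \<in> \<int>" by (simp only: ee_eq_1_iff)
    from per[OF that(2) this] show ?thesis using X by (simp only: H_def if_False)
  qed
  have Im_lg: "Im (lg X) > t" if "X \<noteq> 0" "norm X < R t" for X t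
  proof -
    have "R (Im (lg X)) < R t" using norm_N[of "lg X"] ee_lg[OF that(1)] that(2) by simp
    then show ?thesis by (simp only: R_less)
  qed
  define E where "E = fps_exp 1 oo neg_fps g"
  have conv: "fps_conv_radius (neg_fps g) > 0"
  proof -
    have "summable (\<lambda>m. g (Suc m) * ee (of_nat N * Complex 0 (Y + 1)) ^ Suc m)" by (rule germ_sum) simp
    then show ?thesis by (rule neg_fps_conv_radius) simp
  qed
  \<comment> \<open>Near X = 0 the germ identifies \<open>H\<close> with a convergent power series,
    which settles analyticity at the puncture.\<close>
  have fpsH: "H has_fps_expansion (fps_const \<phi>0 * fps_X ^ c * E)"
  proof -
    have "(\<lambda>X. \<phi>0 * X ^ c * (exp \<circ> eval_fps (neg_fps g)) X) has_fps_expansion (fps_const \<phi>0 * fps_X ^ c * E)"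
      unfolding E_def
      by (intro has_fps_expansion_mult has_fps_expansion_const has_fps_expansion_fps_X_power
            has_fps_expansion_compose has_fps_expansion_exp1 eval_fps_has_fps_expansion conv)
         (simp add: neg_fps_def)
    moreover have "eventually (\<lambda>X. H X = \<phi>0 * X ^ c * (exp \<circ> eval_fps (neg_fps g)) X) (nhds 0)"
    proof -
      have "eventually (\<lambda>X. X \<in> ball 0 (R (max Y h0))) (nhds (0 :: complex))"
        by (intro eventually_nhds_in_open) (auto simp: R_def)
      then show ?thesis
      proof eventually_elim
        case (elim X)
        show ?case
        proof (cases "X = 0")
          case True then show ?thesis using c by (simp add: H_def)
        next
          case False
          then have Im: "Im (lg X) > Y" using Im_lg[OF False, of "max Y h0"] elim by simp
          show ?thesis
            using germ[OF Im] neg_fps_eval[OF germ_sum[OF Im]] False by (simp add: H_def ee_lg[OF False])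
        qed
      qed
    qed
    ultimately show ?thesis by (subst has_fps_expansion_cong[OF _ refl]) auto
  qed
  have diffH: "H field_differentiable at X" if "norm X < R h0" for X
  proof (cases "X = 0")
    case True
    have "H analytic_on {0}" by (rule has_fps_expansion_imp_analytic_0[OF fpsH])
    then show ?thesis using True by (auto intro: analytic_on_imp_differentiable_at)
  next
    case False
    \<comment> \<open>A branch centred at X, holomorphic on a disc avoiding 0 even when X lies on
      the cut of \<open>Ln\<close>.\<close>
    define w where "w = (\<lambda>Z. Ln (Z / X) / (2 * of_real pi * \<i> * of_nat N) + lg X)"
    have ImX: "Im (lg X) > h0" by (rule Im_lg[OF False that])
    define U where "U = ball X (norm X) \<inter> w -` {\<omega>. Im \<omega> > h0} "
    have nonneg: "Z / X \<notin> \<real>\<^sub>\<le>\<^sub>0" if "Z \<in> ball X (norm X)" for Z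
    proof
      assume "Z / X \<in> \<real>\<^sub>\<le>\<^sub>0"
      then obtain s where s: "Z / X = of_real s" "s \<le> 0" by (auto elim!: nonpos_Reals_cases)
      then have "Z = of_real s * X" using False by (simp add: field_simps)
      then have "X - Z = of_real (1 - s) * X" by (simp add: algebra_simps)
      then have "dist X Z = (1 - s) * norm X" using s(2) by (simp add: dist_norm norm_mult del: of_real_diff)
      moreover have "norm X \<le> (1 - s) * norm X" using s(2) mult_right_mono[of 1 "1 - s" "norm X"] by simp
      ultimately show False using that by simp
    qed
    have holw: "w holomorphic_on ball X (norm X)"
      unfolding w_def using N by (intro holomorphic_intros nonneg) (auto simp: False)
    then have contw: "continuous_on (ball X (norm X)) w" by (rule holomorphic_on_imp_continuous_on)
    have "open {\<omega>. Im \<omega> > h0}" by (rule open_halfspace_Im_gt)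
    then have "open U"
      unfolding U_def using continuous_on_open_vimage[of "ball X (norm X)" w] contw by (metis Int_commute open_ball)
    moreover have "X \<in> U" using False ImX by (simp add: U_def w_def)
    ultimately have ev: "eventually (\<lambda>Z. Z \<in> U) (nhds X)" by (intro eventually_nhds_in_open)
    have eq: "H Z = G (w Z)" if "Z \<in> U" for Z
    proof (rule HG)
      have "Z \<noteq> 0" using that by (auto simp: U_def)
      have "of_nat N * w Z = Ln (Z / X) / (2 * of_real pi * \<i>) + of_nat N * lg X"
        using N by (simp add: w_def field_simps)
      then have "ee (of_nat N * w Z) = ee (Ln (Z / X) / (2 * of_real pi * \<i>)) * ee (of_nat N * lg X)"
        by (simp only: ee_add)
      also have "\<dots> = Z" using False \<open>Z \<noteq> 0\<close> by (simp add: ee_lg[OF False]) (simp add: ee_def)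
      finally show "ee (of_nat N * w Z) = Z" .
      show "Im (w Z) > h0" using that by (simp add: U_def)
    qed
    have "w field_differentiable at X"
      using False by (intro holomorphic_on_imp_differentiable_at[OF holw]) auto
    moreover have "G field_differentiable at (w X)"
    proof (rule holomorphic_on_imp_differentiable_at[OF hol open_halfspace_Im_gt])
      show "w X \<in> {\<omega>. Im \<omega> > h0}" using ImX False by (simp add: w_def)
    qed
    ultimately have "(G \<circ> w) field_differentiable at X" by (rule field_differentiable_compose)
    moreover have "eventually (\<lambda>Z. (G \<circ> w) Z = H Z) (nhds X)"
      using ev by eventually_elim (simp add: eq)
    note ev' = this
    obtain D where D: "((G \<circ> w) has_field_derivative D) (at X)"
      using \<open>(G \<circ> w) field_differentiable at X\<close> unfolding field_differentiable_def by blast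
    have "(H has_field_derivative D) (at X)"
      by (rule DERIV_cong_ev[THEN iffD1, OF refl ev' refl D])
    then show ?thesis unfolding field_differentiable_def by blast
  qed
  define r where "r = R h"
  have r: "0 < r" "r < R h0" using h R_less by (auto simp: r_def R_def)
  have holH: "H holomorphic_on cball 0 r"
    unfolding holomorphic_on_def using diffH r by (auto intro: field_differentiable_at_within)
  \<comment> \<open>The circle of radius \<open>R h\<close> is the image of the line Im \<omega> =
    h, which need not meet the half plane where the germ is given.\<close>
  have "norm ((deriv ^^ (c + m)) H 0) \<le> fact (c + m) * B / r ^ (c + m)"
  proof (rule Cauchy_inequality)
    show "H holomorphic_on ball 0 r" using holH by (rule holomorphic_on_subset) auto
    show "continuous_on (cball 0 r) H" using holH by (rule holomorphic_on_imp_continuous_on)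
    show "0 < r" by (rule r)
    fix X :: complex assume "norm (0 - X) = r"
    then have nX: "norm X = r" by simp
    then have X: "X \<noteq> 0" using r by auto
    have "R (Im (lg X)) = R h" using norm_N[of "lg X"] ee_lg[OF X] nX by (simp add: r_def)
    then have "Im (lg X) = h" using N by (simp add: R_def)
    then have "lg X = Complex (Re (lg X)) h" by (simp add: complex_eq_iff)
    then show "norm (H X) \<le> B" using X B[of "Re (lg X)"] by (simp add: H_def)
  qed
  moreover have "fps_nth (fps_const \<phi>0 * fps_X ^ c * E) (c + m) = \<phi>0 * exp_coeff g m"
    by (simp add: mult.assoc fps_X_power_mult_nth exp_coeff_def E_def)
  then have "(deriv ^^ (c + m)) H 0 = fact (c + m) * (\<phi>0 * exp_coeff g m)"
    using fps_nth_fps_expansion[OF fpsH, of "c + m"] by (simp add: field_simps)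
  ultimately have "fact (c + m) * norm (\<phi>0 * exp_coeff g m) \<le> fact (c + m) * (B / r ^ (c + m))"
    by (simp add: norm_mult)
  then have "norm (\<phi>0 * exp_coeff g m) \<le> B / r ^ (c + m)"
    by (rule mult_left_le_imp_le) (rule fact_gt_zero)
  also have "\<dots> = B * exp (2 * pi * real ((c + m) * N) * h)"
    by (simp add: r_def R_def exp_of_nat_mult[symmetric] exp_minus field_simps)
  finally show ?thesis .
qed

lemma irrational_between:
  fixes a b :: real
  assumes "a < b"
  obtains x where "a < x" "x < b" "x \<notin> \<rat>"
proof -
  have "uncountable {a<..<b}" using assms uncountable_open_interval by blast
  then have "\<not> {a<..<b} \<subseteq> \<rat>" using countable_rat countable_subset by blast
  then show ?thesis using that by (auto simp: subset_iff)
qed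

text \<open>X tends to 0 as Im \<omega> grows. The limit isolates the leading factor of the germ;
  the constant \<kappa> permits comparison at two shifted arguments.\<close>

lemma exp_neg_series_tendsto_1:
  assumes N: "N > 0" and sm: "\<And>\<omega>. Im \<omega> > Y \<Longrightarrow> summable (\<lambda>m. g (Suc m) * ee (of_nat N * \<omega>) ^ Suc m)"
  shows "((\<lambda>y. exp (- (\<Sum>m. g (Suc m) * ee (of_nat N * (\<kappa> + \<i> * of_real y)) ^ Suc m))) \<longlongrightarrow> 1) at_top"
proof -
  define P where "P = eval_fps (neg_fps g)"
  have "summable (\<lambda>m. g (Suc m) * ee (of_nat N * Complex 0 (Y + 1)) ^ Suc m)" by (rule sm) simp
  then have conv: "fps_conv_radius (neg_fps g) > 0" by (rule neg_fps_conv_radius) simp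
  have "P has_fps_expansion neg_fps g" unfolding P_def by (rule eval_fps_has_fps_expansion[OF conv])
  then have P: "(P \<longlongrightarrow> 0) (nhds 0)"
    using has_fps_expansion_imp_continuous[of P "neg_fps g" UNIV] has_fps_expansion_imp_0_eq_fps_nth_0[of P "neg_fps g"]
    by (simp add: neg_fps_def tendsto_nhds_iff isCont_def)
  have "((\<lambda>y. ee (of_nat N * (\<kappa> + \<i> * of_real y))) \<longlongrightarrow> 0) at_top"
  proof (rule tendsto_norm_zero_cancel)
    have *: "norm (ee (of_nat N * (\<kappa> + \<i> * of_real y))) = exp (- 2 * pi * N * Im \<kappa>) * exp (- ((2 * pi * N) * y))" for y
      by (simp add: norm_ee exp_add[symmetric] algebra_simps)
    have "((\<lambda>y. exp (- ((2 * pi * real N) * y))) \<longlongrightarrow> 0) at_top"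
      using N by (intro exp_neg_mult_tendsto_0) auto
    then show "((\<lambda>y. norm (ee (of_nat N * (\<kappa> + \<i> * of_real y)))) \<longlongrightarrow> 0) at_top"
      unfolding * by (rule tendsto_mult_right_zero)
  qed
  then have "((\<lambda>y. P (ee (of_nat N * (\<kappa> + \<i> * of_real y)))) \<longlongrightarrow> 0) at_top"
    by (rule filterlim_compose[OF P])
  then have "((\<lambda>y. exp (P (ee (of_nat N * (\<kappa> + \<i> * of_real y))))) \<longlongrightarrow> exp 0) at_top"
    by (rule tendsto_exp)
  moreover have "\<forall>\<^sub>F y in at_top. exp (P (ee (of_nat N * (\<kappa> + \<i> * of_real y)))) = exp (- (\<Sum>m. g (Suc m) * ee (of_nat N * (\<kappa> + \<i> * of_real y)) ^ Suc m))"
    using eventually_gt_at_top[of "Y - Im \<kappa>"]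
  proof eventually_elim
    case (elim y)
    have "summable (\<lambda>m. g (Suc m) * ee (of_nat N * (\<kappa> + \<i> * of_real y)) ^ Suc m)"
      by (rule sm) (use elim in simp)
    from neg_fps_eval[OF this] show ?case by (simp only: P_def minus_minus)
  qed
  ultimately show ?thesis by (simp add: filterlim_cong[OF refl refl])
qed

text \<open>Indexed from 0: entry m is the term of \<open>Grit(\<psi>)\<close> in X^(m + 1).\<close>

abbreviation grit_coeff ::
    "nat \<Rightarrow> (complex \<times> complex \<Rightarrow> complex) \<Rightarrow> complex \<Rightarrow> complex \<Rightarrow> complex \<Rightarrow> nat \<Rightarrow> complex" where
  "grit_coeff N \<psi> \<tau> z \<omega> m \<equiv> jacobi_V 0 (Suc m) \<psi> (\<tau>, z) * ee (of_nat N * \<omega>) ^ Suc m"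

text \<open>At irrational slope the block is regular and equals \<phi>, so the germ can be written
  with \<phi>, on a half plane Im \<omega> > Y where Y may depend on \<tau> and z.\<close>

lemma borcherds_germ:
  assumes B: "is_borcherds_product N \<psi> F" and TB: "is_theta_block (leading_exponents \<psi>) \<phi>"
    and \<tau>: "Im \<tau> > 0" and z: "Im z / Im \<tau> \<notin> \<rat>"
  shows "\<exists>Y. \<forall>\<omega>. Im \<omega> > Y \<longrightarrow>
    summable (grit_coeff N \<psi> \<tau> z \<omega>) \<and>
    F (siegel_point \<tau> z \<omega>) = \<phi> (\<tau>, z) * ee (borch_C \<psi> * \<omega>)
        * exp (- (\<Sum>m. grit_coeff N \<psi> \<tau> z \<omega> m))"
proof -
  have G: "grit_term N \<psi> \<tau> z \<omega> (Suc m) = grit_coeff N \<psi> \<tau> z \<omega> m" for \<omega> m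
    by (simp only: grit_term_def ee_power of_nat_mult mult.assoc)
  have "\<forall>\<^sub>F \<omega> in filtercomap Im at_top.
           summable (\<lambda>m. grit_term N \<psi> \<tau> z \<omega> (Suc m)) \<and>
           F (siegel_point \<tau> z \<omega>) = theta_block (leading_exponents \<psi>) \<tau> z * ee (borch_C \<psi> * \<omega>)
             * exp (- (\<Sum>m. grit_term N \<psi> \<tau> z \<omega> (Suc m)))"
    using B theta_block_nonzero(1)[OF TB \<tau> z] \<tau> unfolding is_borcherds_product_def by blast
  then have "\<exists>Y. \<forall>\<omega>. Im \<omega> > Y \<longrightarrow> summable (\<lambda>m. grit_term N \<psi> \<tau> z \<omega> (Suc m)) \<and>
           F (siegel_point \<tau> z \<omega>) = theta_block (leading_exponents \<psi>) \<tau> z * ee (borch_C \<psi> * \<omega>)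
             * exp (- (\<Sum>m. grit_term N \<psi> \<tau> z \<omega> (Suc m)))"
    by (simp only: eventually_filtercomap_at_top_dense)
  then show ?thesis unfolding G theta_block_nonzero(2)[OF TB \<tau> z, symmetric] .
qed

text \<open>\<open>borch_C\<close> is defined from the theta exponents, and its equality with the
  index of \<phi> has to be derived. A unipotent Levi element replaces z by z + N \<tau> and
  \<omega> by \<omega> + \<kappa>; comparing leading factors with the elliptic law of \<phi> gives
  \<open>ee (D * \<kappa>) = 1\<close> for the difference D, and \<kappa> varies
  continuously.\<close>

lemma borch_C_eq_index:
  assumes F: "F \<in> paramodular_forms k N" and N: "N > 0"
    and T: "jacobi_transform k' M \<phi>"
    and B: "is_borcherds_product N \<psi> F" and TB: "is_theta_block (leading_exponents \<psi>) \<phi>"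
  shows "borch_C \<psi> = of_nat M"
proof -
  define D where "D = borch_C \<psi> - of_nat M"
  have key: "D * (of_nat N ^ 2 * \<tau> + 2 * of_nat N * z) \<in> \<int>"
    if \<tau>: "Im \<tau> > 0" and z: "Im z / Im \<tau> \<notin> \<rat>" for \<tau> z
  proof -
    \<comment> \<open>The displacement of \<omega> under A = (1 0; N 1).\<close>
    define \<kappa> where "\<kappa> = of_nat N ^ 2 * \<tau> + 2 * of_nat N * z"
    define z' where "z' = z + of_nat N * \<tau>"
    have z': "Im z' / Im \<tau> \<notin> \<rat>"
    proof
      assume "Im z' / Im \<tau> \<in> \<rat>"
      from Rats_diff[OF this Rats_of_nat[of N]] have "Im z' / Im \<tau> - of_nat N \<in> \<rat>" .
      then show False using z \<tau> by (simp add: z'_def field_simps)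
    qed
    obtain Y where Yall: "\<forall>\<omega>. Im \<omega> > Y \<longrightarrow> summable (grit_coeff N \<psi> \<tau> z \<omega>) \<and>
        F (siegel_point \<tau> z \<omega>) = \<phi> (\<tau>, z) * ee (borch_C \<psi> * \<omega>)
        * exp (- (\<Sum>m. grit_coeff N \<psi> \<tau> z \<omega> m))"
      using borcherds_germ[OF B TB \<tau> z] by (elim exE)
    note Y = Yall[rule_format, THEN conjunct1] Yall[rule_format, THEN conjunct2]
    obtain Y' where Y'all: "\<forall>\<omega>. Im \<omega> > Y' \<longrightarrow> summable (grit_coeff N \<psi> \<tau> z' \<omega>) \<and>
        F (siegel_point \<tau> z' \<omega>) = \<phi> (\<tau>, z') * ee (borch_C \<psi> * \<omega>)
        * exp (- (\<Sum>m. grit_coeff N \<psi> \<tau> z' \<omega> m))"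
      using borcherds_germ[OF B TB \<tau> z'] by (elim exE)
    note Y' = Y'all[rule_format, THEN conjunct1] Y'all[rule_format, THEN conjunct2]
    define E where "E = (\<lambda>y. exp (- (\<Sum>m. grit_coeff N \<psi> \<tau> z (0 + \<i> * of_real y) m)))"
    define E' where "E' = (\<lambda>y. exp (- (\<Sum>m. grit_coeff N \<psi> \<tau> z' (\<kappa> + \<i> * of_real y) m)))"
    have nz: "\<phi> (\<tau>, z) \<noteq> 0" by (rule theta_block_nonzero(3)[OF TB \<tau> z])
    have "\<phi> (\<tau>, z + of_int (int N) * \<tau> + of_int 0) = ee (- (of_nat M * (of_int ((int N)\<^sup>2) * \<tau> + 2 * of_int (int N) * z))) * \<phi> (\<tau>, z)"
      using T \<tau> unfolding jacobi_transform_def by blast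
    then have \<phi>': "\<phi> (\<tau>, z') = ee (- (of_nat M * \<kappa>)) * \<phi> (\<tau>, z)"
      by (simp add: z'_def \<kappa>_def)
    have "\<forall>\<^sub>F y in at_top. E y = ee (D * \<kappa>) * E' y"
      using eventually_gt_at_top[of "max Y (max (Y' - Im \<kappa>) ((Im z)\<^sup>2 / Im \<tau>))"]
    proof eventually_elim
      case (elim y)
      let ?\<omega> = "0 + \<i> * of_real y" and ?\<omega>' = "\<kappa> + \<i> * of_real y"
      have "siegel_point \<tau> z ?\<omega> \<in> siegel_upper_half_space"
        unfolding siegel_point_in_space_iff using \<tau> elim by (simp add: field_simps)
      from paramodular_levi[OF F _ _ this, of 1 1 0 "int N"]
      have "F (siegel_point \<tau> z' ?\<omega>') = F (siegel_point \<tau> z ?\<omega>)"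
        by (simp add: z'_def \<kappa>_def add_ac mult_ac)
      moreover have "F (siegel_point \<tau> z ?\<omega>) = \<phi> (\<tau>, z) * ee (borch_C \<psi> * ?\<omega>) * E y"
        unfolding E_def by (rule Y(2)) (use elim in simp)
      moreover have "F (siegel_point \<tau> z' ?\<omega>') = \<phi> (\<tau>, z') * ee (borch_C \<psi> * ?\<omega>') * E' y"
        unfolding E'_def by (rule Y'(2)) (use elim in simp)
      ultimately have "\<phi> (\<tau>, z) * ee (borch_C \<psi> * ?\<omega>) * E y = \<phi> (\<tau>, z') * ee (borch_C \<psi> * ?\<omega>') * E' y"
        by simp
      also have "\<dots> = \<phi> (\<tau>, z) * (ee (- (of_nat M * \<kappa>)) * ee (borch_C \<psi> * ?\<omega>')) * E' y"
        by (simp add: \<phi>')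
      also have "ee (- (of_nat M * \<kappa>)) * ee (borch_C \<psi> * ?\<omega>') = ee (borch_C \<psi> * ?\<omega>) * ee (D * \<kappa>)"
        unfolding ee_add[symmetric] by (rule arg_cong[of _ _ ee]) (simp add: D_def algebra_simps)
      finally have "(\<phi> (\<tau>, z) * ee (borch_C \<psi> * ?\<omega>)) * E y = (\<phi> (\<tau>, z) * ee (borch_C \<psi> * ?\<omega>)) * (ee (D * \<kappa>) * E' y)"
        by (simp only: mult.assoc)
      then show ?case using nz ee_nonzero by (metis mult_left_cancel no_zero_divisors)
    qed
    moreover have "(E \<longlongrightarrow> 1) at_top" unfolding E_def by (rule exp_neg_series_tendsto_1[OF N Y(1)])
    moreover have "(E' \<longlongrightarrow> 1) at_top" unfolding E'_def by (rule exp_neg_series_tendsto_1[OF N Y'(1)])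
    then have "((\<lambda>y. ee (D * \<kappa>) * E' y) \<longlongrightarrow> ee (D * \<kappa>) * 1) at_top" by (rule tendsto_mult_left)
    ultimately have "ee (D * \<kappa>) = 1"
      using tendsto_unique[OF trivial_limit_at_top_linorder, of E 1] filterlim_cong[OF refl refl, of E "\<lambda>y. ee (D * \<kappa>) * E' y" at_top]
      by (metis mult.right_neutral)
    then show ?thesis by (simp only: ee_eq_1_iff \<kappa>_def)
  qed
  obtain \<theta> :: real where \<theta>: "\<theta> \<notin> \<rat>" using irrational_between[of 0 1] by auto
  define w where "w = D * (2 * of_nat N)"
  \<comment> \<open>Changing only Re z keeps the slope irrational, so two instances of
    \<open>key\<close> may be subtracted. A number all of whose real multiples are integers is
    0.\<close>
  have wI: "w * of_real x \<in> \<int>" for x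
  proof -
    have "D * (of_nat N ^ 2 * \<i> + 2 * of_nat N * Complex x \<theta>) - D * (of_nat N ^ 2 * \<i> + 2 * of_nat N * Complex 0 \<theta>) \<in> \<int>"
      using \<theta> by (intro Ints_diff key) auto
    also have "D * (of_nat N ^ 2 * \<i> + 2 * of_nat N * Complex x \<theta>) - D * (of_nat N ^ 2 * \<i> + 2 * of_nat N * Complex 0 \<theta>) = w * (Complex x \<theta> - Complex 0 \<theta>)"
      by (simp add: w_def algebra_simps)
    also have "Complex x \<theta> - Complex 0 \<theta> = of_real x" by (simp add: complex_eq_iff)
    finally show ?thesis .
  qed
  have "w = 0"
  proof (rule ccontr)
    assume nz: "w \<noteq> 0"
    obtain j where j: "w = of_int j" using wI[of 1] by (auto elim: Ints_cases)
    then have "w * of_real (1 / (2 * of_int j)) = 1 / 2" using nz by simp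
    then have "(1 / 2 :: complex) \<in> \<int>" using wI[of "1 / (2 * of_int j)"] by simp
    then obtain i where "1 / 2 = (of_int i :: complex)" by (auto elim: Ints_cases)
    then have "of_int 1 = (of_int (2 * i) :: complex)" by (simp add: field_simps)
    then have "1 = 2 * i" by (simp only: of_int_eq_iff)
    then show False by presburger
  qed
  then show ?thesis using N by (simp add: w_def D_def)
qed

lemma siegel_holomorphic:
  assumes F: "F \<in> paramodular_forms k N" and \<tau>: "Im \<tau> > 0"
  shows "(\<lambda>\<omega>. F (siegel_point \<tau> z \<omega>)) holomorphic_on {\<omega>. Im \<omega> > (Im z)\<^sup>2 / Im \<tau>}"
  unfolding holomorphic_on_def
proof
  fix \<omega> assume "\<omega> \<in> {\<omega>. Im \<omega> > (Im z)\<^sup>2 / Im \<tau>}"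
  then have "siegel_point \<tau> z \<omega> \<in> siegel_upper_half_space"
    using \<tau> by (simp add: siegel_point_in_space_iff field_simps)
  then have mem: "(\<tau>, z, \<omega>) \<in> {(\<tau>, z, \<omega>). siegel_point \<tau> z \<omega> \<in> siegel_upper_half_space}" by simp
  have "holomorphic3_on (\<lambda>(\<tau>, z, \<omega>). F (siegel_point \<tau> z \<omega>)) {(\<tau>, z, \<omega>). siegel_point \<tau> z \<omega> \<in> siegel_upper_half_space}"
    using F by (simp add: paramodular_forms_def)
  from this[unfolded holomorphic3_on_def, rule_format, OF mem]
  obtain a b c where d: "((\<lambda>(\<tau>, z, \<omega>). F (siegel_point \<tau> z \<omega>)) has_derivative (\<lambda>(h1, h2, h3). a * h1 + b * h2 + c * h3)) (at (\<tau>, z, \<omega>))"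
    by blast
  have "((\<lambda>\<omega>. (\<tau>, z, \<omega>)) has_derivative (\<lambda>h. (0, 0, h))) (at \<omega>)"
    by (intro derivative_intros)
  from has_derivative_compose[OF this d]
  have "((\<lambda>\<omega>. F (siegel_point \<tau> z \<omega>)) has_derivative (*) c) (at \<omega>)" by simp
  then have "((\<lambda>\<omega>. F (siegel_point \<tau> z \<omega>)) has_field_derivative c) (at \<omega>)"
    by (simp only: has_field_derivative_def)
  then show "(\<lambda>\<omega>. F (siegel_point \<tau> z \<omega>)) field_differentiable at \<omega> within {\<omega>. Im \<omega> > (Im z)\<^sup>2 / Im \<tau>}"
    using field_differentiable_at_within field_differentiable_def by blast
qed

text \<open>The height h only has to satisfy (Im z)^2 < Im \<tau> h, that is, the point lies in the
  Siegel space; the germ need not converge there.\<close>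

lemma borcherds_fourier_jacobi_bound:
  assumes F: "F \<in> paramodular_forms k N" and N: "N > 0" and c: "c > 0"
    and T: "jacobi_transform k' (c * N) \<phi>"
    and B: "is_borcherds_product N \<psi> F" and TB: "is_theta_block (leading_exponents \<psi>) \<phi>"
    and \<tau>: "Im \<tau> > 0" and z: "Im z / Im \<tau> \<notin> \<rat>"
    and h: "(Im z)\<^sup>2 < Im \<tau> * h" and S: "\<And>x. norm (F (siegel_point \<tau> z (Complex x h))) \<le> S"
  shows "norm (\<phi> (\<tau>, z) * exp_coeff (\<lambda>i. jacobi_V 0 i \<psi> (\<tau>, z)) m) \<le> S * exp (2 * pi * real ((c + m) * N) * h)"
proof -
    obtain Y where Yall: "\<forall>\<omega>. Im \<omega> > Y \<longrightarrow> summable (grit_coeff N \<psi> \<tau> z \<omega>) \<and>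
        F (siegel_point \<tau> z \<omega>) = \<phi> (\<tau>, z) * ee (borch_C \<psi> * \<omega>)
        * exp (- (\<Sum>m. grit_coeff N \<psi> \<tau> z \<omega> m))"
      using borcherds_germ[OF B TB \<tau> z] by (elim exE)
    note Y = Yall[rule_format, THEN conjunct1] Yall[rule_format, THEN conjunct2]
  have C: "ee (borch_C \<psi> * \<omega>) = ee (of_nat N * \<omega>) ^ c" for \<omega>
    unfolding borch_C_eq_index[OF F N T B TB] by (simp add: ee_power mult_ac)
  show ?thesis
  proof (rule fourier_jacobi_coeff_bound[OF N c, where ?h0.0 = "(Im z)\<^sup>2 / Im \<tau>"
        and G = "\<lambda>\<omega>. F (siegel_point \<tau> z \<omega>)", OF siegel_holomorphic[OF F \<tau>] _ Y(1) _ _ S])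
    show "(Im z)\<^sup>2 / Im \<tau> < h" using h \<tau> by (simp add: field_simps)
    show "F (siegel_point \<tau> z \<omega>) = \<phi> (\<tau>, z) * ee (of_nat N * \<omega>) ^ c
        * exp (- (\<Sum>m. grit_coeff N \<psi> \<tau> z \<omega> m))" if "Im \<omega> > Y" for \<omega>
      using Y(2)[OF that] by (simp only: C)
    fix \<omega> \<omega>' assume \<omega>: "(Im z)\<^sup>2 / Im \<tau> < Im \<omega>" and I: "of_nat N * (\<omega>' - \<omega>) \<in> \<int>"
    have sp: "siegel_point \<tau> z \<omega> \<in> siegel_upper_half_space"
      using \<tau> \<omega> by (simp add: siegel_point_in_space_iff field_simps)
    obtain j where "of_nat N * (\<omega>' - \<omega>) = of_int j" using I by (auto elim: Ints_cases)
    then have "\<omega>' = \<omega> + of_rat (of_int j / of_nat N)" using N by (simp add: of_rat_divide field_simps)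
    then show "F (siegel_point \<tau> z \<omega>') = F (siegel_point \<tau> z \<omega>)"
      using paramodular_translation[OF F _ _ _ sp, of 0 0 "of_int j / of_nat N"] N by simp
  qed
qed

text \<open>Integral translations bring the three real parts into the unit cube, where continuity
  gives a bound.\<close>

lemma paramodular_bounded_torus:
  assumes F: "F \<in> paramodular_forms k N" and \<theta>: "\<theta> > 0"
  obtains S where "\<And>x1 x2 x3. norm (F (siegel_point (Complex x1 1) (Complex x2 0) (Complex x3 \<theta>))) \<le> S"
proof -
  define G where "G = (\<lambda>x :: real \<times> real \<times> real. F (siegel_point (Complex (fst x) 1) (Complex (fst (snd x)) 0) (Complex (snd (snd x)) \<theta>)))"
  define K where "K = {0..1 :: real} \<times> {0..1 :: real} \<times> {0..1 :: real}"
  have sp: "siegel_point (Complex x1 1) (Complex x2 0) (Complex x3 \<theta>) \<in> siegel_upper_half_space" for x1 x2 x3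
    using \<theta> by (simp add: siegel_point_in_space_iff)
  have "continuous_on K G"
  proof (rule continuous_at_imp_continuous_on, rule ballI)
    fix x
    let ?i = "\<lambda>x :: real \<times> real \<times> real. (Complex (fst x) 1, Complex (fst (snd x)) 0, Complex (snd (snd x)) \<theta>)"
    have mem: "?i x \<in> {(\<tau>, z, \<omega>). siegel_point \<tau> z \<omega> \<in> siegel_upper_half_space}" using sp by simp
    have "holomorphic3_on (\<lambda>(\<tau>, z, \<omega>). F (siegel_point \<tau> z \<omega>)) {(\<tau>, z, \<omega>). siegel_point \<tau> z \<omega> \<in> siegel_upper_half_space}"
      using F by (simp add: paramodular_forms_def)
    from this[unfolded holomorphic3_on_def, rule_format, OF mem]
    have "isCont (\<lambda>(\<tau>, z, \<omega>). F (siegel_point \<tau> z \<omega>)) (?i x)"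
      using has_derivative_continuous by blast
    moreover have "isCont ?i x" unfolding Complex_eq by (intro continuous_intros)
    ultimately show "isCont G x" using isCont_o2[of x ?i "\<lambda>(\<tau>, z, \<omega>). F (siegel_point \<tau> z \<omega>)"] by (simp add: G_def)
  qed
  moreover have "compact K" unfolding K_def by (intro compact_Times) auto
  ultimately have "compact (G ` K)" by (rule compact_continuous_image)
  then obtain S where S: "\<And>x. x \<in> K \<Longrightarrow> norm (G x) \<le> S"
    using compact_imp_bounded bounded_iff by (metis imageI)
  show ?thesis
  proof
    fix x1 x2 x3
    have "F (siegel_point (Complex (frac x1) 1) (Complex (frac x2) 0) (Complex (frac x3) \<theta>)) = F (siegel_point (Complex x1 1) (Complex x2 0) (Complex x3 \<theta>))"
    proof -
      have fr: "Complex (frac x) y = Complex x y + of_rat (of_int (- \<lfloor>x\<rfloor>))" for x y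
        by (simp add: frac_def complex_eq_iff of_rat_minus)
      show ?thesis unfolding fr by (rule paramodular_translation[OF F _ _ _ sp]) auto
    qed
    moreover have "(frac x1, frac x2, frac x3) \<in> K" by (auto simp: K_def intro: less_imp_le[OF frac_lt_1])
    ultimately show "norm (F (siegel_point (Complex x1 1) (Complex x2 0) (Complex x3 \<theta>))) \<le> S"
      using S[of "(frac x1, frac x2, frac x3)"] by (simp add: G_def)
  qed
qed

text \<open>For A = (a b; c d) the action \<Omega> -> A \<Omega> A^T maps the real parts
  bijectively, so the torus above A diag(1, \<theta>) A^T inherits the bound of the torus above
  diag(1, \<theta>).\<close>

lemma paramodular_bounded_torus_levi:
  fixes a b c d :: int and \<theta> :: real
  assumes F: "F \<in> paramodular_forms k N" and \<theta>: "\<theta> > 0"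
    and S: "\<And>x1 x2 x3. norm (F (siegel_point (Complex x1 1) (Complex x2 0) (Complex x3 \<theta>))) \<le> S"
    and det: "a * d - b * c = 1" and N: "int N dvd b"
  shows "norm (F (siegel_point (Complex u (of_int a ^ 2 + \<theta> * of_int b ^ 2))
      (Complex x (of_int a * of_int c + \<theta> * of_int b * of_int d))
      (Complex w (of_int c ^ 2 + \<theta> * of_int d ^ 2)))) \<le> S"
proof -
  have sp: "siegel_point (Complex x1 1) (Complex x2 0) (Complex x3 \<theta>) \<in> siegel_upper_half_space" for x1 x2 x3
    using \<theta> by (simp add: siegel_point_in_space_iff)
  define A B C D :: real where "A = of_int a" and "B = of_int b" and "C = of_int c" and "D = of_int d"
  have det': "A * D - B * C = 1" unfolding A_def B_def C_def D_def
    using det by (metis of_int_1 of_int_diff of_int_mult)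
  \<comment> \<open>The entries of A^-1 (u x; x w) A^-T, the real parts of the preimage.\<close>
  define x1 where "x1 = D\<^sup>2 * u - 2 * D * B * x + B\<^sup>2 * w"
  define x2 where "x2 = - (D * C * u) + (A * D + B * C) * x - A * B * w"
  define x3 where "x3 = C\<^sup>2 * u - 2 * A * C * x + A\<^sup>2 * w"
  have e1: "A\<^sup>2 * x1 + 2 * A * B * x2 + B\<^sup>2 * x3 = u"
    unfolding x1_def x2_def x3_def using det' by algebra
  have e2: "A * C * x1 + (A * D + B * C) * x2 + B * D * x3 = x"
    unfolding x1_def x2_def x3_def using det' by algebra
  have e3: "C\<^sup>2 * x1 + 2 * C * D * x2 + D\<^sup>2 * x3 = w"
    unfolding x1_def x2_def x3_def using det' by algebra
  have "of_int a ^ 2 * Complex x1 1 + 2 * of_int a * of_int b * Complex x2 0 + of_int b ^ 2 * Complex x3 \<theta>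
      = Complex u (A\<^sup>2 + \<theta> * B\<^sup>2)"
    using e1 by (simp add: complex_eq_iff A_def B_def power2_eq_square mult_ac)
  moreover have "of_int a * of_int c * Complex x1 1 + (of_int a * of_int d + of_int b * of_int c) * Complex x2 0 + of_int b * of_int d * Complex x3 \<theta>
      = Complex x (A * C + \<theta> * B * D)"
    using e2 by (simp add: complex_eq_iff A_def B_def C_def D_def mult_ac)
  moreover have "of_int c ^ 2 * Complex x1 1 + 2 * of_int c * of_int d * Complex x2 0 + of_int d ^ 2 * Complex x3 \<theta>
      = Complex w (C\<^sup>2 + \<theta> * D\<^sup>2)"
    using e3 by (simp add: complex_eq_iff C_def D_def power2_eq_square mult_ac)
  ultimately have "F (siegel_point (Complex u (A\<^sup>2 + \<theta> * B\<^sup>2)) (Complex x (A * C + \<theta> * B * D)) (Complex w (C\<^sup>2 + \<theta> * D\<^sup>2)))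
     = F (siegel_point (Complex x1 1) (Complex x2 0) (Complex x3 \<theta>))"
    using paramodular_levi[OF F det N sp[of x1 x2 x3]] by simp
  then show ?thesis using S[of x1 x2 x3] by (simp add: A_def B_def C_def D_def)
qed

section \<open>Koecher's principle for Borcherds products\<close>

lemma exp_coeff_jac_expansion:
  assumes "\<And>i. i > 0 \<Longrightarrow> \<exists>c. has_jac_expansion (g i) c"
  shows "\<exists>d. has_jac_expansion (\<lambda>p. exp_coeff (\<lambda>i. g i p) m) d"
proof (induction m rule: less_induct)
  case (less m)
  show ?case
  proof (cases m)
    case 0
    then show ?thesis using has_jac_expansion_1 by auto
  next
    case (Suc m')
    have "\<exists>e. has_jac_expansion (\<lambda>p. of_nat (Suc i) * (g (Suc i) p * exp_coeff (\<lambda>i. g i p) (m' - i))) e" for i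
    proof -
      obtain C where C: "has_jac_expansion (g (Suc i)) C" using assms[of "Suc i"] by auto
      obtain D where D: "has_jac_expansion (\<lambda>p. exp_coeff (\<lambda>i. g i p) (m' - i)) D"
        using less[of "m' - i"] Suc by (auto simp: less_Suc_eq_le)
      show ?thesis by (rule exI, rule has_jac_expansion_scale[OF has_jac_expansion_mult[OF C D]])
    qed
    then have "\<forall>i. \<exists>e. has_jac_expansion (\<lambda>p. of_nat (Suc i) * (g (Suc i) p * exp_coeff (\<lambda>i. g i p) (m' - i))) e"
      by (rule allI)
    from choice[OF this] obtain E where
      E: "\<forall>i. has_jac_expansion (\<lambda>p. of_nat (Suc i) * (g (Suc i) p * exp_coeff (\<lambda>i. g i p) (m' - i))) (E i)"
      by (elim exE)
    have "has_jac_expansion (\<lambda>p. (- 1 / of_nat (Suc m')) * (\<Sum>i\<le>m'. of_nat (Suc i) * (g (Suc i) p * exp_coeff (\<lambda>i. g i p) (m' - i))))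
        (\<lambda>n r. (- 1 / of_nat (Suc m')) * (\<Sum>i\<le>m'. E i n r))"
      by (intro has_jac_expansion_scale has_jac_expansion_sum E[rule_format] finite_atMost)
    then show ?thesis
      unfolding Suc exp_coeff_Suc by (auto simp: mult.assoc simp del: of_nat_Suc)
  qed
qed

text \<open>The slope is the image of \<theta> under the rational Moebius map (b d \<theta> + a c) /
  (b^2 \<theta> + a^2). Its determinant is a b, so it can be inverted over the rationals.\<close>

lemma irrational_slope_levi:
  fixes a b c d :: int and \<theta> :: real
  assumes \<theta>: "\<theta> \<notin> \<rat>" "\<theta> > 0" and det: "a * d - b * c = 1" and ab: "a \<noteq> 0" "b \<noteq> 0"
  shows "(of_int a * of_int c + \<theta> * of_int b * of_int d) / (of_int a ^ 2 + \<theta> * of_int b ^ 2) \<notin> \<rat>"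
proof
  define A B C D :: real where "A = of_int a" and "B = of_int b" and "C = of_int c" and "D = of_int d"
  have det': "A * D - B * C = 1" unfolding A_def B_def C_def D_def
    using det by (metis of_int_1 of_int_diff of_int_mult)
  assume "(of_int a * of_int c + \<theta> * of_int b * of_int d) / (of_int a ^ 2 + \<theta> * of_int b ^ 2) \<in> \<rat>"
  then obtain \<rho> where \<rho>: "\<rho> \<in> \<rat>" "\<rho> = (A * C + \<theta> * B * D) / (A ^ 2 + \<theta> * B ^ 2)"
    by (simp add: A_def B_def C_def D_def)
  have "A ^ 2 + \<theta> * B ^ 2 > 0" using \<theta> ab by (intro add_pos_pos) (auto simp: A_def B_def)
  then have eq: "\<theta> * (B * D - \<rho> * B ^ 2) = \<rho> * A ^ 2 - A * C"
    using \<rho>(2) by (simp add: field_simps)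
  have Q: "A \<in> \<rat>" "B \<in> \<rat>" "C \<in> \<rat>" "D \<in> \<rat>" by (simp_all add: A_def B_def C_def D_def)
  show False
  proof (cases "B * D - \<rho> * B ^ 2 = 0")
    case False
    then have "\<theta> = (\<rho> * A ^ 2 - A * C) / (B * D - \<rho> * B ^ 2)" using eq by (simp add: field_simps)
    also have "\<dots> \<in> \<rat>" using Q \<rho>(1) by (intro Rats_divide Rats_diff Rats_mult) (auto simp: power2_eq_square)
    finally show False using \<theta>(1) by simp
  next
    case True
    then have "\<rho> * A ^ 2 - A * C = 0" using eq by simp
    then have "A * (\<rho> * A - C) = 0" by (simp add: power2_eq_square algebra_simps)
    moreover have "B * (D - \<rho> * B) = 0" using True by (simp add: power2_eq_square algebra_simps)
    moreover note ab
    ultimately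
    have "C = \<rho> * A" "D = \<rho> * B" by (auto simp: A_def B_def)
    with det' show False by simp
  qed
qed

text \<open>The form n s^2 + r s t + M t^2 is negative in the direction (2 M, -r). A multiple X of
  this vector, moved by (1, 0), stays negative and has first entry coprime to N times the second, so
  it completes to a Levi element.\<close>

lemma negative_primitive_vector:
  fixes n r :: int and M N :: nat
  assumes M: "M > 0" and N: "N > 0" and disc: "4 * int M * n - r\<^sup>2 < 0"
  obtains a b c d :: int where "a * d - b * c = 1" "int N dvd b" "a \<ge> 1"
    "n * a\<^sup>2 + r * a * c + int M * c\<^sup>2 < 0"
proof -
  \<comment> \<open>The factors N and r make N c divide X^2 while a is 1 modulo X; the factor |n| +
    1 lets the main term outweigh the remainder n.\<close>
  define X where "X = int N * \<bar>r\<bar> * (\<bar>n\<bar> + 1)"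
  define a where "a = 2 * int M * X + 1"
  define c where "c = - (r * X)"
  have X0: "X \<ge> 0" by (simp add: X_def)
  have "n * a\<^sup>2 + r * a * c + int M * c\<^sup>2 = (4 * int M * n - r\<^sup>2) * (X * (int M * X + 1)) + n"
    by (simp add: a_def c_def power2_eq_square algebra_simps)
  also have "\<dots> < 0"
  proof (cases "r = 0")
    case True
    then have "X = 0" "n < 0" using disc M by (auto simp: X_def mult_less_0_iff)
    then show ?thesis by simp
  next
    case False
    have "1 * 1 \<le> int N * \<bar>r\<bar>" using N False by (intro mult_mono) auto
    then have "1 * (\<bar>n\<bar> + 1) \<le> X" unfolding X_def by (intro mult_right_mono) auto
    then have X1: "\<bar>n\<bar> + 1 \<le> X" by simp
    have "1 * X \<le> (int M * X + 1) * X" using X0 M by (intro mult_right_mono) auto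
    then have XX: "X \<le> X * (int M * X + 1)" by (simp add: mult.commute)
    have "(4 * int M * n - r\<^sup>2) * (X * (int M * X + 1)) \<le> (- 1) * (X * (int M * X + 1))"
      using disc X0 XX by (intro mult_right_mono) auto
    then show ?thesis using XX X1 by linarith
  qed
  finally have Q: "n * a\<^sup>2 + r * a * c + int M * c\<^sup>2 < 0" .
  have "coprime a X"
  proof (rule coprimeI)
    fix x assume "x dvd a" "x dvd X"
    then have "x dvd a - 2 * int M * X" by (intro dvd_diff dvd_mult)
    then show "is_unit x" by (simp add: a_def)
  qed
  then have "coprime a (X * X)" by simp
  moreover have "int N * c dvd X * X"
  proof -
    have "int N * r dvd X" by (simp add: X_def abs_mult mult_dvd_mono)
    then have "int N * r * X dvd X * X" by (intro mult_dvd_mono) auto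
    then show ?thesis by (simp add: c_def mult_ac)
  qed
  ultimately have "coprime a (int N * c)" using coprime_divisors dvd_refl by blast
  then obtain s t where st: "s * a + t * (int N * c) = 1"
    by (metis bezout_int coprime_iff_gcd_eq_1)
  show ?thesis
  proof (rule that[of a s "- (int N * t)" c])
    show "a * s - - (int N * t) * c = 1" using st by (simp add: algebra_simps)
    show "a \<ge> 1" using X0 by (simp add: a_def)
  qed (use Q in auto)
qed

text \<open>Koecher's principle. The estimate for \<open>a n r\<close> is taken at \<open>Im \<Omega> = U Y U\<^sup>T\<close> with
  \<open>Y = diag(1, \<theta>)\<close>, where \<open>F\<close> has the same bound for all \<open>U\<close>, and \<open>U\<close> runs through a unipotent
  family on which the quadratic form tends to minus infinity. Irrationality of \<open>\<theta>\<close> keeps the points away from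
  the zeros of the theta block.\<close>

lemma borcherds_coeff_holomorphic:
  fixes n r :: int
  assumes F: "F \<in> paramodular_forms k N" and N: "N > 0" and c: "c > 0"
    and T: "jacobi_transform k' (c * N) \<phi>"
    and B: "is_borcherds_product N \<psi> F" and TB: "is_theta_block (leading_exponents \<psi>) \<phi>"
    and f: "has_jac_expansion (\<lambda>p. \<phi> p * exp_coeff (\<lambda>i. jacobi_V 0 i \<psi> p) m) \<alpha>"
    and disc: "4 * int ((c + m) * N) * n - r\<^sup>2 < 0"
  shows "\<alpha> n r = 0"
proof -
  define M where "M = (c + m) * N"
  have M: "M > 0" using c N by (simp add: M_def)
  obtain a b0 c' d0 :: int where det0: "a * d0 - b0 * c' = 1" and b0: "int N dvd b0" and a: "a \<ge> 1"
    and neg: "n * a\<^sup>2 + r * a * c' + int M * c'\<^sup>2 < 0"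
    by (rule negative_primitive_vector[OF M N]) (use disc M_def in auto)
  obtain \<theta> :: real where \<theta>: "\<theta> > 0" "\<theta> \<notin> \<rat>" using irrational_between[of 0 1] by auto
  obtain S where S: "\<And>x1 x2 x3. norm (F (siegel_point (Complex x1 1) (Complex x2 0) (Complex x3 \<theta>))) \<le> S"
    using paramodular_bounded_torus[OF F \<theta>(1)] by blast
  have S0: "S \<ge> 0" using S[of 0 0 0] norm_ge_zero order_trans by blast
  define q where "q = (\<lambda>s t :: int. n * s\<^sup>2 + r * s * t + int M * t\<^sup>2)"
  have bound: "norm (\<alpha> n r) \<le> S * exp (2 * pi * (of_int (q a c') + \<theta> * of_int (q b d)))"
    if det: "a * d - b * c' = 1" and b: "int N dvd b" "b \<noteq> 0" for b d
  proof -
    \<comment> \<open>The numbers v, y, h are the entries of U diag(1, \<theta>) U^T for U = (a b;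
      c' d); its determinant is \<theta>.\<close>
    define v where "v = of_int a ^ 2 + \<theta> * of_int b ^ 2"
    define y where "y = of_int a * of_int c' + \<theta> * of_int b * of_int d"
    define h where "h = of_int c' ^ 2 + \<theta> * of_int d ^ 2"
    have v: "v > 0" unfolding v_def using \<theta> a by (intro add_pos_nonneg) auto
    have irr: "y / v \<notin> \<rat>" unfolding y_def v_def
      by (rule irrational_slope_levi[OF \<theta>(2,1) det]) (use a b in auto)
    have "real_of_int a * of_int d - of_int b * of_int c' = 1"
      using det by (metis of_int_1 of_int_diff of_int_mult)
    then have "v * h - y\<^sup>2 = \<theta>" unfolding v_def h_def y_def by algebra
    then have h: "y\<^sup>2 < v * h" using \<theta> by simp
    have FS: "norm (F (siegel_point (Complex u v) (Complex x y) (Complex w h))) \<le> S" for u x w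
      unfolding v_def y_def h_def by (rule paramodular_bounded_torus_levi[OF F \<theta>(1) S det b(1)])
    have "norm (\<phi> (Complex u v, Complex x y) * exp_coeff (\<lambda>i. jacobi_V 0 i \<psi> (Complex u v, Complex x y)) m) \<le> S * exp (2 * pi * real M * h)" for u x
      unfolding M_def by (rule borcherds_fourier_jacobi_bound[OF F N c T B TB]) (use v irr h FS in simp_all)
    from jac_cauchy[OF f v this, of n r]
    have "norm (\<alpha> n r) \<le> S * exp (2 * pi * real M * h) * exp (2 * pi * (of_int n * v + of_int r * y))" .
    also have "\<dots> = S * exp (2 * pi * (of_int n * v + of_int r * y + M * h))"
      by (simp add: mult.assoc exp_add[symmetric] algebra_simps)
    \<comment> \<open>The pairing is linear in the imaginary part, so it splits into the form
      \<open>q\<close> at the two columns of U.\<close>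
    also have "of_int n * v + of_int r * y + M * h = of_int (q a c') + \<theta> * of_int (q b d)"
      by (simp add: q_def v_def y_def h_def power2_eq_square algebra_simps)
    finally show ?thesis .
  qed
  define \<beta> where "\<beta> = 2 * n * a * b0 + r * (a * d0 + b0 * c') + 2 * int M * c' * d0"
  \<comment> \<open>Adding l times the first column of U to the second preserves the determinant,
    and the negative value \<open>q a c'\<close> becomes the coefficient of l^2.\<close>
  have shift: "q (b0 + l * a) (d0 + l * c') = q b0 d0 + l * \<beta> + l\<^sup>2 * q a c'" for l
    by (simp add: q_def \<beta>_def power2_eq_square algebra_simps)
  \<comment> \<open>For l >= L the quadratic term absorbs the linear and constant ones, and b0 + l a
    is nonzero, as irrationality of the slope requires.\<close>
  define L where "L = \<bar>q b0 d0\<bar> + \<bar>\<beta>\<bar> + \<bar>b0\<bar> + 1"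
  have small: "norm (\<alpha> n r) \<le> S * exp (- (2 * pi * \<theta>) * real j)" if j: "int j \<ge> L" for j
  proof -
    \<comment> \<open>Multiples of N keep b0 + l a divisible by N.\<close>
    define l where "l = int N * int j"
    have lj: "l \<ge> int j" using N mult_right_mono[of 1 "int N" "int j"] by (simp add: l_def)
    have l: "l \<ge> L" using lj j by simp
    have l0: "l \<ge> 1" using l by (simp add: L_def)
    have det: "a * (d0 + l * c') - (b0 + l * a) * c' = 1" using det0 by (simp add: algebra_simps)
    have b: "int N dvd b0 + l * a" using b0 by (simp add: l_def)
    have "l * 1 \<le> l * a" using l0 a by (intro mult_left_mono) auto
    then have bnz: "b0 + l * a \<noteq> 0" using l by (auto simp: L_def)
    define A1 A2 A3 where "A1 = l * \<bar>q b0 d0\<bar>" and "A2 = l * \<bar>\<beta>\<bar>" and "A3 = l * \<bar>b0\<bar>"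
    have "l\<^sup>2 * q a c' \<le> l\<^sup>2 * (- 1)" using neg by (intro mult_left_mono) (auto simp: q_def)
    moreover have "l * L \<le> l * l" using l l0 by (intro mult_left_mono) auto
    then have "A1 + A2 + A3 + l \<le> l\<^sup>2" by (simp add: A1_def A2_def A3_def L_def power2_eq_square algebra_simps)
    moreover have "l * \<beta> \<le> A2" unfolding A2_def using l0 by (intro mult_left_mono) auto
    moreover have "1 * \<bar>q b0 d0\<bar> \<le> A1" unfolding A1_def using l0 by (intro mult_right_mono) auto
    then have "q b0 d0 \<le> A1" by linarith
    moreover have "0 \<le> A3" unfolding A3_def using l0 by simp
    ultimately have "q (b0 + l * a) (d0 + l * c') \<le> - l" unfolding shift by linarith
    then have qj: "real_of_int (q (b0 + l * a) (d0 + l * c')) \<le> - real j" using lj by linarith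
    have "q a c' < 0" using neg by (simp add: q_def)
    then have "real_of_int (q a c') \<le> 0" by simp
    then have "of_int (q a c') + \<theta> * of_int (q (b0 + l * a) (d0 + l * c')) \<le> 0 + \<theta> * (- real j)"
      using qj \<theta> by (intro add_mono mult_left_mono) simp_all
    then have "exp (2 * pi * (of_int (q a c') + \<theta> * of_int (q (b0 + l * a) (d0 + l * c')))) \<le> exp (2 * pi * (0 + \<theta> * (- real j)))"
      by (intro iffD2[OF exp_le_cancel_iff] mult_left_mono) auto
    then have "S * exp (2 * pi * (of_int (q a c') + \<theta> * of_int (q (b0 + l * a) (d0 + l * c')))) \<le> S * exp (- (2 * pi * \<theta>) * real j)"
    proof -
      assume "exp (2 * pi * (of_int (q a c') + \<theta> * of_int (q (b0 + l * a) (d0 + l * c')))) \<le> exp (2 * pi * (0 + \<theta> * (- real j)))"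
      from mult_left_mono[OF this S0] show ?thesis by (simp only: add_0 mult_minus_right mult_minus_left mult.assoc)
    qed
    then show ?thesis using bound[OF det b bnz] by (rule order_trans[rotated])
  qed
  have "(\<lambda>j. exp (- (2 * pi * \<theta>)) ^ j) \<longlonglongrightarrow> 0" using \<theta> by (intro LIMSEQ_power_zero) auto
  then have "(\<lambda>j. S * exp (- (2 * pi * \<theta>)) ^ j) \<longlonglongrightarrow> 0" by (rule tendsto_mult_right_zero)
  then have "(\<lambda>j. S * exp (- (2 * pi * \<theta>) * real j)) \<longlonglongrightarrow> 0"
    by (simp only: exp_of_nat2_mult)
  then have "norm (\<alpha> n r) \<le> 0"
  proof (rule tendsto_lowerbound)
    show "\<forall>\<^sub>F j in sequentially. norm (\<alpha> n r) \<le> S * exp (- (2 * pi * \<theta>) * real j)"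
      using eventually_ge_at_top[of "nat L"] by eventually_elim (rule small, simp)
  qed simp
  then show ?thesis by simp
qed

section \<open>Limits of powers\<close>

text \<open>On z = \<theta> \<tau>, scaling each factor by its leading exponential gives a product
  with a nonzero limit. If the inequality failed, boundedness of the damped product at the cusp
  would make the same expression tend to 0.\<close>

lemma leading_exponent_bound:
  fixes \<theta> :: real
  assumes f: "has_jac_expansion f c" and g: "has_jac_expansion g d"
    and h: "has_jac_expansion (\<lambda>p. f p * g p ^ m) e" and M: "M > 0"
    and hol: "\<And>n r. 4 * int M * n - r\<^sup>2 < 0 \<Longrightarrow> e n r = 0"
    and \<theta>: "0 \<le> \<theta>" "\<theta> \<le> 1"
    and f0: "is_leading \<theta> c n0 r0" and g0: "is_leading \<theta> d n1 r1"
  shows "of_int n0 + \<theta> * of_int r0 + m * (of_int n1 + \<theta> * of_int r1) \<ge> - (M * \<theta>\<^sup>2)"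
proof (rule ccontr)
  define E0 E1 where "E0 = of_int n0 + \<theta> * of_int r0" and "E1 = of_int n1 + \<theta> * of_int r1"
  define x where "x = - (E0 + m * E1 + M * \<theta>\<^sup>2)"
  assume "\<not> ?thesis"
  then have x: "x > 0" by (simp add: x_def E0_def E1_def)
  let ?p = "\<lambda>v. (Complex 0 v, Complex 0 (\<theta> * v))"
  define A where "A = (\<lambda>v. (f (?p v) * of_real (exp (2 * pi * v * E0))) * (g (?p v) * of_real (exp (2 * pi * v * E1))) ^ m)"
  have "(A \<longlongrightarrow> c n0 r0 * d n1 r1 ^ m) at_top"
    unfolding A_def E0_def E1_def
    by (intro tendsto_mult tendsto_power jac_leading_asymp[OF f f0] jac_leading_asymp[OF g g0])
  moreover have "(A \<longlongrightarrow> 0) at_top"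
  proof -
    obtain B where B: "\<And>\<tau> z. Im \<tau> \<ge> 1 \<Longrightarrow> 0 \<le> Im z \<Longrightarrow> Im z \<le> Im \<tau> \<Longrightarrow> jac_norm M (\<lambda>p. f p * g p ^ m) \<tau> z \<le> B"
      using jac_norm_bounded_cusp[OF h M _ hol, of 1] by auto
    have "norm (A v) \<le> B * exp (- ((2 * pi * x) * v))" if v: "v \<ge> 1" for v
    proof -
      have "\<theta> * v \<le> 1 * v" using \<theta> v by (intro mult_right_mono) auto
      then have "jac_norm M (\<lambda>p. f p * g p ^ m) (Complex 0 v) (Complex 0 (\<theta> * v)) \<le> B"
        using v \<theta> by (intro B) auto
      moreover have "(\<theta> * v)\<^sup>2 / v = \<theta>\<^sup>2 * v" using v by (simp add: power2_eq_square)
      ultimately have *: "norm (f (?p v) * g (?p v) ^ m) * exp (- 2 * pi * M * (\<theta>\<^sup>2 * v)) \<le> B"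
        by (simp add: jac_norm_def)
      have "norm (A v) = norm (f (?p v) * g (?p v) ^ m) * (exp (2 * pi * v * E0) * exp (2 * pi * v * E1) ^ m)"
        by (simp add: A_def norm_mult norm_power power_mult_distrib mult_ac)
      also have "exp (2 * pi * v * E0) * exp (2 * pi * v * E1) ^ m = exp (- 2 * pi * M * (\<theta>\<^sup>2 * v)) * exp (- ((2 * pi * x) * v))"
        unfolding exp_of_nat_mult[symmetric] exp_add[symmetric] by (simp add: x_def algebra_simps)
      also have "norm (f (?p v) * g (?p v) ^ m) * (exp (- 2 * pi * M * (\<theta>\<^sup>2 * v)) * exp (- ((2 * pi * x) * v))) \<le> B * exp (- ((2 * pi * x) * v))"
        unfolding mult.assoc[symmetric] using * by (intro mult_right_mono) (auto simp: mult_ac)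
      finally show ?thesis .
    qed
    moreover have "((\<lambda>v. B * exp (- ((2 * pi * x) * v))) \<longlongrightarrow> 0) at_top"
      using x by (intro tendsto_mult_right_zero exp_neg_mult_tendsto_0) auto
    ultimately show ?thesis
      by (intro Lim_null_comparison[of A "\<lambda>v. B * exp (- ((2 * pi * x) * v))"] eventually_at_top_linorderI[of 1])
  qed
  ultimately have "c n0 r0 * d n1 r1 ^ m = 0"
    using tendsto_unique[OF trivial_limit_at_top_linorder] by blast
  then show False using f0 g0 by (simp add: is_leading_def)
qed

text \<open>Gaussian elimination on coordinates in S: the vectors \<open>w s\<close> play the role
  of a basis dual to the evaluations at T.\<close>

lemma finitely_determined_basis:
  fixes W :: "('i \<Rightarrow> complex) set"
  assumes "finite S" and "(\<lambda>_. 0) \<in> W"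
    and "\<And>f g a. f \<in> W \<Longrightarrow> g \<in> W \<Longrightarrow> (\<lambda>i. f i + a * g i) \<in> W"
    and "\<And>f. f \<in> W \<Longrightarrow> \<forall>s\<in>S. f s = 0 \<Longrightarrow> f = (\<lambda>_. 0)"
  shows "\<exists>T w. T \<subseteq> S \<and> (\<forall>s\<in>T. w s \<in> W) \<and> (\<forall>f\<in>W. \<forall>i. f i = (\<Sum>s\<in>T. f s * w s i))"
  using assms
proof (induction S arbitrary: W rule: finite_induct)
  case empty
  then show ?case by (intro exI[of _ "{}"]) fastforce
next
  case (insert s S)
  note closed = insert.prems(2)
  show ?case
  proof (cases "\<forall>f\<in>W. f s = 0")
    case True
    have "\<exists>T w. T \<subseteq> S \<and> (\<forall>s\<in>T. w s \<in> W) \<and> (\<forall>f\<in>W. \<forall>i. f i = (\<Sum>s\<in>T. f s * w s i))"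
      by (rule insert.IH[OF insert.prems(1,2)]) (use True insert.prems(3) in auto)
    then show ?thesis by (elim ex_forward conj_forward) auto
  next
    case False
    then obtain f0 where f0: "f0 \<in> W" "f0 s \<noteq> 0" by auto
    \<comment> \<open>The pivot vector, normalised to value 1 at s; the summand 0 matches the shape
      of the closure assumption.\<close>
    define p where "p = (\<lambda>i. 0 + (1 / f0 s) * f0 i)"
    have p: "p \<in> W" "p s = 1"
      unfolding p_def by (rule closed[OF insert.prems(1) f0(1)]) (use f0(2) in simp)
    define W' where "W' = {f \<in> W. f s = 0}"
    have "\<exists>T w. T \<subseteq> S \<and> (\<forall>s\<in>T. w s \<in> W') \<and> (\<forall>f\<in>W'. \<forall>i. f i = (\<Sum>s\<in>T. f s * w s i))"
    proof (rule insert.IH)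
      show "(\<lambda>_. 0) \<in> W'" using insert.prems(1) by (simp add: W'_def)
      show "(\<lambda>i. f i + a * g i) \<in> W'" if "f \<in> W'" "g \<in> W'" for f g a
        using that closed[of f g a] by (simp add: W'_def)
      show "f = (\<lambda>_. 0)" if "f \<in> W'" "\<forall>s\<in>S. f s = 0" for f
        using that insert.prems(3)[of f] by (simp add: W'_def)
    qed
    then obtain T w where T: "T \<subseteq> S" "\<forall>t\<in>T. w t \<in> W'"
      and rep': "\<forall>f\<in>W'. \<forall>i. f i = (\<Sum>t\<in>T. f t * w t i)" by blast
    note rep = rep'[rule_format]
    have finT: "finite T" using T(1) insert.hyps(1) finite_subset by blast
    have sT: "s \<notin> T" using T(1) insert.hyps(2) by auto
    have sumW: "(\<lambda>i. p i + (\<Sum>t\<in>U. x t * w t i)) \<in> W" if "finite U" "U \<subseteq> T" for U x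
      using that
    proof (induction U rule: finite_induct)
      case empty then show ?case using p by simp
    next
      case (insert u U)
      have "(\<lambda>i. (p i + (\<Sum>t\<in>U. x t * w t i)) + x u * w u i) \<in> W"
        using insert T(2) by (intro closed) (auto simp: W'_def)
      then show ?case using insert.hyps by (simp add: add_ac)
    qed
    define w0 where "w0 = (\<lambda>i. p i + (\<Sum>t\<in>T. (- p t) * w t i))"
    have w0: "w0 \<in> W" unfolding w0_def by (rule sumW[OF finT]) simp
    define w' where "w' = w(s := w0)"
    have "f i = (\<Sum>t\<in>insert s T. f t * w' t i)" if f: "f \<in> W" for f i
    proof -
      have "(\<lambda>i. f i + (- f s) * p i) \<in> W'"
        using closed[OF f p(1), of "- f s"] p(2) by (simp add: W'_def)
      from rep[OF this, of i] have "f i = f s * p i + (\<Sum>t\<in>T. (f t + (- f s) * p t) * w t i)"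
        by (simp add: diff_eq_eq add.commute)
      also have "(\<Sum>t\<in>T. (f t + (- f s) * p t) * w t i) = f s * (\<Sum>t\<in>T. (- p t) * w t i) + (\<Sum>t\<in>T. f t * w t i)"
        by (simp add: sum_distrib_left sum.distrib[symmetric] algebra_simps)
      also have "f s * p i + (f s * (\<Sum>t\<in>T. (- p t) * w t i) + (\<Sum>t\<in>T. f t * w t i)) = f s * w0 i + (\<Sum>t\<in>T. f t * w t i)"
        unfolding w0_def distrib_left by (simp only: add.assoc)
      also have "(\<Sum>t\<in>T. f t * w t i) = (\<Sum>t\<in>T. f t * w' t i)"
        using sT by (intro sum.cong) (auto simp: w'_def)
      finally show ?thesis using sT finT by (simp add: w'_def)
    qed
    moreover have "\<forall>t\<in>insert s T. w' t \<in> W" using w0 T(2) by (auto simp: w'_def W'_def)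
    moreover have "insert s T \<subseteq> insert s S" using T(1) by auto
    ultimately show ?thesis by (intro exI[of _ "insert s T"] exI[of _ w'] conjI ballI allI) auto
  qed
qed

lemma convergent_subsequence_finite:
  fixes y :: "nat \<Rightarrow> 'i \<Rightarrow> complex"
  assumes "finite S" "\<And>j s. s \<in> S \<Longrightarrow> norm (y j s) \<le> B"
  shows "\<exists>\<rho> l. strict_mono (\<rho> :: nat \<Rightarrow> nat) \<and> (\<forall>s\<in>S. (\<lambda>j. y (\<rho> j) s) \<longlonglongrightarrow> l s)"
  using assms
proof (induction S rule: finite_induct)
  case empty
  then show ?case by (intro exI[of _ id]) (auto simp: strict_mono_def)
next
  case (insert s S)
  then obtain \<rho> l where \<rho>: "strict_mono \<rho>" and "\<forall>t\<in>S. (\<lambda>j. y (\<rho> j) t) \<longlonglongrightarrow> l t"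
    by (metis insertCI)
  then have \<rho>l: "(\<lambda>j. y (\<rho> j) t) \<longlonglongrightarrow> l t" if "t \<in> S" for t using that by blast
  have "bounded (range (\<lambda>j. y (\<rho> j) s))" using insert.prems by (auto simp: bounded_iff)
  then obtain x \<sigma> where \<sigma>: "strict_mono \<sigma>" "((\<lambda>j. y (\<rho> j) s) \<circ> \<sigma>) \<longlonglongrightarrow> x"
    using bounded_imp_convergent_subsequence by blast
  have "(\<lambda>j. y ((\<rho> \<circ> \<sigma>) j) t) \<longlonglongrightarrow> (l(s := x)) t" if "t \<in> insert s S" for t
  proof (cases "t = s")
    case True then show ?thesis using \<sigma>(2) by (simp add: o_def)
  next
    case False
    then have "(\<lambda>j. y (\<rho> j) t) \<longlonglongrightarrow> l t" using that by (intro \<rho>l) auto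
    from LIMSEQ_subseq_LIMSEQ[OF this \<sigma>(1)] show ?thesis using False by (simp add: o_def)
  qed
  moreover have "strict_mono (\<rho> \<circ> \<sigma>)" using \<rho> \<sigma>(1) by (rule strict_mono_o)
  ultimately show ?case by blast
qed

lemma uniform_limit_sum:
  fixes f :: "'i \<Rightarrow> 'n \<Rightarrow> 'p \<Rightarrow> complex"
  assumes "finite I" "\<And>i. i \<in> I \<Longrightarrow> uniform_limit S (f i) (l i) F"
  shows "uniform_limit S (\<lambda>j p. \<Sum>i\<in>I. f i j p) (\<lambda>p. \<Sum>i\<in>I. l i p) F"
  using assms
proof (induction I rule: finite_induct)
  case empty
  then show ?case using uniform_limit_const[where c = "\<lambda>p. 0"] by simp
next
  case (insert i I)
  then have "uniform_limit S (\<lambda>j p. f i j p + (\<Sum>i\<in>I. f i j p)) (\<lambda>p. l i p + (\<Sum>i\<in>I. l i p)) F"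
    by (intro uniform_limit_add) auto
  then show ?case using insert.hyps by simp
qed

lemma uniform_limit_scalar_mult:
  fixes x :: "'n \<Rightarrow> complex" and g :: "'n \<Rightarrow> 'p \<Rightarrow> complex"
  assumes "(x \<longlongrightarrow> y) F" "uniform_limit S g l F" "bounded (l ` S)"
  shows "uniform_limit S (\<lambda>j p. x j * g j p) (\<lambda>p. y * l p) F"
proof (rule uniform_lim_mult[OF _ assms(2) _ assms(3)])
  show "uniform_limit S (\<lambda>j p. x j) (\<lambda>p. y) F"
    using assms(1) by (auto simp: uniform_limit_iff tendsto_iff elim: eventually_mono)
  show "bounded ((\<lambda>p. y) ` S)" by (simp add: bounded_iff) auto
qed

text \<open>After scaling by (1 / M)^m, summand i of the recursion for \<open>exp_coeff\<close>
  keeps a surplus factor (1 / M)^i. Only i = 0 survives, and iteration yields the power of - G 1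
  over the factorial.\<close>

lemma exp_coeff_uniform_limit:
  fixes g :: "'n \<Rightarrow> nat \<Rightarrow> 'p \<Rightarrow> complex" and M :: "'n \<Rightarrow> complex"
  assumes lim: "\<And>i. i > 0 \<Longrightarrow> uniform_limit S (\<lambda>j p. 1 / M j * g j i p) (G i) F"
    and bdd: "\<And>i. i > 0 \<Longrightarrow> bounded (G i ` S)"
    and M: "((\<lambda>j. 1 / M j) \<longlongrightarrow> 0) F"
  shows "uniform_limit S (\<lambda>j p. (1 / M j) ^ m * exp_coeff (\<lambda>i. g j i p) m) (\<lambda>p. (- G 1 p) ^ m / fact m) F"
proof (induction m rule: less_induct)
  case (less m)
  have bE: "bounded ((\<lambda>p. (- G 1 p) ^ l / fact l) ` S)" for l
  proof -
    obtain B where B: "\<And>p. p \<in> S \<Longrightarrow> norm (G 1 p) \<le> B" using bdd[of 1] by (auto simp: bounded_iff)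
    have "norm ((- G 1 p) ^ l / fact l) \<le> B ^ l / fact l" if "p \<in> S" for p
    proof -
      have "norm (G 1 p) ^ l \<le> B ^ l" using B[OF that] by (rule power_mono) simp
      then show ?thesis by (simp add: norm_divide norm_power divide_right_mono)
    qed
    then show ?thesis unfolding bounded_iff by blast
  qed
  show ?case
  proof (cases m)
    case 0
    then show ?thesis using uniform_limit_const[where c = "\<lambda>p. 1"] by simp
  next
    case (Suc m')
    \<comment> \<open>The power (1 / M)^m, with m = i + 1 + (m' - i), is shared among the surplus,
      the factor g and the earlier coefficient.\<close>
    define H where "H = (\<lambda>i j p. (of_nat (Suc i) * (1 / M j) ^ i) * ((1 / M j * g j (Suc i) p) * ((1 / M j) ^ (m' - i) * exp_coeff (\<lambda>i. g j i p) (m' - i))))"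
    \<comment> \<open>Here \<open>0 ^ i\<close> is 1 at i = 0 and 0 otherwise, the limit of the
      surplus factor.\<close>
    define L where "L = (\<lambda>i p. (of_nat (Suc i) * 0 ^ i) * (G (Suc i) p * ((- G 1 p) ^ (m' - i) / fact (m' - i))))"
    have H: "uniform_limit S (H i) (L i) F" for i
      unfolding H_def L_def
    proof (rule uniform_limit_scalar_mult)
      show "((\<lambda>j. of_nat (Suc i) * (1 / M j) ^ i) \<longlongrightarrow> of_nat (Suc i) * 0 ^ i) F"
        by (intro tendsto_intros M)
      show "uniform_limit S (\<lambda>j p. 1 / M j * g j (Suc i) p * ((1 / M j) ^ (m' - i) * exp_coeff (\<lambda>i. g j i p) (m' - i)))
         (\<lambda>p. G (Suc i) p * ((- G 1 p) ^ (m' - i) / fact (m' - i))) F"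
        using Suc by (intro uniform_lim_mult lim less bE bdd) auto
      show "bounded ((\<lambda>p. G (Suc i) p * ((- G 1 p) ^ (m' - i) / fact (m' - i))) ` S)"
      proof -
        obtain B where B: "\<And>p. p \<in> S \<Longrightarrow> norm (G (Suc i) p) \<le> B" using bdd[of "Suc i"] by (auto simp: bounded_iff)
        obtain B' where B': "\<And>p. p \<in> S \<Longrightarrow> norm ((- G 1 p) ^ (m' - i) / fact (m' - i)) \<le> B'"
          using bE[of "m' - i"] unfolding bounded_iff by auto
        have "norm (G (Suc i) p * ((- G 1 p) ^ (m' - i) / fact (m' - i))) \<le> B * B'" if "p \<in> S" for p
          unfolding norm_mult using B[OF that] B'[OF that] by (intro mult_mono) (auto intro: order_trans[OF norm_ge_zero])
        then show ?thesis unfolding bounded_iff by blast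
      qed
    qed
    have "uniform_limit S (\<lambda>j p. (- 1 / of_nat (Suc m')) * (\<Sum>i\<le>m'. H i j p)) (\<lambda>p. (- 1 / of_nat (Suc m')) * (\<Sum>i\<le>m'. L i p)) F"
    proof -
      have "uniform_limit S (\<lambda>j p. \<Sum>i\<le>m'. H i j p) (\<lambda>p. \<Sum>i\<le>m'. L i p) F"
        by (intro uniform_limit_sum H) auto
      from bounded_linear.uniform_limit[OF bounded_linear_mult_right this] show ?thesis .
    qed
    moreover have "(- 1 / of_nat (Suc m')) * (\<Sum>i\<le>m'. H i j p) = (1 / M j) ^ m * exp_coeff (\<lambda>i. g j i p) m" for j p
    proof -
      have "H i j p = (1 / M j) ^ m * (of_nat (Suc i) * g j (Suc i) p * exp_coeff (\<lambda>i. g j i p) (m' - i))" if "i \<le> m'" for i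
      proof -
        have "m = i + 1 + (m' - i)" using that Suc by simp
        then have "(1 / M j) ^ m = (1 / M j) ^ i * (1 / M j) * (1 / M j) ^ (m' - i)"
          by (metis power_add power_one_right)
        then show ?thesis by (simp only: H_def) (simp only: mult_ac)
      qed
      then have "(\<Sum>i\<le>m'. H i j p) = (1 / M j) ^ m * (\<Sum>i\<le>m'. of_nat (Suc i) * g j (Suc i) p * exp_coeff (\<lambda>i. g j i p) (m' - i))"
        by (simp add: sum_distrib_left del: of_nat_Suc)
      then show ?thesis unfolding Suc exp_coeff_Suc by (simp del: of_nat_Suc power_Suc)
    qed
    moreover have "(- 1 / of_nat (Suc m')) * (\<Sum>i\<le>m'. L i p) = (- G 1 p) ^ m / fact m" for p
    proof -
      have "(\<Sum>i\<le>m'. L i p) = (\<Sum>i\<in>{0}. L i p)"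
        by (intro sum.mono_neutral_right) (auto simp: L_def)
      then have S: "(\<Sum>i\<le>m'. L i p) = G 1 p * ((- G 1 p) ^ m' / fact m')" by (simp add: L_def)
      show ?thesis unfolding S Suc by (simp add: field_simps)
    qed
    ultimately show ?thesis by (simp only:)
  qed
qed

section \<open>Finite dimensionality\<close>

text \<open>Linear algebra is done on coefficient arrays; this recovers the function, which agrees
  with the original form on the upper half plane.\<close>

definition jac_series :: "(int \<times> int \<Rightarrow> complex) \<Rightarrow> complex \<times> complex \<Rightarrow> complex" where
  "jac_series a = (\<lambda>(\<tau>, z). \<Sum>\<^sub>\<infinity>p. a p * ee (of_int (fst p) * \<tau> + of_int (snd p) * z))"

lemma jac_series_eq:
  assumes "has_jac_expansion f (\<lambda>n r. a (n, r))" "Im \<tau> > 0"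
  shows "jac_series a (\<tau>, z) = f (\<tau>, z)"
proof -
  have "((\<lambda>p. a p * ee (of_int (fst p) * \<tau> + of_int (snd p) * z)) has_sum f (\<tau>, z)) UNIV"
    using assms by (simp add: has_jac_expansion_def case_prod_unfold)
  then show ?thesis by (simp add: jac_series_def infsumI)
qed

lemma has_jac_expansion_jac_series:
  assumes "has_jac_expansion f (\<lambda>n r. a (n, r))"
  shows "has_jac_expansion (jac_series a) (\<lambda>n r. a (n, r))"
  using assms jac_series_eq[OF assms] by (rule has_jac_expansion_cong)

lemma jacobi_transform_cong:
  assumes T: "jacobi_transform k m f" and eq: "\<And>\<tau> z. Im \<tau> > 0 \<Longrightarrow> g (\<tau>, z) = f (\<tau>, z)"
  shows "jacobi_transform k m g"
  unfolding jacobi_transform_def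
proof (intro conjI allI impI)
  fix a b c d :: int and \<tau> z assume det: "a * d - b * c = 1" and \<tau>: "Im \<tau> > 0"
  have "Im ((of_int a * \<tau> + of_int b) / (of_int c * \<tau> + of_int d)) > 0"
    unfolding Im_moebius_int(2)[OF det \<tau>] using Im_moebius_int(1)[OF det \<tau>] \<tau> by simp
  then show "g ((of_int a * \<tau> + of_int b) / (of_int c * \<tau> + of_int d), z / (of_int c * \<tau> + of_int d))
        = (of_int c * \<tau> + of_int d) powi k * ee (of_nat m * of_int c * z\<^sup>2 / (of_int c * \<tau> + of_int d)) * g (\<tau>, z)"
    using T det \<tau> unfolding jacobi_transform_def by (simp add: eq)
next
  fix l \<mu> :: int and \<tau> z assume \<tau>: "Im \<tau> > 0"
  then show "g (\<tau>, z + of_int l * \<tau> + of_int \<mu>) = ee (- (of_nat m * (of_int (l\<^sup>2) * \<tau> + 2 * of_int l * z))) * g (\<tau>, z)"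
    using T unfolding jacobi_transform_def eq[OF \<tau>] by blast
qed

lemma jacobi_transform_lincomb:
  assumes f: "jacobi_transform k m f" and g: "jacobi_transform k m g"
  shows "jacobi_transform k m (\<lambda>p. f p + x * g p)"
  unfolding jacobi_transform_def
proof (intro conjI allI impI)
  fix a b c d :: int and \<tau> z assume det: "a * d - b * c = 1" and \<tau>: "Im \<tau> > 0"
  let ?J = "of_int c * \<tau> + of_int d" and ?p = "((of_int a * \<tau> + of_int b) / (of_int c * \<tau> + of_int d), z / (of_int c * \<tau> + of_int d))"
  have 1: "f ?p = ?J powi k * ee (of_nat m * of_int c * z\<^sup>2 / ?J) * f (\<tau>, z)"
    using f det \<tau> unfolding jacobi_transform_def by blast
  have 2: "g ?p = ?J powi k * ee (of_nat m * of_int c * z\<^sup>2 / ?J) * g (\<tau>, z)"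
    using g det \<tau> unfolding jacobi_transform_def by blast
  show "f ?p + x * g ?p = ?J powi k * ee (of_nat m * of_int c * z\<^sup>2 / ?J) * (f (\<tau>, z) + x * g (\<tau>, z))"
    unfolding 1 2 by (simp only: distrib_left) (simp only: mult_ac)
next
  fix l \<mu> :: int and \<tau> z assume \<tau>: "Im \<tau> > 0"
  let ?p = "(\<tau>, z + of_int l * \<tau> + of_int \<mu>)" and ?e = "ee (- (of_nat m * (of_int (l\<^sup>2) * \<tau> + 2 * of_int l * z)))"
  have 1: "f ?p = ?e * f (\<tau>, z)" using f \<tau> unfolding jacobi_transform_def by blast
  have 2: "g ?p = ?e * g (\<tau>, z)" using g \<tau> unfolding jacobi_transform_def by blast
  show "f ?p + x * g ?p = ?e * (f (\<tau>, z) + x * g (\<tau>, z))"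
    unfolding 1 2 by (simp only: distrib_left) (simp only: mult_ac)
qed

text \<open>Bounding the exponents below in one irrational direction leaves only finitely many singular
  coefficients modulo elliptic translations (\<open>singular_window\<close>), and these determine the form.\<close>

definition jac_space :: "nat \<Rightarrow> real \<Rightarrow> real \<Rightarrow> (int \<times> int \<Rightarrow> complex) set" where
  "jac_space N \<theta> \<kappa> = {a. has_jac_expansion (jac_series a) (\<lambda>n r. a (n, r)) \<and>
     jacobi_transform 0 N (jac_series a) \<and>
     (\<forall>n r. a (n, r) \<noteq> 0 \<longrightarrow> \<kappa> \<le> of_int n + \<theta> * of_int r)}"

lemma jac_space_0: "(\<lambda>_. 0) \<in> jac_space N \<theta> \<kappa>"
proof -
  have "jac_series (\<lambda>_. 0) = (\<lambda>p. 0)" by (auto simp: jac_series_def)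
  then show ?thesis by (simp add: jac_space_def has_jac_expansion_0 jacobi_transform_def)
qed

lemma jac_space_lincomb:
  assumes a: "a \<in> jac_space N \<theta> \<kappa>" and b: "b \<in> jac_space N \<theta> \<kappa>"
  shows "(\<lambda>i. a i + x * b i) \<in> jac_space N \<theta> \<kappa>"
proof -
  let ?f = "\<lambda>p. jac_series a p + x * jac_series b p"
  have e: "has_jac_expansion ?f (\<lambda>n r. a (n, r) + x * b (n, r))"
    using a b by (intro has_jac_expansion_add has_jac_expansion_scale) (auto simp: jac_space_def)
  note eq = jac_series_eq[of ?f "\<lambda>i. a i + x * b i", OF e]
  have "jacobi_transform 0 N ?f"
    using a b by (intro jacobi_transform_lincomb) (auto simp: jac_space_def)
  then have "jacobi_transform 0 N (jac_series (\<lambda>i. a i + x * b i))"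
    using eq by (rule jacobi_transform_cong)
  moreover have "has_jac_expansion (jac_series (\<lambda>i. a i + x * b i)) (\<lambda>n r. a (n, r) + x * b (n, r))"
    using has_jac_expansion_jac_series[of ?f "\<lambda>i. a i + x * b i"] e by simp
  moreover have "\<kappa> \<le> of_int n + \<theta> * of_int r" if "a (n, r) + x * b (n, r) \<noteq> 0" for n r
    using that a b by (cases "a (n, r) = 0") (auto simp: jac_space_def)
  ultimately show ?thesis by (simp add: jac_space_def)
qed

lemma jac_space_sum:
  assumes "finite S" "\<And>s. s \<in> S \<Longrightarrow> w s \<in> jac_space N \<theta> \<kappa>"
  shows "(\<lambda>i. \<Sum>s\<in>S. x s * w s i) \<in> jac_space N \<theta> \<kappa>"
  using assms
proof (induction S rule: finite_induct)
  case empty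
  then show ?case by (simp add: jac_space_0)
next
  case (insert s S)
  then have "(\<lambda>i. (\<Sum>s\<in>S. x s * w s i) + x s * w s i) \<in> jac_space N \<theta> \<kappa>"
    by (intro jac_space_lincomb) auto
  then show ?case using insert.hyps by (simp add: add.commute)
qed

lemma jac_space_holomorphic_eq_0:
  assumes a: "a \<in> jac_space N \<theta> \<kappa>" and N: "N > 0"
    and hol: "\<And>n r. 4 * int N * n - r\<^sup>2 < 0 \<Longrightarrow> a (n, r) = 0"
  shows "a = (\<lambda>_. 0)"
proof
  fix i :: "int \<times> int"
  have "a (fst i, snd i) = 0"
    by (rule weight_0_holomorphic_eq_0[of "jac_series a" "\<lambda>n r. a (n, r)"])
       (use a N hol in \<open>auto simp: jac_space_def\<close>)
  then show "a i = 0" by simp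
qed

definition singular_window :: "nat \<Rightarrow> real \<Rightarrow> real \<Rightarrow> (int \<times> int) set" where
  "singular_window N \<theta> \<kappa> = {(n, r). \<bar>r\<bar> \<le> int N \<and> 4 * int N * n - r\<^sup>2 < 0 \<and> \<kappa> \<le> of_int n + \<theta> * of_int r}"

text \<open>On the strip |r| <= N, negative discriminant bounds n above and \<kappa> bounds it
  below.\<close>

lemma finite_singular_window: "finite (singular_window N \<theta> \<kappa>)"
proof -
  define E where "E = \<lceil>\<bar>\<kappa>\<bar> + \<bar>\<theta>\<bar> * N\<rceil>"
  have "singular_window N \<theta> \<kappa> \<subseteq> {-E..int N * int N} \<times> {-int N..int N}"
  proof (safe, goal_cases)
    case (1 n r)
    then have r: "\<bar>r\<bar> \<le> int N" and d: "4 * int N * n < r\<^sup>2" and \<kappa>: "\<kappa> \<le> of_int n + \<theta> * of_int r"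
      by (auto simp: singular_window_def)
    have "\<bar>real_of_int r\<bar> \<le> real N" using r by linarith
    then have "\<bar>\<theta> * of_int r\<bar> \<le> \<bar>\<theta>\<bar> * N" by (simp add: abs_mult mult_left_mono)
    then have "- real_of_int n \<le> \<bar>\<kappa>\<bar> + \<bar>\<theta>\<bar> * N" using \<kappa> by linarith
    then have "- n \<le> E" unfolding E_def by linarith
    moreover have "n \<le> int N * int N"
    proof (cases "N = 0")
      case False
      have "r\<^sup>2 \<le> (int N)\<^sup>2" using r by (metis abs_le_square_iff abs_of_nat)
      then have "4 * int N * n < int N * int N" using d by (simp add: power2_eq_square)
      then have "int N * (4 * n) < int N * int N" by (simp add: mult_ac)
      then have "4 * n < int N" using False by simp
      moreover have "int N * 1 \<le> int N * int N" using False by (intro mult_left_mono) auto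
      ultimately show ?thesis by linarith
    qed (use r d in auto)
    ultimately show ?case by auto
  next
    case (2 n r)
    then show ?case by (auto simp: singular_window_def)
  qed
  then show ?thesis by (rule finite_subset) auto
qed

text \<open>A nonzero coefficient of negative discriminant can be translated into the strip |r| <= N
  and then lies in the window. Vanishing on the window thus makes the form holomorphic, hence zero
  in weight 0.\<close>

lemma jac_space_determined:
  assumes a: "a \<in> jac_space N \<theta> \<kappa>" and N: "N > 0" and 0: "\<forall>s\<in>singular_window N \<theta> \<kappa>. a s = 0"
  shows "a = (\<lambda>_. 0)"
proof (rule jac_space_holomorphic_eq_0[OF a N])
  fix n r assume disc: "4 * int N * n - r\<^sup>2 < 0"
  have e: "has_jac_expansion (jac_series a) (\<lambda>n r. a (n, r))" and T: "jacobi_transform 0 N (jac_series a)"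
    and supp: "\<And>n r. a (n, r) \<noteq> 0 \<Longrightarrow> \<kappa> \<le> of_int n + \<theta> * of_int r"
    using a by (auto simp: jac_space_def)
  obtain n' r' where *: "a (n, r) = a (n', r')" "4 * int N * n' - r'\<^sup>2 = 4 * int N * n - r\<^sup>2" "\<bar>r'\<bar> \<le> int N"
    by (rule jac_coeff_reduce[OF e T N, of n r])
  show "a (n, r) = 0"
  proof (rule ccontr)
    assume "a (n, r) \<noteq> 0"
    then have "a (n', r') \<noteq> 0" using * by simp
    then have "(n', r') \<in> singular_window N \<theta> \<kappa>"
      using * disc supp by (auto simp: singular_window_def)
    then show False using 0 \<open>a (n', r') \<noteq> 0\<close> by blast
  qed
qed

lemma wh_jacobi_formsD:
  assumes "f \<in> wh_jacobi_forms k m"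
  shows "has_jac_expansion f (jac_coeff f)" "jacobi_transform k m f" "\<exists>n0. \<forall>n r. jac_coeff f n r \<noteq> 0 \<longrightarrow> n0 \<le> n"
proof -
  obtain c n0 where c: "has_jac_expansion f c" "\<forall>n r. n < n0 \<longrightarrow> c n r = 0" and T: "jacobi_transform k m f"
    using assms by (auto simp: wh_jacobi_forms_def)
  have eq: "jac_coeff f = c" by (rule jac_coeff_eq[OF c(1)])
  show "has_jac_expansion f (jac_coeff f)" "jacobi_transform k m f" using c T by (simp_all add: eq)
  show "\<exists>n0. \<forall>n r. jac_coeff f n r \<noteq> 0 \<longrightarrow> n0 \<le> n" using c(2) unfolding eq by (metis not_le)
qed

lemma is_leading_min:
  assumes "is_leading \<theta> c n0 r0" "c n r \<noteq> 0"
  shows "of_int n0 + \<theta> * of_int r0 \<le> of_int n + \<theta> * of_int r"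
  using assms unfolding is_leading_def by (cases "(n, r) = (n0, r0)") force+

lemma is_leading_exists:
  assumes "has_jac_expansion f c" "jacobi_transform k M f" "M > 0" "\<theta> \<notin> \<rat>" "c n1 r1 \<noteq> 0"
    and "\<And>n r. \<bar>r\<bar> \<le> int M \<Longrightarrow> c n r \<noteq> 0 \<Longrightarrow> n0 \<le> n"
  shows "\<exists>n0 r0. is_leading \<theta> c n0 r0"
proof -
  obtain K where K: "\<And>n r. c n r \<noteq> 0 \<Longrightarrow> r\<^sup>2 - K \<le> 4 * int M * n"
    using jac_support_bound[OF assms(1-3), of n0] assms(6) by blast
  then show ?thesis
    using jac_leading_term[where c = c, OF assms(3) _ assms(4,5)] by blast
qed

text \<open>Uniform convergence on a single torus suffices, because \<open>jac_cauchy\<close> reads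
  off every coefficient there; \<phi> is bounded on that torus.\<close>

lemma limit_power_holomorphic:
  fixes \<Phi> :: "nat \<Rightarrow> complex \<times> complex \<Rightarrow> complex"
  assumes \<phi>: "has_jac_expansion \<phi> c" and \<alpha>: "\<And>j. has_jac_expansion (\<lambda>p. \<phi> p * \<Phi> j p) (\<alpha> j)"
    and 0: "\<And>j. \<alpha> j n r = 0"
    and lim: "uniform_limit {(\<tau>, z). Im \<tau> = 1 \<and> Im z = 0} (\<lambda>j p. x j * \<Phi> j p) (\<lambda>p. (- G p) ^ m / fact m) sequentially"
    and e: "has_jac_expansion (\<lambda>p. \<phi> p * G p ^ m) e"
  shows "e n r = 0"
proof -
  define S where "S = {(\<tau> :: complex, z :: complex). Im \<tau> = 1 \<and> Im z = 0}"
  define K where "K = ((- 1) ^ m / fact m :: complex)"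
  obtain B where B: "\<And>\<tau> z. Im \<tau> = 1 \<Longrightarrow> Im z = 0 \<Longrightarrow> norm (\<phi> (\<tau>, z)) \<le> B"
    using jac_expansion_bounded[OF \<phi>, of 1 0] by auto
  have "0 \<le> norm (\<phi> (\<i>, 0))" by simp
  also have "\<dots> \<le> B" by (rule B) simp_all
  finally have B0: "B \<ge> 0" .
  have bound: "norm (K * e n r) \<le> B * \<epsilon> * exp (2 * pi * of_int n)" if \<epsilon>: "\<epsilon> > 0" for \<epsilon>
  proof -
    have "\<forall>\<^sub>F j in sequentially. \<forall>p\<in>S. dist (x j * \<Phi> j p) ((- G p) ^ m / fact m) < \<epsilon>"
      using lim \<epsilon> unfolding S_def by (rule uniform_limitD)
    then obtain j where j: "\<forall>p\<in>S. dist (x j * \<Phi> j p) ((- G p) ^ m / fact m) < \<epsilon>"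
      using eventually_happens trivial_limit_sequentially by blast
    have exp: "has_jac_expansion (\<lambda>p. x j * (\<phi> p * \<Phi> j p) + (- K) * (\<phi> p * G p ^ m)) (\<lambda>n r. x j * \<alpha> j n r + (- K) * e n r)"
      by (intro has_jac_expansion_add has_jac_expansion_scale \<alpha> e)
    have "norm (x j * (\<phi> p * \<Phi> j p) + (- K) * (\<phi> p * G p ^ m)) \<le> B * \<epsilon>" if p: "p \<in> S" for p
    proof -
      have "x j * (\<phi> p * \<Phi> j p) + (- K) * (\<phi> p * G p ^ m) = \<phi> p * (x j * \<Phi> j p - (- G p) ^ m / fact m)"
        by (simp add: K_def power_minus[of "G p"] algebra_simps)
      moreover have "norm (\<phi> p) \<le> B" using p B by (auto simp: S_def)
      moreover have "norm (x j * \<Phi> j p - (- G p) ^ m / fact m) \<le> \<epsilon>" using j p by (auto simp: dist_norm intro: less_imp_le)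
      ultimately show ?thesis using B0 by (simp add: norm_mult mult_mono)
    qed
    then have "norm (x j * \<alpha> j n r + (- K) * e n r) \<le> B * \<epsilon> * exp (2 * pi * (of_int n * 1 + of_int r * 0))"
      by (intro jac_cauchy[OF exp]) (auto simp: S_def)
    then show ?thesis by (simp add: 0)
  qed
  have "((\<lambda>\<epsilon>. B * \<epsilon> * exp (2 * pi * of_int n)) \<longlongrightarrow> B * 0 * exp (2 * pi * of_int n)) (at_right 0)"
    by (intro tendsto_intros)
  then have "norm (K * e n r) \<le> B * 0 * exp (2 * pi * of_int n)"
    by (rule tendsto_lowerbound) (use bound in \<open>auto simp: eventually_at_filter\<close>)
  then show ?thesis by (simp add: K_def)
qed

text \<open>As a function of t, n + t r + N t^2 has its minimum at t = - r / (2 N), with value the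
  discriminant over 4 N. A coefficient of negative discriminant would contradict the hypothesis near
  that point, once the point is moved into the unit interval.\<close>

lemma jac_space_holomorphic_if_exponents_nonneg:
  assumes a: "a \<in> jac_space N \<theta> \<kappa>" and N: "N > 0"
    and nonneg: "\<And>(t :: real) n r. 0 < t \<Longrightarrow> t < 1 \<Longrightarrow> t \<notin> \<rat> \<Longrightarrow> a (n, r) \<noteq> 0 \<Longrightarrow> of_int n + t * of_int r \<ge> - (N * t\<^sup>2)"
  shows "a = (\<lambda>_. 0)"
proof (rule jac_space_holomorphic_eq_0[OF a N])
  fix n r assume disc: "4 * int N * n - r\<^sup>2 < 0"
  have e: "has_jac_expansion (jac_series a) (\<lambda>n r. a (n, r))" and T: "jacobi_transform 0 N (jac_series a)"
    using a by (auto simp: jac_space_def)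
  \<comment> \<open>An elliptic translation replaces r by -s with 0 <= s < 2 N, so the minimum is at
    t0 = s / (2 N) in [0, 1).\<close>
  define s where "s = (- r) mod (2 * int N)"
  define l where "l = (- r) div (2 * int N)"
  define n' where "n' = n + l * r + int N * l\<^sup>2"
  have rs: "r + 2 * int N * l = - s"
    using mult_div_mod_eq[of "2 * int N" "- r"] unfolding s_def l_def by linarith
  have s: "0 \<le> s" "s \<le> 2 * int N - 1" using N pos_mod_bound[of "2 * int N" "- r"] by (auto simp: s_def)
  have eq: "a (n, r) = a (n', - s)"
    using jac_elliptic_coeff[OF e T, of n r l] by (simp add: n'_def rs)
  have "4 * int N * n' - (r + 2 * int N * l)\<^sup>2 = 4 * int N * n - r\<^sup>2"
    by (simp add: n'_def power2_eq_square algebra_simps)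
  then have disc': "4 * int N * n' - s\<^sup>2 \<le> - 1" using disc unfolding rs by simp
  define t0 where "t0 = real_of_int s / (2 * N)"
  have N': "real N > 0" using N by simp
  \<comment> \<open>The width 1 / (4 N) keeps t < 1 and 4 N^2 (t - t0)^2 <= 1/4, whereas the
    integral discriminant is at most -1.\<close>
  obtain t where t: "t0 < t" "t < t0 + 1 / (4 * N)" "t \<notin> \<rat>"
    using irrational_between[of t0 "t0 + 1 / (4 * N)"] N' by auto
  have "t0 \<ge> 0" using s by (simp add: t0_def)
  then have tpos: "0 < t" using t by simp
  have "t0 + 1 / (4 * N) \<le> 1"
  proof -
    have "real_of_int s \<le> 2 * real N - 1" using s by linarith
    then show ?thesis using N' by (simp add: t0_def field_simps)
  qed
  then have t1: "t < 1" using t by simp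
  have "\<not> of_int n' + t * of_int (- s) \<ge> - (N * t\<^sup>2)"
  proof -
    have "4 * N * (of_int n' + t * of_int (- s) + N * t\<^sup>2) = real_of_int (4 * int N * n' - s\<^sup>2) + 4 * (real N)\<^sup>2 * (t - t0)\<^sup>2"
      using N' by (simp add: t0_def power2_eq_square field_simps)
    also have "real_of_int (4 * int N * n' - s\<^sup>2) \<le> real_of_int (- 1)" using disc' by (simp only: of_int_le_iff)
    also have "real_of_int (- 1) + 4 * (real N)\<^sup>2 * (t - t0)\<^sup>2 < 0"
    proof -
      have "(t - t0)\<^sup>2 \<le> (1 / (4 * N))\<^sup>2" using t by (intro power_mono) auto
      then have "4 * (real N)\<^sup>2 * (t - t0)\<^sup>2 \<le> 4 * (real N)\<^sup>2 * (1 / (4 * N))\<^sup>2" by (intro mult_left_mono) auto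
      also have "\<dots> = 1 / 4" using N' by (simp add: power2_eq_square)
      finally show ?thesis by simp
    qed
    finally have "4 * N * (of_int n' + t * of_int (- s) + N * t\<^sup>2) < 0" by simp
    then have "of_int n' + t * of_int (- s) + N * t\<^sup>2 < 0" using N' by (simp add: mult_less_0_iff)
    then show ?thesis by simp
  qed
  then show "a (n, r) = 0" using nonneg[OF tpos t1 t(3), of n' "- s"] eq by auto
qed

lemma borcherds_power_expansion:
  assumes N: "N > 0" and c: "c > 0" and \<phi>: "\<phi> \<in> wh_jacobi_forms k (c * N)" and \<psi>: "\<psi> \<in> wh_jacobi_forms 0 N"
    and F: "F \<in> paramodular_forms k N" and B: "is_borcherds_product N \<psi> F"
    and TB: "is_theta_block (leading_exponents \<psi>) \<phi>"
  shows "\<exists>\<alpha>. has_jac_expansion (\<lambda>p. \<phi> p * exp_coeff (\<lambda>i. jacobi_V 0 i \<psi> p) m) \<alpha> \<and>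
    (\<forall>n r. 4 * int ((c + m) * N) * n - r\<^sup>2 < 0 \<longrightarrow> \<alpha> n r = 0)"
proof -
  obtain d where d: "has_jac_expansion (\<lambda>p. exp_coeff (\<lambda>i. jacobi_V 0 i \<psi> p) m) d"
    using exp_coeff_jac_expansion[of "\<lambda>i. jacobi_V 0 i \<psi>" m] has_jac_expansion_V[OF wh_jacobi_formsD(1)[OF \<psi>]] by blast
  define \<alpha> where "\<alpha> = (\<lambda>n r. \<Sum>\<^sub>\<infinity>p. jac_coeff \<phi> (fst p) (snd p) * d (n - fst p) (r - snd p))"
  have e: "has_jac_expansion (\<lambda>p. \<phi> p * exp_coeff (\<lambda>i. jacobi_V 0 i \<psi> p) m) \<alpha>"
    unfolding \<alpha>_def by (rule has_jac_expansion_mult[OF wh_jacobi_formsD(1)[OF \<phi>] d])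
  show ?thesis
    using e borcherds_coeff_holomorphic[OF F N c wh_jacobi_formsD(2)[OF \<phi>] B TB e] by blast
qed

lemma jacobi_V_jac_series_sum:
  assumes "finite S" "\<And>s. s \<in> S \<Longrightarrow> w s \<in> jac_space N \<theta> \<kappa>" "Im \<tau> > 0" "i > 0"
  shows "jacobi_V 0 i (jac_series (\<lambda>p. \<Sum>s\<in>S. x s * w s p)) (\<tau>, z) = (\<Sum>s\<in>S. x s * jacobi_V 0 i (jac_series (w s)) (\<tau>, z))"
proof -
  have "has_jac_expansion (\<lambda>p. \<Sum>s\<in>S. x s * jac_series (w s) p) (\<lambda>n r. \<Sum>s\<in>S. x s * w s (n, r))"
    using assms(1,2) by (intro has_jac_expansion_sum has_jac_expansion_scale) (auto simp: jac_space_def)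
  note eq = jac_series_eq[of "\<lambda>p. \<Sum>s\<in>S. x s * jac_series (w s) p" "\<lambda>p. \<Sum>s\<in>S. x s * w s p", OF this]
  have "jacobi_V 0 i (jac_series (\<lambda>p. \<Sum>s\<in>S. x s * w s p)) (\<tau>, z) = jacobi_V 0 i (\<lambda>p. \<Sum>s\<in>S. x s * jac_series (w s) p) (\<tau>, z)"
    using eq assms(3,4) by (rule jacobi_V_cong)
  then show ?thesis by (simp only: jacobi_V_sum)
qed

lemma finite_bounded_Ints: "finite {z :: complex. z \<in> \<int> \<and> norm z \<le> B}"
proof (rule finite_subset)
  show "{z :: complex. z \<in> \<int> \<and> norm z \<le> B} \<subseteq> of_int ` {- \<lceil>B\<rceil>..\<lceil>B\<rceil>}"
  proof
    fix z :: complex assume "z \<in> {z. z \<in> \<int> \<and> norm z \<le> B}"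
    then obtain j where j: "z = of_int j" "norm z \<le> B" by (auto elim: Ints_cases)
    then have "\<bar>real_of_int j\<bar> \<le> B" by simp
    then have "j \<in> {- \<lceil>B\<rceil>..\<lceil>B\<rceil>}" by (simp add: abs_le_iff) linarith
    then show "z \<in> of_int ` {- \<lceil>B\<rceil>..\<lceil>B\<rceil>}" using j(1) by blast
  qed
qed auto

theorem theorem5p2:
  fixes k :: int and N c :: nat and \<phi> :: "complex \<times> complex \<Rightarrow> complex"
  assumes "N > 0" and "c > 0"
    and "\<phi> \<in> jacobi_forms k (c * N)"
    and "basic_theta_block k (c * N) \<phi>"
  shows "finite {\<psi> \<in> wh_jacobi_forms 0 N.
           integral_singular_coeffs N \<psi> \<and>
           (\<exists>F \<in> paramodular_forms k N. is_borcherds_product N \<psi> F) \<and>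
           has_leading_theta_block \<psi> \<phi>}"
proof (rule ccontr)
  define X where "X = {\<psi> \<in> wh_jacobi_forms 0 N.
           integral_singular_coeffs N \<psi> \<and>
           (\<exists>F \<in> paramodular_forms k N. is_borcherds_product N \<psi> F) \<and>
           has_leading_theta_block \<psi> \<phi>}"
  assume "\<not> ?thesis"
  then have inf: "infinite X" by (simp add: X_def)
  note N = assms(1) and c = assms(2)
  have \<phi>: "\<phi> \<in> wh_jacobi_forms k (c * N)" using assms(3) by (simp add: jacobi_forms_def)
  note f = wh_jacobi_formsD(1)[OF \<phi>] and fT = wh_jacobi_formsD(2)[OF \<phi>]
  have cN: "c * N > 0" using N c by simp
  have wh: "\<psi> \<in> wh_jacobi_forms 0 N" if "\<psi> \<in> X" for \<psi> using that by (simp add: X_def)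
  have pw: "\<exists>\<alpha>. has_jac_expansion (\<lambda>p. \<phi> p * exp_coeff (\<lambda>i. jacobi_V 0 i \<psi> p) m) \<alpha> \<and>
    (\<forall>n r. 4 * int ((c + m) * N) * n - r\<^sup>2 < 0 \<longrightarrow> \<alpha> n r = 0)" if \<psi>: "\<psi> \<in> X" for \<psi> m
  proof -
    obtain F where "F \<in> paramodular_forms k N" "is_borcherds_product N \<psi> F" "is_theta_block (leading_exponents \<psi>) \<phi>"
      using \<psi> by (auto simp: X_def has_leading_theta_block_def)
    then show ?thesis by (rule borcherds_power_expansion[OF N c \<phi> wh[OF \<psi>]])
  qed

  \<comment> \<open>A lower bound for exponents, common to all forms in \<open>X\<close>\<close>
  obtain \<theta> :: real where \<theta>: "0 < \<theta>" "\<theta> < 1" "\<theta> \<notin> \<rat>" using irrational_between[of 0 1] by auto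

  \<comment> \<open>A member of \<open>X\<close> presents \<phi> as a theta block, so \<phi> does
    not vanish at slope \<theta>.\<close>
  have lead: "\<exists>n0 r0. is_leading t (jac_coeff \<phi>) n0 r0" if t: "t \<notin> \<rat>" for t
  proof -
    obtain \<psi>0 where "\<psi>0 \<in> X" using inf by (metis finite.emptyI ex_in_conv)
    then have "is_theta_block (leading_exponents \<psi>0) \<phi>" by (simp add: X_def has_leading_theta_block_def)
    then have nz: "\<phi> (\<i>, Complex 0 \<theta>) \<noteq> 0" using \<theta> by (intro theta_block_nonzero(3)) auto
    have "\<exists>n r. jac_coeff \<phi> n r \<noteq> 0"
    proof (rule ccontr)
      assume "\<not> ?thesis"
      then have z: "jac_coeff \<phi> = (\<lambda>n r. 0)" by (intro ext) blast
      have "((\<lambda>(n, r). jac_coeff \<phi> n r * ee (of_int n * \<i> + of_int r * Complex 0 \<theta>)) has_sum \<phi> (\<i>, Complex 0 \<theta>)) UNIV"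
        using f by (simp add: has_jac_expansion_def)
      then have "((\<lambda>_ :: int \<times> int. 0) has_sum \<phi> (\<i>, Complex 0 \<theta>)) UNIV" unfolding z by (simp add: case_prod_unfold)
      then show False using nz has_sum_unique has_sum_0_simp by blast
    qed
    then obtain n1 r1 where "jac_coeff \<phi> n1 r1 \<noteq> 0" by blast
    moreover obtain n0 where "\<forall>n r. jac_coeff \<phi> n r \<noteq> 0 \<longrightarrow> n0 \<le> n" using wh_jacobi_formsD(3)[OF \<phi>] by blast
    ultimately show ?thesis by (intro is_leading_exists[OF f fT cN t]) auto
  qed
  obtain n0 r0 where lead\<theta>: "is_leading \<theta> (jac_coeff \<phi>) n0 r0" using lead[OF \<theta>(3)] by blast
  \<comment> \<open>The coefficient with m = 1 is - \<phi> \<psi>, of index (c + 1) N. Additivity of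
    leading exponents gives this bound, in which \<psi> does not occur.\<close>
  define \<kappa> where "\<kappa> = - (real ((c + 1) * N) * \<theta>\<^sup>2) - (of_int n0 + \<theta> * of_int r0)"
  have exp1: "exp_coeff g 1 = - g 1" for g using exp_coeff_Suc[of g 0] by simp
  have \<kappa>: "\<kappa> \<le> of_int n + \<theta> * of_int r" if \<psi>: "\<psi> \<in> X" and nz: "jac_coeff \<psi> n r \<noteq> 0" for \<psi> n r
  proof -
    note g = wh_jacobi_formsD(1,2)[OF wh[OF \<psi>]]
    obtain m0 where "\<forall>n r. jac_coeff \<psi> n r \<noteq> 0 \<longrightarrow> m0 \<le> n" using wh_jacobi_formsD(3)[OF wh[OF \<psi>]] by blast
    then have "\<exists>n1 r1. is_leading \<theta> (jac_coeff \<psi>) n1 r1"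
      by (intro is_leading_exists[OF g N \<theta>(3) nz]) auto
    then obtain n1 r1 where lead\<psi>: "is_leading \<theta> (jac_coeff \<psi>) n1 r1" by blast
    obtain \<alpha> where \<alpha>: "has_jac_expansion (\<lambda>p. \<phi> p * exp_coeff (\<lambda>i. jacobi_V 0 i \<psi> p) 1) \<alpha>"
      "\<And>n r. 4 * int ((c + 1) * N) * n - r\<^sup>2 < 0 \<Longrightarrow> \<alpha> n r = 0"
      using pw[OF \<psi>, of 1] by blast
    have "has_jac_expansion (\<lambda>p. \<phi> p * \<psi> p ^ 1) (\<lambda>n r. (- 1) * \<alpha> n r)"
      using has_jac_expansion_scale[OF \<alpha>(1), of "- 1"] unfolding exp1 jacobi_V_1 by simp
    then have "- (real ((c + 1) * N) * \<theta>\<^sup>2) \<le> of_int n0 + \<theta> * of_int r0 + real 1 * (of_int n1 + \<theta> * of_int r1)"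
      by (rule leading_exponent_bound[OF f g(1)]) (use N \<alpha>(2) \<theta> lead\<theta> lead\<psi> in auto)
    then show ?thesis using is_leading_min[OF lead\<psi> nz] by (simp add: \<kappa>_def)
  qed

  \<comment> \<open>Finitely many coordinates and a sequence with unbounded coordinates\<close>
  define C where "C = (\<lambda>\<psi> p. jac_coeff \<psi> (fst p) (snd p))"
  have CJ: "has_jac_expansion \<psi> (\<lambda>n r. C \<psi> (n, r))" if "\<psi> \<in> X" for \<psi>
    using wh_jacobi_formsD(1)[OF wh[OF that]] by (simp add: C_def)
  have Cser: "jac_series (C \<psi>) (\<tau>, z) = \<psi> (\<tau>, z)" if "\<psi> \<in> X" "Im \<tau> > 0" for \<psi> \<tau> z
    by (rule jac_series_eq[OF CJ[OF that(1)] that(2)])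
  have CW: "C \<psi> \<in> jac_space N \<theta> \<kappa>" if "\<psi> \<in> X" for \<psi>
    unfolding jac_space_def
    using has_jac_expansion_jac_series[OF CJ[OF that]] jacobi_transform_cong[OF wh_jacobi_formsD(2)[OF wh[OF that]] Cser[OF that]] \<kappa>[OF that]
    by (simp add: C_def)
  have "\<exists>T w. T \<subseteq> singular_window N \<theta> \<kappa> \<and> (\<forall>s\<in>T. w s \<in> jac_space N \<theta> \<kappa>) \<and>
      (\<forall>a\<in>jac_space N \<theta> \<kappa>. \<forall>i. a i = (\<Sum>s\<in>T. a s * w s i))"
    by (rule finitely_determined_basis[OF finite_singular_window jac_space_0 jac_space_lincomb jac_space_determined[OF _ N]])
  then obtain T w where T: "T \<subseteq> singular_window N \<theta> \<kappa>" and w_all: "\<forall>s\<in>T. w s \<in> jac_space N \<theta> \<kappa>"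
    and rep_all: "\<forall>a\<in>jac_space N \<theta> \<kappa>. \<forall>i. a i = (\<Sum>s\<in>T. a s * w s i)"
    by blast
  note w = w_all[rule_format] and rep = rep_all[rule_format]
  have finT: "finite T" using T finite_singular_window finite_subset by blast
  define M where "M = (\<lambda>\<psi>. \<Sum>s\<in>T. norm (C \<psi> s))"
  have CM: "norm (C \<psi> s) \<le> M \<psi>" if "s \<in> T" for \<psi> s
    unfolding M_def using that finT by (intro member_le_sum) auto
  \<comment> \<open>Bounded integers take finitely many values, and the coordinates at T determine
    \<open>C \<psi>\<close>, hence \<psi> as an extensional function.\<close>
  have unbounded: "\<exists>\<psi>\<in>X. B < M \<psi>" for B
  proof (rule ccontr)
    assume "\<not> ?thesis"
    then have bd: "\<And>\<psi>. \<psi> \<in> X \<Longrightarrow> M \<psi> \<le> B" by (auto simp: not_less)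
    have "C \<psi> s \<in> \<int>" if \<psi>: "\<psi> \<in> X" and s: "s \<in> T" for \<psi> s
    proof -
      have "4 * int N * fst s - (snd s)\<^sup>2 \<le> 0" using s T by (auto simp: singular_window_def)
      then show ?thesis using \<psi> unfolding C_def X_def integral_singular_coeffs_def by blast
    qed
    then have "(\<lambda>\<psi>. restrict (C \<psi>) T) ` X \<subseteq> (\<Pi>\<^sub>E s\<in>T. {z. z \<in> \<int> \<and> norm z \<le> B})"
      using CM bd by (fastforce intro: order_trans)
    then have "finite ((\<lambda>\<psi>. restrict (C \<psi>) T) ` X)"
      by (rule finite_subset) (intro finite_PiE finT finite_bounded_Ints)
    moreover have "inj_on (\<lambda>\<psi>. restrict (C \<psi>) T) X"
    proof (rule inj_onI)
      fix \<psi> \<psi>' assume \<psi>: "\<psi> \<in> X" "\<psi>' \<in> X" and eq: "restrict (C \<psi>) T = restrict (C \<psi>') T"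
      have "C \<psi> s = C \<psi>' s" if "s \<in> T" for s using fun_cong[OF eq, of s] that by simp
      then have "C \<psi> i = C \<psi>' i" for i
        unfolding rep[OF CW[OF \<psi>(1)], of i] rep[OF CW[OF \<psi>(2)], of i] by (intro sum.cong) auto
      then have CC: "C \<psi> = C \<psi>'" by (rule ext)
      show "\<psi> = \<psi>'"
      proof (rule extensionalityI[where A = jac_domain])
        show "\<psi> \<in> extensional jac_domain" "\<psi>' \<in> extensional jac_domain"
          using wh[OF \<psi>(1)] wh[OF \<psi>(2)] by (simp_all add: wh_jacobi_forms_def)
        fix p assume "p \<in> jac_domain"
        then obtain \<tau> z where p: "p = (\<tau>, z)" "Im \<tau> > 0" by (auto simp: jac_domain_def)
        show "\<psi> p = \<psi>' p" unfolding p(1) Cser[OF \<psi>(1) p(2), symmetric] Cser[OF \<psi>(2) p(2), symmetric] CC ..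
      qed
    qed
    ultimately show False using inf finite_imageD by blast
  qed
  then have "\<forall>j. \<exists>\<psi>. \<psi> \<in> X \<and> real j + 1 < M \<psi>" by blast
  from choice[OF this] obtain \<Psi>0 where \<Psi>0: "\<And>j :: nat. \<Psi>0 j \<in> X" "\<And>j. real j + 1 < M (\<Psi>0 j)" by blast
  \<comment> \<open>Coordinates normalised so that their absolute values add up to 1.\<close>
  define y where "y = (\<lambda>j s. C (\<Psi>0 j) s / of_real (M (\<Psi>0 j)))"
  have y1: "norm (y j s) \<le> 1" if "s \<in> T" for j s
  proof -
    have "M (\<Psi>0 j) > 0" using \<Psi>0(2)[of j] by linarith
    then show ?thesis using CM[OF that, of "\<Psi>0 j"] by (simp add: y_def norm_divide)
  qed
  have "\<exists>\<rho> x. strict_mono (\<rho> :: nat \<Rightarrow> nat) \<and> (\<forall>s\<in>T. (\<lambda>j. y (\<rho> j) s) \<longlonglongrightarrow> x s)"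
    by (rule convergent_subsequence_finite[OF finT]) (rule y1)
  then obtain \<rho> :: "nat \<Rightarrow> nat" and x where \<rho>: "strict_mono \<rho>" and x_all: "\<forall>s\<in>T. (\<lambda>j. y (\<rho> j) s) \<longlonglongrightarrow> x s"
    by blast
  note x = x_all[rule_format]
  define \<Psi> where "\<Psi> = (\<lambda>j. \<Psi>0 (\<rho> j))"
  have \<Psi>: "\<Psi> j \<in> X" for j by (simp add: \<Psi>_def \<Psi>0)
  have M\<Psi>: "real j + 1 < M (\<Psi> j)" for j
    using \<Psi>0(2)[of "\<rho> j"] seq_suble[OF \<rho>, of j] unfolding \<Psi>_def by linarith
  have Mpos: "M (\<Psi> j) > 0" for j using M\<Psi>[of j] by linarith
  have y\<Psi>: "y (\<rho> j) s = 1 / of_real (M (\<Psi> j)) * C (\<Psi> j) s" for j s by (simp add: y_def \<Psi>_def)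
  have Minv: "(\<lambda>j. 1 / complex_of_real (M (\<Psi> j))) \<longlonglongrightarrow> 0"
  proof (rule tendsto_norm_zero_cancel, rule tendsto_sandwich)
    show "\<forall>\<^sub>F j in sequentially. 0 \<le> norm (1 / complex_of_real (M (\<Psi> j)))" by simp
    show "\<forall>\<^sub>F j in sequentially. norm (1 / complex_of_real (M (\<Psi> j))) \<le> inverse (real (Suc j))"
    proof (intro always_eventually allI)
      fix j show "norm (1 / complex_of_real (M (\<Psi> j))) \<le> inverse (real (Suc j))"
        using M\<Psi>[of j] Mpos[of j] by (simp add: norm_divide inverse_eq_divide frac_le)
    qed
    show "(\<lambda>j. inverse (real (Suc j))) \<longlonglongrightarrow> 0" by (rule LIMSEQ_inverse_real_of_nat)
  qed simp

  \<comment> \<open>The limit form and its nonvanishing\<close>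
  define D where "D = (\<lambda>i. \<Sum>s\<in>T. x s * w s i)"
  have DW: "D \<in> jac_space N \<theta> \<kappa>" unfolding D_def by (rule jac_space_sum[OF finT w])
  \<comment> \<open>The representation through the \<open>w s\<close>, evaluated at t in T, passes
    to the limit.\<close>
  have Dx: "D t = x t" if t: "t \<in> T" for t
  proof (rule LIMSEQ_unique)
    show "(\<lambda>j. y (\<rho> j) t) \<longlonglongrightarrow> x t" by (rule x[OF t])
    have "y (\<rho> j) t = (\<Sum>s\<in>T. y (\<rho> j) s * w s t)" for j
      unfolding y\<Psi> by (subst rep[OF CW[OF \<Psi>]]) (simp add: sum_distrib_left mult.assoc)
    moreover have "(\<lambda>j. \<Sum>s\<in>T. y (\<rho> j) s * w s t) \<longlonglongrightarrow> D t"
      unfolding D_def by (intro tendsto_sum tendsto_mult_right x)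
    ultimately show "(\<lambda>j. y (\<rho> j) t) \<longlonglongrightarrow> D t" by simp
  qed
  \<comment> \<open>A finite sum of absolute values equal to 1 along the sequence is 1 in the
    limit.\<close>
  have "\<exists>t\<in>T. x t \<noteq> 0"
  proof (rule ccontr)
    assume "\<not> ?thesis"
    then have x0: "x s = 0" if "s \<in> T" for s using that by blast
    have "(\<lambda>j. \<Sum>s\<in>T. norm (y (\<rho> j) s)) \<longlonglongrightarrow> (\<Sum>s\<in>T. norm (x s))" by (intro tendsto_sum tendsto_norm x)
    moreover have "(\<Sum>s\<in>T. norm (y (\<rho> j) s)) = 1" for j
    proof -
      have "(\<Sum>s\<in>T. norm (y (\<rho> j) s)) = (\<Sum>s\<in>T. norm (C (\<Psi> j) s)) / M (\<Psi> j)"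
        using Mpos[of j] by (simp add: y_def \<Psi>_def norm_divide sum_divide_distrib)
      also have "\<dots> = 1" using Mpos[of j] by (simp add: M_def)
      finally show ?thesis .
    qed
    ultimately have "(\<Sum>s\<in>T. norm (x s)) = 1" by (simp add: LIMSEQ_const_iff)
    then show False by (simp add: x0)
  qed
  then obtain t0 where t0: "D t0 \<noteq> 0" using Dx by metis

  \<comment> \<open>Powers of the limit form\<close>
  define S where "S = {(\<tau> :: complex, z :: complex). Im \<tau> = 1 \<and> Im z = 0}"
  define G where "G = (\<lambda>i. jacobi_V 0 i (jac_series D))"
  have bddV: "bounded (jacobi_V 0 i (jac_series a) ` S)" if a: "a \<in> jac_space N \<theta> \<kappa>" and i: "i > 0" for a i
  proof -
    have "has_jac_expansion (jac_series a) (\<lambda>n r. a (n, r))" using a by (simp add: jac_space_def)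
    from has_jac_expansion_V[OF this i, of 0] obtain d where d: "has_jac_expansion (jacobi_V 0 i (jac_series a)) d" by blast
    obtain B where "\<And>\<tau> z. Im \<tau> = 1 \<Longrightarrow> Im z = 0 \<Longrightarrow> norm (jacobi_V 0 i (jac_series a) (\<tau>, z)) \<le> B"
      using jac_expansion_bounded[OF d, of 1 0] by auto
    then show ?thesis unfolding bounded_iff S_def by auto
  qed
  \<comment> \<open>V_i is linear, so the scaled images are combinations, with convergent
    coefficients, of fixed functions bounded on \<open>S\<close>.\<close>
  have lim: "uniform_limit S (\<lambda>j p. 1 / of_real (M (\<Psi> j)) * jacobi_V 0 i (\<Psi> j) p) (G i) sequentially" if i: "i > 0" for i
  proof -
    have "uniform_limit S (\<lambda>j p. \<Sum>s\<in>T. y (\<rho> j) s * jacobi_V 0 i (jac_series (w s)) p) (\<lambda>p. \<Sum>s\<in>T. x s * jacobi_V 0 i (jac_series (w s)) p) sequentially"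
      by (intro uniform_limit_sum finT uniform_limit_scalar_mult x uniform_limit_const bddV w i)
    note u = this
    have e1: "(\<Sum>s\<in>T. y (\<rho> j) s * jacobi_V 0 i (jac_series (w s)) p) = 1 / of_real (M (\<Psi> j)) * jacobi_V 0 i (\<Psi> j) p"
      if p: "p \<in> S" for j p
    proof -
      obtain \<tau> z where pz: "p = (\<tau>, z)" and \<tau>: "Im \<tau> > 0" using p by (auto simp: S_def)
      have "C (\<Psi> j) = (\<lambda>i. \<Sum>s\<in>T. C (\<Psi> j) s * w s i)" by (rule ext, rule rep[OF CW[OF \<Psi>]])
      moreover have "jacobi_V 0 i (\<Psi> j) p = jacobi_V 0 i (jac_series (C (\<Psi> j))) p"
        unfolding pz by (rule jacobi_V_cong[OF _ \<tau> i]) (rule Cser[OF \<Psi>, symmetric])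
      ultimately have "jacobi_V 0 i (\<Psi> j) p = jacobi_V 0 i (jac_series (\<lambda>i. \<Sum>s\<in>T. C (\<Psi> j) s * w s i)) p" by simp
      also have "\<dots> = (\<Sum>s\<in>T. C (\<Psi> j) s * jacobi_V 0 i (jac_series (w s)) p)"
        unfolding pz by (rule jacobi_V_jac_series_sum[OF finT w \<tau> i])
      finally show ?thesis unfolding y\<Psi> by (simp only: sum_distrib_left mult.assoc)
    qed
    have e2: "(\<Sum>s\<in>T. x s * jacobi_V 0 i (jac_series (w s)) p) = G i p" if p: "p \<in> S" for p
    proof -
      obtain \<tau> z where pz: "p = (\<tau>, z)" and \<tau>: "Im \<tau> > 0" using p by (auto simp: S_def)
      show ?thesis unfolding pz G_def D_def by (rule jacobi_V_jac_series_sum[OF finT w \<tau> i, symmetric])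
    qed
    have "uniform_limit S (\<lambda>j p. \<Sum>s\<in>T. y (\<rho> j) s * jacobi_V 0 i (jac_series (w s)) p) (\<lambda>p. \<Sum>s\<in>T. x s * jacobi_V 0 i (jac_series (w s)) p) sequentially
      \<longleftrightarrow> uniform_limit S (\<lambda>j p. 1 / of_real (M (\<Psi> j)) * jacobi_V 0 i (\<Psi> j) p) (G i) sequentially"
      by (rule uniform_limit_cong') (erule e1, erule e2)
    then show ?thesis using u by (rule iffD1)
  qed
  note DW' = DW[unfolded jac_space_def mem_Collect_eq]
  note D_exp = DW'[THEN conjunct1] and D_T = DW'[THEN conjunct2, THEN conjunct1]
    and D_\<kappa> = DW'[THEN conjunct2, THEN conjunct2, rule_format]
  have power: "\<exists>e. has_jac_expansion (\<lambda>p. \<phi> p * jac_series D p ^ m) e \<and>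
      (\<forall>n r. 4 * int ((c + m) * N) * n - r\<^sup>2 < 0 \<longrightarrow> e n r = 0)" for m
  proof -
    have "\<forall>j. \<exists>\<alpha>. has_jac_expansion (\<lambda>p. \<phi> p * exp_coeff (\<lambda>i. jacobi_V 0 i (\<Psi> j) p) m) \<alpha> \<and>
      (\<forall>n r. 4 * int ((c + m) * N) * n - r\<^sup>2 < 0 \<longrightarrow> \<alpha> n r = 0)" by (rule allI, rule pw[OF \<Psi>])
    from choice[OF this] obtain \<alpha> where \<alpha>_all: "\<forall>j. has_jac_expansion (\<lambda>p. \<phi> p * exp_coeff (\<lambda>i. jacobi_V 0 i (\<Psi> j) p) m) (\<alpha> j) \<and>
      (\<forall>n r. 4 * int ((c + m) * N) * n - r\<^sup>2 < 0 \<longrightarrow> \<alpha> j n r = 0)" by (elim exE)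
    note \<alpha> = \<alpha>_all[rule_format, THEN conjunct1] \<alpha>_all[rule_format, THEN conjunct2, rule_format]
    obtain d where d: "has_jac_expansion (\<lambda>p. jac_series D p ^ m) d"
      using has_jac_expansion_power[OF D_exp] by blast
    obtain e where e: "has_jac_expansion (\<lambda>p. \<phi> p * jac_series D p ^ m) e"
      using has_jac_expansion_mult[OF f d] by blast
    have "uniform_limit S (\<lambda>j p. (1 / of_real (M (\<Psi> j))) ^ m * exp_coeff (\<lambda>i. jacobi_V 0 i (\<Psi> j) p) m) (\<lambda>p. (- G 1 p) ^ m / fact m) sequentially"
      by (rule exp_coeff_uniform_limit[OF lim _ Minv]) (auto simp: G_def intro: bddV DW)
    then have u: "uniform_limit S (\<lambda>j p. (1 / of_real (M (\<Psi> j))) ^ m * exp_coeff (\<lambda>i. jacobi_V 0 i (\<Psi> j) p) m) (\<lambda>p. (- jac_series D p) ^ m / fact m) sequentially"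
      unfolding G_def jacobi_V_1 .
    have "e n r = 0" if "4 * int ((c + m) * N) * n - r\<^sup>2 < 0" for n r
      by (rule limit_power_holomorphic[OF f \<alpha>(1) \<alpha>(2)[OF that] u[unfolded S_def] e])
    then show ?thesis using e by blast
  qed

  \<comment> \<open>Vanishing of the limit form\<close>
  have "D = (\<lambda>_. 0)"
  proof (rule jac_space_holomorphic_if_exponents_nonneg[OF DW N])
    fix t :: real and n r :: int assume t: "0 < t" "t < 1" "t \<notin> \<rat>" and nz: "D (n, r) \<noteq> 0"
    obtain m0 s0 where l\<phi>: "is_leading t (jac_coeff \<phi>) m0 s0" using lead[OF t(3)] by blast
    \<comment> \<open>The bound \<kappa> refers to the fixed slope \<theta>, but on the strip |r| <=
      N it bounds n from below, which suffices for every slope t.\<close>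
    have "\<exists>n1 r1. is_leading t (\<lambda>n r. D (n, r)) n1 r1"
    proof (rule is_leading_exists[OF D_exp D_T N t(3) nz])
      fix n' r' assume r': "\<bar>r'\<bar> \<le> int N" and "D (n', r') \<noteq> 0"
      from D_\<kappa>[OF this(2)] have k: "\<kappa> \<le> of_int n' + \<theta> * of_int r'" .
      have "\<theta> * of_int r' \<le> \<theta> * real N" using r' \<theta> by (intro mult_left_mono) linarith+
      then show "\<lfloor>\<kappa> - \<theta> * real N\<rfloor> \<le> n'" using k by linarith
    qed
    then obtain n1 r1 where lD: "is_leading t (\<lambda>n r. D (n, r)) n1 r1" by blast
    define E0 E1 where "E0 = of_int m0 + t * of_int s0" and "E1 = of_int n1 + t * of_int r1"
    have ineq: "- (real ((c + m) * N) * t\<^sup>2) \<le> E0 + real m * E1" for m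
    proof -
      obtain e where e: "has_jac_expansion (\<lambda>p. \<phi> p * jac_series D p ^ m) e"
        "\<And>n r. 4 * int ((c + m) * N) * n - r\<^sup>2 < 0 \<Longrightarrow> e n r = 0" using power[of m] by blast
      show ?thesis unfolding E0_def E1_def
        by (rule leading_exponent_bound[OF f D_exp e(1) _ e(2) _ _ l\<phi> lD]) (use N c t in auto)
    qed
    \<comment> \<open>The index (c + m) N grows with m at rate N, the index of D. A negative value
      here, multiplied by a large m, would outweigh the fixed part E0 + c N t^2.\<close>
    have "E1 + N * t\<^sup>2 \<ge> 0"
    proof (rule ccontr)
      assume "\<not> ?thesis"
      then have neg: "- (E1 + N * t\<^sup>2) > 0" by simp
      obtain m where "E0 + real (c * N) * t\<^sup>2 < real m * (- (E1 + N * t\<^sup>2))"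
        using reals_Archimedean3[OF neg] by blast
      with ineq[of m] show False by (simp add: algebra_simps)
    qed
    then show "- (N * t\<^sup>2) \<le> of_int n + t * of_int r"
      using is_leading_min[OF lD, of n r] nz by (simp add: E1_def)
  qed
  then show False using t0 by simp
qed

end
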